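(* There exist $h_0>0$ and positive constants $C,c$, independent of $\alpha$, of the ratios $\overline\alpha_i/\underline\alpha_i$, and of $h_i$ and $H_i$ for $i=1,\dots,N$, such that for all $h<h_0$, $k\in\{2,3\}$ and $u\in V_h$, $$\|T_A^{(k)}u\|_a\le C\|u\|_a,$$ $$a_h^{FE}(T_A^{(k)}u,u)\ge c\left(\max_{i=1,\dots,N}\frac{\overline\alpha_i}{\underline\alpha_i}\frac{H_i^2}{h_i^2}\right)^{-1}a_h^{FE}(u,u).$$
   Context: Domain and coefficient: $\Omega\subset\mathbb{R}^2$ is a bounded convex (polygonal) domain. There is a nonoverlapping partition of $\Omega$ into open connected Lipschitz polytopes $D_1,\dots,D_n$ with $\bar\Omega=\bigcup_j\bar D_j$; the coefficient satisfies $\alpha\in W^{1,\infty}(D_j)$ with $|\alpha|_{1,\infty,D_j}\le C$ for each $j$, and $\alpha\ge\alpha_0\ge 1$. Mesh: $\mathcal{T}_h$ is a quasiuniform triangulation of $\Omega$ into closed triangles, $h=\max_K \mathrm{diam}(K)$; triangle boundaries are aligned with the $\partial D_j$, so $\alpha\in W^{1,\infty}(K)$ for every $K$. $\mathrm{E}_h^{in}$ is the set of interior edges, and $m_e$ is the midpoint of the edge $e$. In each $K$ an interior point $z_K$ is chosen and joined by segments to the vertices of $K$, splitting $K$ into three subtriangles, one per edge; for $e\in\mathrm{E}_h^{in}$ the control volume $b_e$ is the union of the two subtriangles having $e$ as a common edge. Spaces and forms: $V_h$ is the Crouzeix-Raviart space of functions $v\in L^2(\Omega)$ with $v|_K$ affine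 for each $K$, continuous at midpoints of interior edges, and zero at midpoints of edges on $\partial\Omega$. $I_h^*v=\sum_{e\in\mathrm{E}_h^{in}}v(m_e)\chi_e$ with $\chi_e$ the characteristic function of $b_e$. For $u,v\in V_h$, $$a_h^{FE}(u,v)=\sum_{K\in\mathcal{T}_h}\int_K\alpha\nabla u\cdot\nabla v\,dx,\qquad a_h^{FV}(u,I_h^*v)=-\sum_{e\in\mathrm{E}_h^{in}}v(m_e)\int_{\partial b_e}\alpha\nabla u\cdot\mathbf n\,ds,$$ with $\mathbf n$ the outward unit normal to $b_e$, and $\|u\|_a=\sqrt{a_h^{FE}(u,u)}$. Subdomains: $\bar\Omega=\bigcup_{i=1}^N\bar\Omega_i$ is another nonoverlapping partition into open connected Lipschitz polytopes, forming a shape regular coarse partition, with boundaries of triangles of $\mathcal{T}_h$ aligned with the $\partial\Omega_i$. $\mathcal{T}_h(\Omega_i)$, the restriction of $\mathcal{T}_h$ to $\Omega_i$, is shape regular and quasiuniform with mesh parameter $h_i$; $H_i=\mathrm{diam}(\Omega_i)$. $\Omega_{ih}^{CR}$ and $\partial\Omega_{ih}^{CR}$ are the sets of edge midpoints lying in $\Omega_i$ and on $\partial\Omega_i$, respectively. $\Omega_i^\delta$ is the union of the triangles in $\mathcal{T}_h(\Omega_i)$ that touch $\partial\Omega_i$ (with an edge or a vertex), and $\overline\alpha_i=\sup_{x\in\bar\Omega_i^\delta}\alpha(x)$, $\underline\alpha_i=\inf_{x\in\bar\Omega_i^\delta}\alpha(x)$. Decomposition: for $i=1,\dots,N$, $V_i\subset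 V_h$ consists of the functions in $V_h$ vanishing at the nodes of $\partial\Omega_{ih}^{CR}$ and on all the other subdomains. The coarse space $V_0\subset V_h$ is the range of $I_A:V_h\to V_h$, where $I_Au(x)=u(x)$ for $x\in\partial\Omega_{ih}^{CR}$ and $I_Au(x)=\hat u_i:=\frac1{n_i}\sum_{y\in\partial\Omega_{ih}^{CR}}u(y)$ for $x\in\Omega_{ih}^{CR}$ ($i=1,\dots,N$), $n_i$ being the number of points of $\partial\Omega_{ih}^{CR}$. Operators: for $i=0,\dots,N$ define $T_i^{(2)},T_i^{(3)}:V_h\to V_i$ by $$a_h^{FE}(T_i^{(2)}u,v)=a_h^{FV}(u,I_h^*v),\qquad a_h^{FV}(T_i^{(3)}u,I_h^*v)=a_h^{FV}(u,I_h^*v)\qquad\forall v\in V_i,$$ and $T_A^{(k)}=\sum_{i=0}^N T_i^{(k)}$ for $k=2,3$. *)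

theory Defs
  imports "HOL-Analysis.Analysis"
begin

type_synonym point = "real^2"


section \<open>Domains, partitions and coefficients\<close>

text \<open>A (not necessarily convex) polytope: a domain whose closure is a finite union of convex
  polytopes and which is locally the region strictly below a Lipschitz graph in some orthonormal
  coordinate system.\<close>

definition lipschitz_polytope :: "point set \<Rightarrow> bool" where
  "lipschitz_polytope D \<longleftrightarrow>
     open D \<and> connected D \<and> D \<noteq> {} \<and>
     (\<exists>P. finite P \<and> (\<forall>p\<in>P. polytope p) \<and> closure D = \<Union>P) \<and>
     (\<forall>x\<in>frontier D. \<exists>U t n g L. open U \<and> x \<in> U \<and>
        norm t = 1 \<and> norm n = 1 \<and> t \<bullet> n = 0 \<and>
        L-lipschitz_on (UNIV :: real set) g \<and>
        D \<inter> U = {y\<in>U. y \<bullet> n < g (y \<bullet> t)})"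

definition polygonal_domain :: "point set \<Rightarrow> bool" where
  "polygonal_domain \<Omega> \<longleftrightarrow> open \<Omega> \<and> convex \<Omega> \<and> \<Omega> \<noteq> {} \<and> polytope (closure \<Omega>)"

definition nonoverlapping_partition :: "point set \<Rightarrow> nat \<Rightarrow> (nat \<Rightarrow> point set) \<Rightarrow> bool" where
  "nonoverlapping_partition \<Omega> n D \<longleftrightarrow>
     (\<forall>j\<in>{1..n}. lipschitz_polytope (D j) \<and> D j \<subseteq> \<Omega>) \<and>
     disjoint_family_on D {1..n} \<and>
     closure \<Omega> = (\<Union>j\<in>{1..n}. closure (D j))"

definition partial :: "2 \<Rightarrow> (point \<Rightarrow> real) \<Rightarrow> point \<Rightarrow> real" where
  "partial i f x = frechet_derivative f (at x) (axis i 1)"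

primrec C_k :: "nat \<Rightarrow> (point \<Rightarrow> real) \<Rightarrow> bool" where
  "C_k 0 f \<longleftrightarrow> continuous_on UNIV f"
| "C_k (Suc k) f \<longleftrightarrow> f differentiable_on UNIV \<and> (\<forall>i. C_k k (partial i f))"

definition test_function :: "point set \<Rightarrow> (point \<Rightarrow> real) \<Rightarrow> bool" where
  "test_function D \<phi> \<longleftrightarrow> (\<forall>k. C_k k \<phi>) \<and>
     compact (closure {x. \<phi> x \<noteq> 0}) \<and> closure {x. \<phi> x \<noteq> 0} \<subseteq> D"

definition Linf_norm_le :: "point set \<Rightarrow> (point \<Rightarrow> real) \<Rightarrow> real \<Rightarrow> bool" where
  "Linf_norm_le D f B \<longleftrightarrow>
     f \<in> borel_measurable (lebesgue_on D) \<and> (AE x in lebesgue_on D. \<bar>f x\<bar> \<le> B)"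

definition weak_partial :: "point set \<Rightarrow> 2 \<Rightarrow> (point \<Rightarrow> real) \<Rightarrow> (point \<Rightarrow> real) \<Rightarrow> bool" where
  "weak_partial D i f g \<longleftrightarrow>
     (\<forall>\<phi>. test_function D \<phi> \<longrightarrow>
        (LINT x|lebesgue_on D. f x * partial i \<phi> x) = - (LINT x|lebesgue_on D. g x * \<phi> x))"

text \<open>\<open>f \<in> W\<^sup>1\<^sup>,\<^sup>\<infinity>(D)\<close> with seminorm (the larger of the two \<open>L\<^sup>\<infinity>\<close> norms of the weak first
  partial derivatives) at most \<open>M\<close>.\<close>

definition W1inf_seminorm_le :: "point set \<Rightarrow> (point \<Rightarrow> real) \<Rightarrow> real \<Rightarrow> bool" where
  "W1inf_seminorm_le D f M \<longleftrightarrow>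
     (\<exists>B. Linf_norm_le D f B) \<and> (\<forall>i. \<exists>g. weak_partial D i f g \<and> Linf_norm_le D g M)"

text \<open>Line integrals and pointwise suprema of \<open>\<alpha>\<close> occur below, so \<open>\<alpha>\<close> denotes the continuous
  representative of its class on each \<open>D j\<close>.  Its values off the union of the \<open>D j\<close>, i.e. on the
  interfaces, are arbitrary and never matter.\<close>

definition coefficient ::
    "nat \<Rightarrow> (nat \<Rightarrow> point set) \<Rightarrow> real \<Rightarrow> real \<Rightarrow> (point \<Rightarrow> real) \<Rightarrow> bool" where
  "coefficient n D M \<alpha>0 \<alpha> \<longleftrightarrow> 1 \<le> \<alpha>0 \<and>
     (\<forall>j\<in>{1..n}. continuous_on (D j) \<alpha> \<and> W1inf_seminorm_le (D j) \<alpha> M \<and> (\<forall>x\<in>D j. \<alpha>0 \<le> \<alpha> x))"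


section \<open>Meshes\<close>

definition mesh_size :: "point set set \<Rightarrow> real" where
  "mesh_size \<T> = Max (diameter ` \<T>)"

definition shape_regular :: "real \<Rightarrow> point set set \<Rightarrow> bool" where
  "shape_regular \<sigma> \<T> \<longleftrightarrow> (\<forall>K\<in>\<T>. \<exists>x. ball x (diameter K / \<sigma>) \<subseteq> K)"

definition quasiuniform :: "real \<Rightarrow> point set set \<Rightarrow> bool" where
  "quasiuniform \<sigma> \<T> \<longleftrightarrow> (\<forall>K\<in>\<T>. \<exists>x. ball x (mesh_size \<T> / \<sigma>) \<subseteq> K)"

definition aligned :: "point set set \<Rightarrow> point set \<Rightarrow> bool" where
  "aligned \<T> S \<longleftrightarrow> frontier S \<subseteq> (\<Union>K\<in>\<T>. frontier K)"

text \<open>\<open>triangulation\<close> includes conformity: two triangles meet in a common face or not at all.\<close>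

definition fine_mesh ::
    "real \<Rightarrow> point set \<Rightarrow> nat \<Rightarrow> (nat \<Rightarrow> point set) \<Rightarrow> point set set \<Rightarrow> bool" where
  "fine_mesh \<sigma> \<Omega> n D \<T> \<longleftrightarrow>
     triangulation \<T> \<and> (\<forall>K\<in>\<T>. 2 simplex K) \<and> \<Union>\<T> = closure \<Omega> \<and>
     quasiuniform \<sigma> \<T> \<and> (\<forall>j\<in>{1..n}. aligned \<T> (D j))"

definition mesh_on :: "point set set \<Rightarrow> point set \<Rightarrow> point set set" where
  "mesh_on \<T> S = {K\<in>\<T>. K \<subseteq> closure S}"

definition edges :: "point set set \<Rightarrow> point set set" where
  "edges \<T> = {e. \<exists>K\<in>\<T>. e edge_of K}"

definition interior_edges :: "point set \<Rightarrow> point set set \<Rightarrow> point set set" where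
  "interior_edges \<Omega> \<T> = {e\<in>edges \<T>. \<not> e \<subseteq> frontier \<Omega>}"

definition edge_mid :: "point set \<Rightarrow> point" where
  "edge_mid e = (THE m. \<exists>a b. e = closed_segment a b \<and> m = midpoint a b)"

definition mids :: "point set set \<Rightarrow> point set" where
  "mids \<T> = edge_mid ` edges \<T>"

definition cr_interior :: "point set set \<Rightarrow> point set \<Rightarrow> point set" where
  "cr_interior \<T> S = mids \<T> \<inter> S"

definition cr_boundary :: "point set set \<Rightarrow> point set \<Rightarrow> point set" where
  "cr_boundary \<T> S = mids \<T> \<inter> frontier S"

definition control_volume ::
    "point set set \<Rightarrow> (point set \<Rightarrow> point) \<Rightarrow> point set \<Rightarrow> point set" where
  "control_volume \<T> z e = (\<Union>K\<in>{K\<in>\<T>. e edge_of K}. convex hull (insert (z K) e))"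


section \<open>Subdomains\<close>

text \<open>Shape regularity of the subdomains: after scaling by its diameter, each closed subdomain is
  bi-Lipschitz equivalent to the closed unit disc, with a fixed constant.  In particular
  subdomains have no holes.\<close>

definition coarse_shape_regular :: "real \<Rightarrow> nat \<Rightarrow> (nat \<Rightarrow> point set) \<Rightarrow> bool" where
  "coarse_shape_regular \<sigma> N Om \<longleftrightarrow>
     (\<forall>i\<in>{1..N}. \<exists>\<Phi>. \<Phi> ` cball (0::point) 1 = closure (Om i) \<and>
        (\<forall>x\<in>cball 0 1. \<forall>y\<in>cball 0 1.
           diameter (Om i) / \<sigma> * dist x y \<le> dist (\<Phi> x) (\<Phi> y) \<and>
           dist (\<Phi> x) (\<Phi> y) \<le> \<sigma> * diameter (Om i) * dist x y))"

definition subdomains ::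
    "real \<Rightarrow> point set \<Rightarrow> point set set \<Rightarrow> nat \<Rightarrow> (nat \<Rightarrow> point set) \<Rightarrow> bool" where
  "subdomains \<sigma> \<Omega> \<T> N Om \<longleftrightarrow>
     nonoverlapping_partition \<Omega> N Om \<and> coarse_shape_regular \<sigma> N Om \<and>
     (\<forall>i\<in>{1..N}. aligned \<T> (Om i) \<and>
        shape_regular \<sigma> (mesh_on \<T> (Om i)) \<and> quasiuniform \<sigma> (mesh_on \<T> (Om i)))"

definition boundary_layer :: "point set set \<Rightarrow> point set \<Rightarrow> point set" where
  "boundary_layer \<T> S = \<Union>{K\<in>mesh_on \<T> S. K \<inter> frontier S \<noteq> {}}"

text \<open>On an interface between different \<open>D j\<close> the coefficient has several one-sided values.  The
  supremum over the closed layer with the one-sided values taken from inside the layer is, by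
  continuity, the supremum over the points of the layer at which \<open>\<alpha>\<close> is single-valued.\<close>

definition alpha_sup ::
    "nat \<Rightarrow> (nat \<Rightarrow> point set) \<Rightarrow> (point \<Rightarrow> real) \<Rightarrow> point set set \<Rightarrow> point set \<Rightarrow> real" where
  "alpha_sup n D \<alpha> \<T> S = (SUP x \<in> boundary_layer \<T> S \<inter> (\<Union>j\<in>{1..n}. D j). \<alpha> x)"

definition alpha_inf ::
    "nat \<Rightarrow> (nat \<Rightarrow> point set) \<Rightarrow> (point \<Rightarrow> real) \<Rightarrow> point set set \<Rightarrow> point set \<Rightarrow> real" where
  "alpha_inf n D \<alpha> \<T> S = (INF x \<in> boundary_layer \<T> S \<inter> (\<Union>j\<in>{1..n}. D j). \<alpha> x)"

definition condition_factor ::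
    "nat \<Rightarrow> (nat \<Rightarrow> point set) \<Rightarrow> (point \<Rightarrow> real) \<Rightarrow> point set set \<Rightarrow> nat \<Rightarrow> (nat \<Rightarrow> point set) \<Rightarrow> real" where
  "condition_factor n D \<alpha> \<T> N Om =
     (MAX i\<in>{1..N}. alpha_sup n D \<alpha> \<T> (Om i) / alpha_inf n D \<alpha> \<T> (Om i) *
        (diameter (Om i) ^ 2 / mesh_size (mesh_on \<T> (Om i)) ^ 2))"


section \<open>The Crouzeix-Raviart space and the bilinear forms\<close>

text \<open>A Crouzeix-Raviart function is an \<open>L\<^sup>2\<close> class; it is represented by the function given by
  its affine pieces in the open triangles and by their common value at the edge midpoints, and
  set to 0 at all remaining points, so that equal classes have equal representatives.  That both
  affine pieces adjacent to an edge take the value \<open>v m\<close> at its midpoint \<open>m\<close> is the continuity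
  at midpoints.\<close>

definition CR :: "point set \<Rightarrow> point set set \<Rightarrow> (point \<Rightarrow> real) set" where
  "CR \<Omega> \<T> = {v.
     (\<forall>K\<in>\<T>. \<exists>g c. \<forall>x \<in> interior K \<union> mids {K}. v x = g \<bullet> x + c) \<and>
     (\<forall>e\<in>edges \<T> - interior_edges \<Omega> \<T>. v (edge_mid e) = 0) \<and>
     (\<forall>x. x \<notin> (\<Union>K\<in>\<T>. interior K) \<union> mids \<T> \<longrightarrow> v x = 0)}"

definition grad :: "(point \<Rightarrow> real) \<Rightarrow> point \<Rightarrow> point" where
  "grad f x = (THE G. GDERIV f x :> G)"

definition Ih_star ::
    "point set \<Rightarrow> point set set \<Rightarrow> (point set \<Rightarrow> point) \<Rightarrow> (point \<Rightarrow> real) \<Rightarrow> point \<Rightarrow> real" where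
  "Ih_star \<Omega> \<T> z v x =
     (\<Sum>e\<in>interior_edges \<Omega> \<T>. v (edge_mid e) * indicator (control_volume \<T> z e) x)"

definition a_FE ::
    "(point \<Rightarrow> real) \<Rightarrow> point set set \<Rightarrow> (point \<Rightarrow> real) \<Rightarrow> (point \<Rightarrow> real) \<Rightarrow> real" where
  "a_FE \<alpha> \<T> u v = (\<Sum>K\<in>\<T>. LINT x:K|lebesgue. \<alpha> x * (grad u x \<bullet> grad v x))"

definition norm_a :: "(point \<Rightarrow> real) \<Rightarrow> point set set \<Rightarrow> (point \<Rightarrow> real) \<Rightarrow> real" where
  "norm_a \<alpha> \<T> u = sqrt (a_FE \<alpha> \<T> u u)"

text \<open>Outward unit normal of a closed polygon at a boundary point that is not a corner: near the
  point the polygon is a half-plane.\<close>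

definition outward_normal :: "point set \<Rightarrow> point \<Rightarrow> point" where
  "outward_normal S x =
     (THE n. norm n = 1 \<and> (\<exists>r>0. S \<inter> ball x r = {y\<in>ball x r. (y - x) \<bullet> n \<le> 0}))"

definition segment_flux ::
    "(point \<Rightarrow> point) \<Rightarrow> point set \<Rightarrow> point \<Rightarrow> point \<Rightarrow> real" where
  "segment_flux F S p q =
     dist p q * integral {0..1} (\<lambda>t. F (linepath p q t) \<bullet> outward_normal S (linepath p q t))"

text \<open>The boundary of the control volume of an interior edge consists of the segments joining the
  points \<open>z K\<close> of the two adjacent triangles to the two end points of the edge.\<close>

definition boundary_flux ::
    "point set set \<Rightarrow> (point set \<Rightarrow> point) \<Rightarrow> (point \<Rightarrow> point) \<Rightarrow> point set \<Rightarrow> real" where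
  "boundary_flux \<T> z F e =
     (\<Sum>K\<in>{K\<in>\<T>. e edge_of K}. \<Sum>a\<in>{a. a extreme_point_of e}.
        segment_flux F (control_volume \<T> z e) (z K) a)"

text \<open>The second argument of \<open>a_FV\<close> is a function that is constant inside each control volume, to
  be applied to \<open>Ih_star\<close>, whose value inside the control volume of \<open>e\<close> is its value at the
  midpoint of \<open>e\<close>.\<close>

definition a_FV ::
    "(point \<Rightarrow> real) \<Rightarrow> point set \<Rightarrow> point set set \<Rightarrow> (point set \<Rightarrow> point) \<Rightarrow>
     (point \<Rightarrow> real) \<Rightarrow> (point \<Rightarrow> real) \<Rightarrow> real" where
  "a_FV \<alpha> \<Omega> \<T> z u w =
     - (\<Sum>e\<in>interior_edges \<Omega> \<T>. w (edge_mid e) * boundary_flux \<T> z (\<lambda>x. \<alpha> x *\<^sub>R grad u x) e)"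


section \<open>Decomposition and operators\<close>

definition boundary_average :: "point set set \<Rightarrow> point set \<Rightarrow> (point \<Rightarrow> real) \<Rightarrow> real" where
  "boundary_average \<T> S u = (\<Sum>y\<in>cr_boundary \<T> S. u y) / card (cr_boundary \<T> S)"

definition I_A ::
    "point set \<Rightarrow> point set set \<Rightarrow> nat \<Rightarrow> (nat \<Rightarrow> point set) \<Rightarrow> (point \<Rightarrow> real) \<Rightarrow> point \<Rightarrow> real" where
  "I_A \<Omega> \<T> N Om u = (THE w. w \<in> CR \<Omega> \<T> \<and>
     (\<forall>i\<in>{1..N}. (\<forall>x\<in>cr_boundary \<T> (Om i). w x = u x) \<and>
                 (\<forall>x\<in>cr_interior \<T> (Om i). w x = boundary_average \<T> (Om i) u)))"

definition V_space ::
    "point set \<Rightarrow> point set set \<Rightarrow> nat \<Rightarrow> (nat \<Rightarrow> point set) \<Rightarrow> nat \<Rightarrow> (point \<Rightarrow> real) set" where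
  "V_space \<Omega> \<T> N Om i =
     (if i = 0 then I_A \<Omega> \<T> N Om ` CR \<Omega> \<T>
      else {v\<in>CR \<Omega> \<T>. (\<forall>x\<in>cr_boundary \<T> (Om i). v x = 0) \<and>
                       (\<forall>j\<in>{1..N} - {i}. \<forall>x\<in>Om j. v x = 0)})"

definition T2 ::
    "(point \<Rightarrow> real) \<Rightarrow> point set \<Rightarrow> point set set \<Rightarrow> (point set \<Rightarrow> point) \<Rightarrow> nat \<Rightarrow>
     (nat \<Rightarrow> point set) \<Rightarrow> nat \<Rightarrow> (point \<Rightarrow> real) \<Rightarrow> point \<Rightarrow> real" where
  "T2 \<alpha> \<Omega> \<T> z N Om i u = (THE w. w \<in> V_space \<Omega> \<T> N Om i \<and>
     (\<forall>v\<in>V_space \<Omega> \<T> N Om i.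
        a_FE \<alpha> \<T> w v = a_FV \<alpha> \<Omega> \<T> z u (Ih_star \<Omega> \<T> z v)))"

definition T3 ::
    "(point \<Rightarrow> real) \<Rightarrow> point set \<Rightarrow> point set set \<Rightarrow> (point set \<Rightarrow> point) \<Rightarrow> nat \<Rightarrow>
     (nat \<Rightarrow> point set) \<Rightarrow> nat \<Rightarrow> (point \<Rightarrow> real) \<Rightarrow> point \<Rightarrow> real" where
  "T3 \<alpha> \<Omega> \<T> z N Om i u = (THE w. w \<in> V_space \<Omega> \<T> N Om i \<and>
     (\<forall>v\<in>V_space \<Omega> \<T> N Om i.
        a_FV \<alpha> \<Omega> \<T> z w (Ih_star \<Omega> \<T> z v) = a_FV \<alpha> \<Omega> \<T> z u (Ih_star \<Omega> \<T> z v)))"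

text \<open>Only used for \<open>k \<in> {2, 3}\<close>.\<close>

definition T_A ::
    "nat \<Rightarrow> (point \<Rightarrow> real) \<Rightarrow> point set \<Rightarrow> point set set \<Rightarrow> (point set \<Rightarrow> point) \<Rightarrow> nat \<Rightarrow>
     (nat \<Rightarrow> point set) \<Rightarrow> (point \<Rightarrow> real) \<Rightarrow> point \<Rightarrow> real" where
  "T_A k \<alpha> \<Omega> \<T> z N Om u x =
     (\<Sum>i=0..N. (if k = 2 then T2 else T3) \<alpha> \<Omega> \<T> z N Om i u x)"

end

theory Submission
  imports Defs
begin

text \<open>On a triangle with constant coefficient the finite volume form coincides with the finite element
  form, so for a Lipschitz coefficient the two differ by \<open>O(h) |u|\<^sub>a |v|\<^sub>a\<close>.  Both forms decouple the local
  spaces, whose sum \<open>W\<close> therefore acts as a single subspace, and only \<open>V\<^sub>0\<close> and \<open>W\<close> enter the Schwarz argument.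

  The stability of \<open>u = I\<^sub>A u + (u - I\<^sub>A u)\<close> rests on a chain argument: the triangles meeting a connected set
  are linked through edge midpoints, and a curve of length \<open>L\<close> meets only \<open>O(1 + L/h)\<close> of them.  Going
  around the boundary of a subdomain inside its layer bounds \<open>I\<^sub>A\<close> by the contrast in the layer times \<open>(H/h)\<^sup>2\<close>.

  This alone does not suffice.  With \<open>S\<^sup>2 = |t\<^sub>0|\<^sub>a\<^sup>2 + |t\<^sub>W|\<^sub>a\<^sup>2\<close> for the components \<open>t\<^sub>0 = T\<^sub>0 u\<close> and
  \<open>t\<^sub>W = T\<^sub>1 u + \<dots> + T\<^sub>N u\<close>, the perturbation contributes a term of order \<open>h |u|\<^sub>a S\<close>, while the layer bound
  only gives \<open>S \<ge> c (h/H) |u|\<^sub>a\<close>, which is of the same order.  Leaving the layer and going around along the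
  cheapest of \<open>q\<close> concentric rings yields a second bound for \<open>I\<^sub>A\<close> which is \<open>o(h\<^sup>-\<^sup>2)\<close>.  Its constants involve an
  upper bound for \<open>\<alpha>\<close>, but they affect only the threshold \<open>h\<^sub>0\<close>.\<close>


section \<open>Lipschitz continuity from bounded weak derivatives\<close>

text \<open>The order of the quantifiers decides what the ring bound has to deliver.
  \<open>C\<close> and \<open>c\<close> precede \<alpha>, whereas \<open>h0\<close> follows it, so
  an upper bound \<open>A\<close> of \<alpha>, and a number \<open>q\<close> of rings chosen from
  \<open>A\<close>, may enter \<open>h0\<close> only. With R = diam(\<Omega>)/h, the ring bound for
  the squared norm of the coarse component is of order R^2/q + qR + q^2, up to constants in
  \<open>A\<close> and \<open>\<sigma>\<close>. Multiplied by the squared perturbation, of order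
  h^2, the first term becomes a fixed multiple of 1/q, and the others vanish with h. So
  \<open>q\<close> is fixed first, then \<open>h0\<close>, and the cross term is absorbed into S^2.
  A second obstacle is the coefficient itself: it is known through weak derivatives on pieces that
  need not be convex, while comparing the forms takes increments along segments inside triangles.
  Each open triangle is convex and lies in one piece, and there a Lipschitz bound depending on
  \<open>M\<close> alone is available.\<close>

text \<open>One-variable counterpart of \<open>C_k\<close>. The test functions used are products of
  functions of one coordinate each, so their smoothness is settled in one variable; a witness for
  the derivative suits inductions by the product and chain rules.\<close>

primrec Ck_real :: "nat \<Rightarrow> (real \<Rightarrow> real) \<Rightarrow> bool" where
  "Ck_real 0 f \<longleftrightarrow> continuous_on UNIV f"
| "Ck_real (Suc k) f \<longleftrightarrow> (\<exists>f'. (\<forall>x. (f has_real_derivative f' x) (at x)) \<and> Ck_real k f')"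

lemma Ck_real_mono: "Ck_real (Suc k) f \<Longrightarrow> Ck_real k f"
proof (induction k arbitrary: f)
  case 0
  then obtain f' where "\<And>x. (f has_real_derivative f' x) (at x)" by auto
  then show ?case by (auto intro!: continuous_at_imp_continuous_on DERIV_isCont[of f])
next
  case (Suc k)
  then show ?case by (metis Ck_real.simps(2))
qed

lemma Ck_real_add: "Ck_real k f \<Longrightarrow> Ck_real k g \<Longrightarrow> Ck_real k (\<lambda>x. f x + g x)"
proof (induction k arbitrary: f g)
  case 0
  then show ?case by (auto intro: continuous_intros)
next
  case (Suc k)
  then obtain f' g' where "\<forall>x. (f has_real_derivative f' x) (at x)" "Ck_real k f'"
    "\<forall>x. (g has_real_derivative g' x) (at x)" "Ck_real k g'" by auto
  then show ?case using Suc.IH[of f' g']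
    by (auto intro!: exI[of _ "\<lambda>x. f' x + g' x"] derivative_eq_intros)
qed

lemma Ck_real_mult: "Ck_real k f \<Longrightarrow> Ck_real k g \<Longrightarrow> Ck_real k (\<lambda>x. f x * g x)"
proof (induction k arbitrary: f g)
  case 0
  then show ?case by (auto intro: continuous_intros)
next
  case (Suc k)
  then obtain f' g' where d: "\<forall>x. (f has_real_derivative f' x) (at x)" "Ck_real k f'"
    "\<forall>x. (g has_real_derivative g' x) (at x)" "Ck_real k g'" by auto
  have "Ck_real k (\<lambda>x. f' x * g x + g' x * f x)"
    using Suc d Ck_real_mono by (intro Ck_real_add Suc.IH) auto
  then show ?case using d
    by (auto intro!: exI[of _ "\<lambda>x. f' x * g x + g' x * f x"] derivative_eq_intros)
qed

lemma Ck_real_const: "Ck_real k (\<lambda>x. c)"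
proof (induction k arbitrary: c)
  case (Suc k)
  show ?case using Suc[of 0] by (auto intro!: exI[of _ "\<lambda>x. 0"])
qed auto

lemma Ck_real_affine: "Ck_real k f \<Longrightarrow> Ck_real k (\<lambda>x. f (a * x + b))"
proof (induction k arbitrary: f)
  case 0
  then show ?case
    by (auto intro!: continuous_on_compose2[of UNIV f] continuous_intros)
next
  case (Suc k)
  then obtain f' where d: "\<forall>x. (f has_real_derivative f' x) (at x)" "Ck_real k f'" by auto
  have "((\<lambda>x. f (a * x + b)) has_real_derivative f' (a * x + b) * a) (at x)" for x
    by (rule DERIV_chain2[of f]) (use d in \<open>auto intro!: derivative_eq_intros\<close>)
  moreover have "Ck_real k (\<lambda>x. f' (a * x + b) * a)"
    using Suc.IH[OF d(2)] Ck_real_const by (rule Ck_real_mult)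
  ultimately show ?case
    unfolding Ck_real.simps by (intro exI[of _ "\<lambda>x. f' (a * x + b) * a"] conjI) simp_all
qed

section \<open>Smooth bumps and steps on the real line\<close>

text \<open>For \<open>p = 1\<close> this is the classical exp(-1/x), flat at 0. Admitting a
  polynomial in 1/x as a factor makes the family closed under differentiation, so smoothness of
  every order is a single induction.\<close>

definition flat_exp :: "real poly \<Rightarrow> real \<Rightarrow> real" where
  "flat_exp p x = (if x > 0 then poly p (1 / x) * exp (- (1 / x)) else 0)"

lemma poly_div_exp_at_top: "((\<lambda>y. poly p y * exp (- y)) \<longlongrightarrow> (0::real)) at_top"
proof -
  have "((\<lambda>y. \<Sum>i\<le>degree p. coeff p i * (y ^ i / exp y)) \<longlongrightarrow> (\<Sum>i\<le>degree p. coeff p i * 0)) at_top"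
    by (intro tendsto_intros tendsto_power_div_exp_0)
  then show ?thesis
    by (simp add: poly_altdef sum_distrib_right exp_minus divide_inverse mult.assoc)
qed

text \<open>In the variable y = 1/x one has d/dx = - y^2 d/dy, which turns p(y) exp(-y) into y^2 (p
  - p')(y) exp(-y); \<open>[:0, 0, 1:]\<close> is y^2. Only the origin needs a limit.\<close>

lemma flat_exp_deriv:
  "(flat_exp p has_real_derivative flat_exp ([:0, 0, 1:] * (p - pderiv p)) x) (at x)"
proof -
  consider "x > 0" | "x < 0" | "x = 0" by linarith
  then show ?thesis
  proof cases
    case 1
    have "((\<lambda>x. poly p (1 / x) * exp (- (1 / x))) has_real_derivative
        flat_exp ([:0, 0, 1:] * (p - pderiv p)) x) (at x)"
      using 1 by (auto intro!: derivative_eq_intros DERIV_chain2[OF poly_DERIV]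
        simp: flat_exp_def field_simps power2_eq_square)
    then show ?thesis
      by (rule has_field_derivative_transform_within_open[of _ _ _ "{0<..}"])
        (use 1 in \<open>auto simp: flat_exp_def\<close>)
  next
    case 2
    have "((\<lambda>x. 0) has_real_derivative flat_exp ([:0, 0, 1:] * (p - pderiv p)) x) (at x)"
      using 2 by (auto simp: flat_exp_def)
    then show ?thesis
      by (rule has_field_derivative_transform_within_open[of _ _ _ "{..<0}"])
        (use 2 in \<open>auto simp: flat_exp_def\<close>)
  next
    case 3
    have r: "((\<lambda>h. flat_exp p h / h) \<longlongrightarrow> 0) (at_right 0)"
    proof -
      \<comment> \<open>Dividing by h multiplies by 1/h, so the difference quotient is again of the
        same form, with \<open>pCons 0 p\<close> in place of \<open>p\<close>.\<close>
      have "((\<lambda>h. poly (pCons 0 p) (inverse h) * exp (- inverse h)) \<longlongrightarrow> (0::real)) (at_right 0)"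
        using filterlim_compose[OF poly_div_exp_at_top filterlim_inverse_at_top_right] .
      moreover have "\<forall>\<^sub>F h in at_right 0. poly (pCons 0 p) (inverse h) * exp (- inverse h) = flat_exp p h / h"
        by (auto simp: eventually_at_filter flat_exp_def field_simps)
      ultimately show ?thesis by (rule Lim_transform_eventually)
    qed
    have l: "((\<lambda>h. flat_exp p h / h) \<longlongrightarrow> 0) (at_left 0)"
    proof (rule Lim_transform_eventually)
      show "((\<lambda>h::real. 0::real) \<longlongrightarrow> 0) (at_left 0)" by simp
      show "\<forall>\<^sub>F h in at_left 0. 0 = flat_exp p h / h"
        by (auto simp: eventually_at_filter flat_exp_def)
    qed
    have "((\<lambda>h. flat_exp p h / h) \<longlongrightarrow> 0) (at 0)"
      using filterlim_split_at[OF l r] by simp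
    then show ?thesis using 3 by (simp add: DERIV_def flat_exp_def)
  qed
qed

lemma Ck_real_flat_exp: "Ck_real k (flat_exp p)"
proof (induction k arbitrary: p)
  case 0
  show ?case
    by (auto intro!: continuous_at_imp_continuous_on DERIV_isCont[OF flat_exp_deriv])
next
  case (Suc k)
  then show ?case using flat_exp_deriv[of p] by auto
qed

definition bump :: "real \<Rightarrow> real" where
  "bump s = flat_exp 1 (1 + s) * flat_exp 1 (1 - s)"

lemma Ck_real_bump: "Ck_real k bump"
  using Ck_real_mult[OF Ck_real_affine[of k "flat_exp 1" 1 1] Ck_real_affine[of k "flat_exp 1" "-1" 1]]
  by (simp add: Ck_real_flat_exp bump_def[abs_def] add.commute)

lemma bump_nonneg: "bump s \<ge> 0"
  by (simp add: bump_def flat_exp_def)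

lemma bump_le_1: "bump s \<le> 1"
  by (auto simp: bump_def flat_exp_def intro!: mult_le_one)

lemma bump_eq_0: "\<bar>s\<bar> \<ge> 1 \<Longrightarrow> bump s = 0"
  by (auto simp: bump_def flat_exp_def)

text \<open>Both arguments 1 + s and 1 - s are at least 1/2, where each factor is at least exp(-2).
  The exponentials in the Lipschitz constants below all stem from here.\<close>

lemma bump_ge: assumes "\<bar>s\<bar> \<le> 1/2" shows "bump s \<ge> exp (- 4)"
proof -
  have "exp (-2) \<le> flat_exp 1 x" if "x \<ge> 1/2" for x
    using that by (auto simp: flat_exp_def field_simps)
  from mult_mono[OF this[of "1 + s"] this[of "1 - s"]]
  have "exp (-2) * exp (-2) \<le> bump s" using assms
    unfolding bump_def by (auto simp: flat_exp_def)
  then show ?thesis by (simp flip: exp_add)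
qed

lemma continuous_bump: "continuous_on S bump"
  using Ck_real_bump[of 0] continuous_on_subset by auto

text \<open>An antiderivative of \<open>bump\<close>: the difference of two translates is a plateau
  with bumps as derivative. Integration starts at -2, left of the support, so that -1 is an interior
  point for the fundamental theorem.\<close>

definition smooth_step :: "real \<Rightarrow> real" where
  "smooth_step s = integral {-2..s} bump"

lemma smooth_step_left: "s \<le> -1 \<Longrightarrow> smooth_step s = 0"
  unfolding smooth_step_def
  by (subst integral_cong[of _ _ "\<lambda>x. 0"]) (auto intro: bump_eq_0)

lemma smooth_step_deriv: "(smooth_step has_real_derivative bump s) (at s)"
proof (cases "s < -1")
  case True
  have "((\<lambda>x. 0) has_real_derivative bump s) (at s)"
    using True by (auto simp: bump_eq_0)
  then show ?thesis
    by (rule has_field_derivative_transform_within_open[of _ _ _ "{..<-1}"])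
      (use True in \<open>auto simp: smooth_step_left\<close>)
next
  case False
  have "(smooth_step has_real_derivative bump s) (at s within {-2..s+1})"
    unfolding smooth_step_def
    by (rule integral_has_real_derivative) (use False continuous_bump in auto)
  moreover have "at s within {-2..s+1} = at s"
    by (rule at_within_interior) (use False in auto)
  ultimately show ?thesis by simp
qed

lemma Ck_real_smooth_step: "Ck_real k smooth_step"
proof (cases k)
  case 0
  then show ?thesis
    by (auto intro!: continuous_at_imp_continuous_on DERIV_isCont[OF smooth_step_deriv])
next
  case (Suc k)
  then show ?thesis using smooth_step_deriv Ck_real_bump by auto
qed

lemma smooth_step_right: assumes "s \<ge> 1" shows "smooth_step s = smooth_step 1"
proof (cases "s = 1")
  case False
  show ?thesis
  proof (rule DERIV_isconst2[of 1 s])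
    show "continuous_on {1..s} smooth_step"
      using Ck_real_smooth_step[of 0] continuous_on_subset by auto
    show "DERIV smooth_step x :> 0" if "1 < x" "x < s" for x
      using smooth_step_deriv[of x] that by (simp add: bump_eq_0)
  qed (use assms False in auto)
qed auto

lemma smooth_step_bounds: "0 \<le> smooth_step s" "smooth_step s \<le> 3"
proof -
  have mono: "smooth_step a \<le> smooth_step b" if "a \<le> b" for a b
    by (rule DERIV_nonneg_imp_nondecreasing[OF that]) (meson smooth_step_deriv bump_nonneg)
  show "0 \<le> smooth_step s"
    using mono[of "min s (-1)" s] smooth_step_left[of "min s (-1)"] by simp
  \<comment> \<open>The integrand is at most 1 and the interval has length 3.\<close>
  have "smooth_step 1 \<le> integral {-2..1::real} (\<lambda>x. 1)"
    unfolding smooth_step_def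
    by (rule integral_le) (auto intro: integrable_continuous_interval continuous_bump bump_le_1)
  then show "smooth_step s \<le> 3"
    using mono[of s "max s 1"] smooth_step_right[of "max s 1"] by simp
qed

section \<open>Test functions on the plane and integrals against them\<close>

text \<open>A partial derivative of p(y_i) q(y_j) has the same form, with \<open>p\<close> or
  \<open>q\<close> replaced by its derivative, so induction over arbitrary factors closes; in the
  plane \<open>i\<close> and \<open>j\<close> exhaust the directions.\<close>

lemma C_k_product:
  assumes "i \<noteq> (j::2)" "Ck_real k p" "Ck_real k q"
  shows "C_k k (\<lambda>y::point. p (y $ i) * q (y $ j))"
  using assms
proof (induction k arbitrary: p q)
  case 0
  have "continuous_on UNIV (\<lambda>y::point. p (y $ i) * q (y $ j))"
    using 0 by (auto intro!: continuous_intros continuous_on_compose2[of UNIV p] continuous_on_compose2[of UNIV q])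
  then show ?case by simp
next
  case (Suc k)
  obtain p' q' where d: "\<And>x. (p has_real_derivative p' x) (at x)" "Ck_real k p'"
    "\<And>x. (q has_real_derivative q' x) (at x)" "Ck_real k q'" using Suc.prems by auto
  have D: "((\<lambda>y::point. p (y $ i) * q (y $ j)) has_derivative
      (\<lambda>h. p (y $ i) * (q' (y $ j) * h $ j) + p' (y $ i) * h $ i * q (y $ j))) (at y)" for y :: point
  proof (rule has_derivative_mult)
    show "((\<lambda>y::point. p (y $ i)) has_derivative (\<lambda>h. p' (y $ i) * h $ i)) (at y)"
      using has_derivative_compose[of "\<lambda>y::point. y $ i" "\<lambda>h. h $ i" y UNIV p "(*) (p' (y $ i))"] d(1)[of "y $ i"]
      by (simp add: has_field_derivative_def bounded_linear_imp_has_derivative bounded_linear_vec_nth)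
    show "((\<lambda>y::point. q (y $ j)) has_derivative (\<lambda>h. q' (y $ j) * h $ j)) (at y)"
      using has_derivative_compose[of "\<lambda>y::point. y $ j" "\<lambda>h. h $ j" y UNIV q "(*) (q' (y $ j))"] d(3)[of "y $ j"]
      by (simp add: has_field_derivative_def bounded_linear_imp_has_derivative bounded_linear_vec_nth)
  qed
  have pi: "partial i (\<lambda>y::point. p (y $ i) * q (y $ j)) = (\<lambda>y. p' (y $ i) * q (y $ j))"
    unfolding partial_def frechet_derivative_at[OF D, symmetric] using Suc.prems(1)
    by (auto simp: axis_def)
  have pj: "partial j (\<lambda>y::point. p (y $ i) * q (y $ j)) = (\<lambda>y. p (y $ i) * q' (y $ j))"
    unfolding partial_def frechet_derivative_at[OF D, symmetric] using Suc.prems(1)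
    by (auto simp: axis_def)
  have ij: "l = i \<or> l = j" for l :: 2 using Suc.prems(1) by (metis exhaust_2)
  have "C_k k (partial l (\<lambda>y::point. p (y $ i) * q (y $ j)))" for l
    using ij[of l] Suc.IH[OF Suc.prems(1), of p' q] Suc.IH[OF Suc.prems(1), of p q'] pi pj d
      Ck_real_mono Suc.prems by auto
  moreover have "(\<lambda>y::point. p (y $ i) * q (y $ j)) differentiable_on UNIV"
    using D by (auto simp: differentiable_on_def differentiable_def)
  ultimately show ?case by simp
qed

lemma integrable_lebesgue_on_compact:
  fixes f :: "'a::euclidean_space \<Rightarrow> real"
  assumes "compact S" "continuous_on S f"
  shows "integrable (lebesgue_on S) f"
proof -
  have "integrable lebesgue (\<lambda>x. indicator S x *\<^sub>R f x)"
    using borel_integrable_compact[OF assms] integrable_completion by (metis borel_measurable_integrable)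
  moreover have "S \<in> sets lebesgue"
    using assms by (simp add: compact_imp_closed)
  ultimately show ?thesis by (simp add: integrable_restrict_space)
qed

lemma integral_lebesgue_on_support:
  fixes F :: "'a::euclidean_space \<Rightarrow> real"
  assumes "D \<in> sets lebesgue" "Q \<in> sets lebesgue" "Q \<subseteq> D" "\<And>x. x \<in> D - Q \<Longrightarrow> F x = 0"
  shows "(LINT x|lebesgue_on D. F x) = (LINT x|lebesgue_on Q. F x)"
proof -
  have "indicator D x *\<^sub>R F x = indicator Q x *\<^sub>R F x" for x
    using assms(3,4) by (auto simp: indicator_def)
  then have "(\<lambda>x. indicator D x *\<^sub>R F x) = (\<lambda>x. indicator Q x *\<^sub>R F x)" by (rule ext)
  moreover have "integral\<^sup>L (lebesgue_on D) F = integral\<^sup>L lebesgue (\<lambda>x. indicator D x *\<^sub>R F x)"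
    "integral\<^sup>L (lebesgue_on Q) F = integral\<^sup>L lebesgue (\<lambda>x. indicator Q x *\<^sub>R F x)"
    by (simp_all only: integral_restrict_space sets.Int_space_eq2 assms)
  ultimately show ?thesis by simp
qed

lemma integral_lebesgue_on_indicator:
  assumes "D \<in> sets lebesgue" "R \<subseteq> D" "R \<in> lmeasurable"
  shows "integrable (lebesgue_on D) (\<lambda>x. c * indicat_real R x)"
    "(LINT x|lebesgue_on D. c * indicat_real R x) = c * measure lebesgue R"
proof -
  have R: "R \<in> sets (lebesgue_on D)"
    using assms by (auto simp: sets_restrict_space_iff)
  have m: "measure (lebesgue_on D) R = measure lebesgue R" "emeasure (lebesgue_on D) R = emeasure lebesgue R"
    using assms by (auto simp: measure_restrict_space emeasure_restrict_space)
  then show "integrable (lebesgue_on D) (\<lambda>x. c * indicat_real R x)"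
    using R assms(3) by (auto intro!: Bochner_Integration.integrable_mult_right integrable_real_indicator simp: fmeasurable_def)
  show "(LINT x|lebesgue_on D. c * indicat_real R x) = c * measure lebesgue R"
    using R m assms by (simp add: Int_absorb2)
qed

definition plane_bump :: "real \<Rightarrow> point \<Rightarrow> point \<Rightarrow> real" where
  "plane_bump \<epsilon> p y = bump ((y $ 1 - p $ 1) / \<epsilon>) * bump ((y $ 2 - p $ 2) / \<epsilon>)"

text \<open>The closed ball of the maximum norm, which is the natural support of a product of bumps
  in the two coordinates.\<close>

definition square :: "real \<Rightarrow> point \<Rightarrow> point set" where
  "square \<epsilon> p = {y. \<forall>l. \<bar>y $ l - p $ l\<bar> \<le> \<epsilon>}"

lemma square_cbox: "square \<epsilon> p = cbox (\<chi> l. p $ l - \<epsilon>) (\<chi> l. p $ l + \<epsilon>)"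
  by (auto simp: square_def mem_box_cart abs_le_iff algebra_simps)

lemma continuous_plane_bump: "continuous_on S (plane_bump \<epsilon> p)"
  unfolding plane_bump_def divide_inverse
  by (intro continuous_intros continuous_on_compose2[OF continuous_bump[of UNIV]]) auto

lemma plane_bump_nonneg: "0 \<le> plane_bump \<epsilon> p y"
  by (simp add: plane_bump_def bump_nonneg)

lemma plane_bump_eq_0: "\<epsilon> > 0 \<Longrightarrow> y \<notin> square \<epsilon> p \<Longrightarrow> plane_bump \<epsilon> p y = 0"
  by (auto simp: plane_bump_def square_def forall_2 not_le intro!: bump_eq_0)

lemma measure_square: "\<epsilon> \<ge> 0 \<Longrightarrow> measure lebesgue (square \<epsilon> p) = (2 * \<epsilon>)\<^sup>2"
  by (subst square_cbox, subst measure_completion, simp, subst content_cbox_cart)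
    (auto simp: UNIV_2 power2_eq_square interval_ne_empty_cart)

text \<open>Centred at 0, since by translation invariance the mass is the same for every centre.
  Only a lower bound for it enters later.\<close>

definition plane_bump_mass :: "real \<Rightarrow> real" where
  "plane_bump_mass \<epsilon> = (LINT y|lborel. plane_bump \<epsilon> 0 y)"

lemma plane_bump_mass:
  assumes "\<epsilon> > 0" "square \<epsilon> p \<subseteq> Q" "compact Q"
  shows "(LINT y|lebesgue_on Q. plane_bump \<epsilon> p y) = plane_bump_mass \<epsilon>"
proof -
  have Q: "Q \<in> sets lebesgue" using assms(3) by (simp add: compact_imp_closed)
  have b: "plane_bump \<epsilon> q \<in> borel_measurable borel" for q
    by (rule borel_measurable_continuous_onI[OF continuous_plane_bump])
  have "(LINT y|lebesgue_on Q. plane_bump \<epsilon> p y) = (LINT y|lebesgue_on UNIV. plane_bump \<epsilon> p y)"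
    by (rule integral_lebesgue_on_support[symmetric]) (use assms Q plane_bump_eq_0 in auto)
  also have "\<dots> = (LINT y|lborel. plane_bump \<epsilon> p y)"
    using b[of p] by (simp add: integral_completion lebesgue_on_UNIV_eq)
  also have "\<dots> = (LINT y|distr lborel borel ((+) p). plane_bump \<epsilon> p y)"
    by (simp add: lborel_distr_plus)
  also have "\<dots> = (LINT y|lborel. plane_bump \<epsilon> p (p + y))"
    using b by (subst integral_distr) auto
  also have "\<dots> = plane_bump_mass \<epsilon>"
    by (simp add: plane_bump_mass_def plane_bump_def)
  finally show ?thesis .
qed

text \<open>On the concentric square of half the size, whose area is
  \<open>\<epsilon>\<^sup>2\<close>, both factors are at least exp(-4).\<close>

lemma plane_bump_mass_ge:
  assumes "\<epsilon> > 0" shows "plane_bump_mass \<epsilon> \<ge> exp (- 8) * \<epsilon>\<^sup>2"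
proof -
  let ?Q = "square \<epsilon> 0" and ?q = "square (\<epsilon> / 2) 0"
  have c: "compact (square r 0)" for r by (simp add: square_cbox)
  have sub: "?q \<subseteq> ?Q"
  proof
    fix y assume "y \<in> ?q"
    then have "\<bar>y $ l\<bar> \<le> \<epsilon> / 2" for l by (simp add: square_def)
    then have "\<bar>y $ l\<bar> \<le> \<epsilon>" for l
      by (rule order_trans) (use assms in simp)
    then show "y \<in> ?Q" by (simp add: square_def)
  qed
  have m: "?q \<in> sets lebesgue" "?Q \<in> sets lebesgue" by (simp_all add: square_cbox)
  have lm: "?q \<in> lmeasurable" by (simp add: square_cbox)
  have "exp (-8) * \<epsilon>\<^sup>2 = (LINT y|lebesgue_on ?Q. exp (-8) * indicat_real ?q y)"
    unfolding integral_lebesgue_on_indicator(2)[OF m(2) sub lm]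
    using assms measure_square[of "\<epsilon>/2" 0] by simp
  also have "\<dots> \<le> (LINT y|lebesgue_on ?Q. plane_bump \<epsilon> 0 y)"
  proof (rule integral_mono)
    show "integrable (lebesgue_on ?Q) (plane_bump \<epsilon> 0)"
      by (rule integrable_lebesgue_on_compact[OF c continuous_plane_bump])
    show "integrable (lebesgue_on ?Q) (\<lambda>y. exp (-8) * indicat_real ?q y)"
      by (rule integral_lebesgue_on_indicator(1)[OF m(2) sub lm])
    show "exp (-8) * indicat_real ?q y \<le> plane_bump \<epsilon> 0 y" for y
    proof (cases "y \<in> ?q")
      case True
      then have "\<bar>(y $ l - 0 $ l) / \<epsilon>\<bar> \<le> 1/2" for l using assms
        by (auto simp: square_def field_simps)
      then have "exp (-4) * exp (-4) \<le> plane_bump \<epsilon> 0 y"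
        unfolding plane_bump_def by (intro mult_mono bump_ge) (auto simp: bump_nonneg)
      then show ?thesis using True by (simp flip: exp_add)
    qed (simp add: plane_bump_nonneg)
  qed
  also have "\<dots> = plane_bump_mass \<epsilon>"
    by (rule plane_bump_mass) (use assms c in auto)
  finally show ?thesis .
qed

text \<open>Converts the integral identity that defines a weak derivative into point values of a
  continuous function.\<close>

lemma plane_bump_average:
  assumes "\<epsilon> > 0" "square \<epsilon> p \<subseteq> Q" "compact Q" "continuous_on Q f"
    and \<kappa>: "\<And>y. y \<in> square \<epsilon> p \<Longrightarrow> \<bar>f y - f p\<bar> \<le> \<kappa>"
  shows "\<bar>(LINT y|lebesgue_on Q. f y * plane_bump \<epsilon> p y) - f p * plane_bump_mass \<epsilon>\<bar>
    \<le> \<kappa> * plane_bump_mass \<epsilon>"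
proof -
  have i: "integrable (lebesgue_on Q) (\<lambda>y. g y * plane_bump \<epsilon> p y)" if "continuous_on Q g" for g
    by (intro integrable_lebesgue_on_compact assms continuous_on_mult that continuous_plane_bump)
  have "(LINT y|lebesgue_on Q. f y * plane_bump \<epsilon> p y) - f p * plane_bump_mass \<epsilon>
      = (LINT y|lebesgue_on Q. f y * plane_bump \<epsilon> p y) - (LINT y|lebesgue_on Q. f p * plane_bump \<epsilon> p y)"
    using plane_bump_mass[OF assms(1-3)] by simp
  also have "\<dots> = (LINT y|lebesgue_on Q. (f y - f p) * plane_bump \<epsilon> p y)"
    using i[OF assms(4)] i[of "\<lambda>_. f p"] by (simp add: left_diff_distrib)
  also have "\<bar>\<dots>\<bar> \<le> (LINT y|lebesgue_on Q. \<kappa> * plane_bump \<epsilon> p y)"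
  proof (rule integral_abs_bound_integral)
    show "\<bar>(f y - f p) * plane_bump \<epsilon> p y\<bar> \<le> \<kappa> * plane_bump \<epsilon> p y" for y
      using \<kappa>[of y] plane_bump_eq_0[OF assms(1), of y p] plane_bump_nonneg[of \<epsilon> p y]
      by (cases "y \<in> square \<epsilon> p") (auto simp: abs_mult intro: mult_right_mono)
    show "integrable (lebesgue_on Q) (\<lambda>y. (f y - f p) * plane_bump \<epsilon> p y)"
      by (intro i continuous_intros assms)
    show "integrable (lebesgue_on Q) (\<lambda>y. \<kappa> * plane_bump \<epsilon> p y)"
      by (intro i continuous_intros)
  qed
  also have "\<dots> = \<kappa> * plane_bump_mass \<epsilon>" using plane_bump_mass[OF assms(1-3)] by simp
  finally show ?thesis .
qed

text \<open>The test function is the product of a plateau in the direction \<open>i\<close>, whose derivative is a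
  difference of two bumps, and a bump in the other direction.\<close>

lemma weak_partial_increment:
  assumes D: "open D" and f: "continuous_on D f" and g: "weak_partial D i f g" "Linf_norm_le D g M"
    and \<epsilon>: "\<epsilon> > 0" and \<delta>: "\<delta> > 0" and QD: "square (\<delta> + 2 * \<epsilon>) p \<subseteq> D" and q: "q = p + \<delta> *\<^sub>R axis i 1"
    and \<kappa>: "\<And>y. y \<in> square \<epsilon> p \<Longrightarrow> \<bar>f y - f p\<bar> \<le> \<kappa>" "\<And>y. y \<in> square \<epsilon> q \<Longrightarrow> \<bar>f y - f q\<bar> \<le> \<kappa>"
  shows "\<bar>f q - f p\<bar> \<le> 2 * \<kappa> + 12 * exp 8 * \<bar>M\<bar> * (\<delta> + 2 * \<epsilon>)"
proof -
  obtain j where ij: "i \<noteq> j" by (metis exhaust_2 zero_neq_one)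
  define Q where "Q = square (\<delta> + 2 * \<epsilon>) p"
  \<comment> \<open>This contains the support of the test function: long in direction
    \<open>i\<close>, but of width only \<open>2 * \<epsilon>\<close> in direction \<open>j\<close>.
    Its area carries one factor \<open>\<epsilon>\<close>, and \<open>lhs\<close> contributes
    another, which together match the mass of a bump.\<close>
  define R where "R = {y. y \<in> Q \<and> \<bar>y $ j - p $ j\<bar> \<le> \<epsilon>}"
  have l_cases: "l = i \<or> l = j" for l using ij by (metis exhaust_2)
  define \<eta> where "\<eta> s = smooth_step (1/\<epsilon> * s + (- p $ i / \<epsilon>)) + (-1) * smooth_step (1/\<epsilon> * s + (- (p $ i + \<delta>) / \<epsilon>))" for s
  define \<rho> where "\<rho> s = bump (1/\<epsilon> * s + (- p $ j / \<epsilon>))" for s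
  define \<phi> where "\<phi> y = \<eta> (y $ i) * \<rho> (y $ j)" for y :: point
  have smooth: "Ck_real k \<eta>" "Ck_real k \<rho>" for k
    unfolding \<eta>_def[abs_def] \<rho>_def[abs_def]
    by (intro Ck_real_add Ck_real_mult Ck_real_const Ck_real_affine[of k smooth_step] Ck_real_affine[of k bump]
        Ck_real_smooth_step Ck_real_bump)+
  have \<eta>0: "\<eta> s = 0" if "s \<le> p $ i - \<epsilon> \<or> s \<ge> p $ i + \<delta> + \<epsilon>" for s
  proof -
    have e: "1/\<epsilon> * s + (- p $ i / \<epsilon>) = (s - p $ i) / \<epsilon>" "1/\<epsilon> * s + (- (p $ i + \<delta>) / \<epsilon>) = (s - p $ i - \<delta>) / \<epsilon>"
      by (auto simp: diff_divide_distrib add_divide_distrib)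
    from that show ?thesis
    proof
      assume "s \<le> p $ i - \<epsilon>"
      then have "(s - p $ i) / \<epsilon> \<le> -1" "(s - p $ i - \<delta>) / \<epsilon> \<le> -1"
        using \<epsilon> \<delta> by (auto simp: field_simps)
      then show ?thesis unfolding \<eta>_def e by (simp add: smooth_step_left)
    next
      assume "s \<ge> p $ i + \<delta> + \<epsilon>"
      then have *: "(s - p $ i) / \<epsilon> \<ge> 1" "(s - p $ i - \<delta>) / \<epsilon> \<ge> 1"
        using \<epsilon> \<delta> by (auto simp: field_simps)
      then show ?thesis unfolding \<eta>_def e by (simp add: smooth_step_right[OF *(1)] smooth_step_right[OF *(2)])
    qed
  qed
  have \<rho>0: "\<rho> s = 0" if "\<bar>s - p $ j\<bar> \<ge> \<epsilon>" for s
  proof -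
    have e: "1/\<epsilon> * s + (- p $ j / \<epsilon>) = (s - p $ j) / \<epsilon>" by (auto simp: diff_divide_distrib)
    show ?thesis unfolding \<rho>_def e by (rule bump_eq_0) (use \<epsilon> that in \<open>simp add: field_simps\<close>)
  qed
  have \<phi>0: "\<phi> y = 0" if "y \<notin> R" for y
    using that l_cases \<epsilon> \<delta> \<eta>0[of "y $ i"] \<rho>0[of "y $ j"]
    unfolding \<phi>_def R_def Q_def square_def by (smt (verit) mem_Collect_eq mult_eq_0_iff)
  have \<phi>bd: "\<bar>\<phi> y\<bar> \<le> 3" for y
  proof -
    have "\<bar>\<eta> (y $ i)\<bar> \<le> 3" using smooth_step_bounds unfolding \<eta>_def by (smt (verit))
    moreover have "\<bar>\<rho> (y $ j)\<bar> \<le> 1" using bump_nonneg bump_le_1 unfolding \<rho>_def by (smt (verit))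
    ultimately have "\<bar>\<eta> (y $ i)\<bar> * \<bar>\<rho> (y $ j)\<bar> \<le> 3 * 1" by (intro mult_mono) auto
    then show ?thesis by (simp add: \<phi>_def abs_mult)
  qed
  have Rbox: "R = cbox (\<chi> l. if l = i then p $ l - (\<delta> + 2 * \<epsilon>) else p $ l - \<epsilon>)
      (\<chi> l. if l = i then p $ l + (\<delta> + 2 * \<epsilon>) else p $ l + \<epsilon>)"
  proof (rule set_eqI)
    fix y :: point
    have all: "(\<forall>l. P l) \<longleftrightarrow> P i \<and> P j" for P :: "2 \<Rightarrow> bool" using l_cases by metis
    show "y \<in> R \<longleftrightarrow> y \<in> cbox (\<chi> l. if l = i then p $ l - (\<delta> + 2 * \<epsilon>) else p $ l - \<epsilon>)
      (\<chi> l. if l = i then p $ l + (\<delta> + 2 * \<epsilon>) else p $ l + \<epsilon>)"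
      using ij \<epsilon> \<delta> unfolding R_def Q_def square_def mem_box_cart all
      by (auto simp: abs_le_iff)
  qed
  have Rmeas: "measure lebesgue R = 2 * (\<delta> + 2 * \<epsilon>) * (2 * \<epsilon>)"
  proof -
    have U: "(UNIV :: 2 set) = {i, j}" using l_cases by auto
    show ?thesis unfolding Rbox using \<epsilon> \<delta> ij
      by (subst measure_completion, simp, subst content_cbox_cart) (auto simp: interval_ne_empty_cart U)
  qed
  have Q: "compact Q" "Q \<in> sets lebesgue" "Q \<subseteq> D" using QD by (simp_all add: Q_def square_cbox)
  have R: "R \<in> lmeasurable" "R \<subseteq> D" using Q by (simp add: Rbox) (use Q in \<open>auto simp: R_def\<close>)
  have Dm: "D \<in> sets lebesgue" using D by auto
  have "test_function D \<phi>"
  proof -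
    have "C_k k \<phi>" for k unfolding \<phi>_def[abs_def] by (rule C_k_product[OF ij smooth])
    moreover have "closure {x. \<phi> x \<noteq> 0} \<subseteq> R"
      by (rule closure_minimal) (use \<phi>0 in \<open>auto simp: Rbox\<close>)
    moreover have "compact R" by (simp add: Rbox)
    ultimately show ?thesis using R
      unfolding test_function_def by (meson closed_closure compact_Int_closed compact_closure bounded_subset compact_imp_bounded closure_subset subset_trans)
  qed
  then have w: "(LINT x|lebesgue_on D. f x * partial i \<phi> x) = - (LINT x|lebesgue_on D. g x * \<phi> x)"
    using g(1) by (auto simp: weak_partial_def)
  have pq: "q $ i = p $ i + \<delta>" "q $ j = p $ j" using ij by (auto simp: q axis_def)
  have p\<phi>: "partial i \<phi> y = (plane_bump \<epsilon> p y - plane_bump \<epsilon> q y) / \<epsilon>" for y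
  proof -
    have pb: "plane_bump \<epsilon> r y = bump ((y $ i - r $ i) / \<epsilon>) * bump ((y $ j - r $ j) / \<epsilon>)" for r
      using ij exhaust_2[of i] exhaust_2[of j] by (auto simp: plane_bump_def mult.commute)
    have d1: "(\<eta> has_real_derivative (bump ((s - p $ i) / \<epsilon>) - bump ((s - q $ i) / \<epsilon>)) / \<epsilon>) (at s)" for s
    proof -
      have "(\<eta> has_real_derivative bump (1/\<epsilon> * s + (- p $ i / \<epsilon>)) * (1/\<epsilon>)
          + (-1) * (bump (1/\<epsilon> * s + (- (p $ i + \<delta>) / \<epsilon>)) * (1/\<epsilon>))) (at s)"
        unfolding \<eta>_def[abs_def]
        by (intro DERIV_add DERIV_cmult DERIV_chain2[of smooth_step] smooth_step_deriv)
          (use \<epsilon> in \<open>auto intro!: derivative_eq_intros\<close>)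
      moreover have "1/\<epsilon> * s + (- p $ i / \<epsilon>) = (s - p $ i) / \<epsilon>" "1/\<epsilon> * s + (- (p $ i + \<delta>) / \<epsilon>) = (s - q $ i) / \<epsilon>"
        by (auto simp: diff_divide_distrib add_divide_distrib pq)
      ultimately show ?thesis using \<epsilon> by (simp add: diff_divide_distrib)
    qed
    obtain \<rho>' where d2: "\<And>s. (\<rho> has_real_derivative \<rho>' s) (at s)" using smooth(2)[of 1] by auto
    have D1: "((\<lambda>y::point. \<eta> (y $ i)) has_derivative (\<lambda>h. (bump ((y $ i - p $ i) / \<epsilon>) - bump ((y $ i - q $ i) / \<epsilon>)) / \<epsilon> * h $ i)) (at y)"
      using has_derivative_compose[of "\<lambda>y::point. y $ i" "\<lambda>h. h $ i" y UNIV \<eta>, OF _ d1[of "y $ i", unfolded has_field_derivative_def]]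
      by (simp add: bounded_linear_imp_has_derivative bounded_linear_vec_nth)
    have D2: "((\<lambda>y::point. \<rho> (y $ j)) has_derivative (\<lambda>h. \<rho>' (y $ j) * h $ j)) (at y)"
      using has_derivative_compose[of "\<lambda>y::point. y $ j" "\<lambda>h. h $ j" y UNIV \<rho> "(*) (\<rho>' (y $ j))"] d2[of "y $ j"]
      by (simp add: has_field_derivative_def bounded_linear_imp_has_derivative bounded_linear_vec_nth)
    show ?thesis
      unfolding partial_def \<phi>_def[abs_def] frechet_derivative_at[OF has_derivative_mult[OF D1 D2], symmetric]
      using ij \<epsilon> by (simp add: axis_def pb \<rho>_def pq diff_divide_distrib algebra_simps)
  qed
  have sub: "square \<epsilon> p \<subseteq> Q" "square \<epsilon> q \<subseteq> Q"
    using \<epsilon> \<delta> l_cases pq unfolding Q_def square_def by (smt (verit) mem_Collect_eq subsetI)+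
  define m where "m = plane_bump_mass \<epsilon>"
  have cf: "continuous_on Q f" using f Q(3) continuous_on_subset by blast
  have ii: "integrable (lebesgue_on Q) (\<lambda>y. f y * plane_bump \<epsilon> r y)" for r
    by (intro integrable_lebesgue_on_compact Q continuous_on_mult cf continuous_plane_bump)
  have z: "plane_bump \<epsilon> p x = 0" "plane_bump \<epsilon> q x = 0" if "x \<notin> Q" for x
    using plane_bump_eq_0[OF \<epsilon>] sub that by blast+
  have "(LINT x|lebesgue_on D. f x * partial i \<phi> x) = (LINT x|lebesgue_on Q. f x * partial i \<phi> x)"
    by (rule integral_lebesgue_on_support) (use Q Dm z in \<open>auto simp: p\<phi>\<close>)
  also have "\<dots> = (LINT y|lebesgue_on Q. (f y * plane_bump \<epsilon> p y - f y * plane_bump \<epsilon> q y) / \<epsilon>)"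
    by (simp add: p\<phi> right_diff_distrib)
  also have "\<dots> = ((LINT y|lebesgue_on Q. f y * plane_bump \<epsilon> p y) - (LINT y|lebesgue_on Q. f y * plane_bump \<epsilon> q y)) / \<epsilon>"
    by (simp add: Bochner_Integration.integral_diff[OF ii ii])
  finally have lhs: "(LINT y|lebesgue_on Q. f y * plane_bump \<epsilon> p y) - (LINT y|lebesgue_on Q. f y * plane_bump \<epsilon> q y)
     = - \<epsilon> * (LINT x|lebesgue_on D. g x * \<phi> x)" using w \<epsilon> by (simp add: field_simps)
  have gphi: "\<bar>LINT x|lebesgue_on D. g x * \<phi> x\<bar> \<le> 3 * \<bar>M\<bar> * (2 * (\<delta> + 2 * \<epsilon>) * (2 * \<epsilon>))"
  proof -
    have "\<bar>LINT x|lebesgue_on D. g x * \<phi> x\<bar> \<le> (LINT x|lebesgue_on D. \<bar>g x * \<phi> x\<bar>)"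
      by (rule integral_abs_bound)
    also have "\<dots> \<le> (LINT x|lebesgue_on D. \<bar>M\<bar> * 3 * indicat_real R x)"
    proof (rule integral_mono_AE')
      show "integrable (lebesgue_on D) (\<lambda>x. \<bar>M\<bar> * 3 * indicat_real R x)"
        by (rule integral_lebesgue_on_indicator(1)[OF Dm R(2,1)])
      show "AE x in lebesgue_on D. \<bar>g x * \<phi> x\<bar> \<le> \<bar>M\<bar> * 3 * indicat_real R x"
        using g(2) unfolding Linf_norm_le_def
      proof (elim conjE AE_mp, intro AE_I2 impI)
        fix x assume "\<bar>g x\<bar> \<le> M"
        then have "\<bar>g x\<bar> * \<bar>\<phi> x\<bar> \<le> \<bar>M\<bar> * 3" by (intro mult_mono \<phi>bd) auto
        then show "\<bar>g x * \<phi> x\<bar> \<le> \<bar>M\<bar> * 3 * indicat_real R x"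
          using \<phi>0[of x] by (cases "x \<in> R") (auto simp: abs_mult)
      qed
    qed auto
    also have "\<dots> = 3 * \<bar>M\<bar> * measure lebesgue R"
      using integral_lebesgue_on_indicator(2)[OF Dm R(2,1), of "\<bar>M\<bar> * 3"] by simp
    finally show ?thesis by (simp add: Rmeas)
  qed
  have "\<bar>f q * m - f p * m\<bar> \<le> 2 * \<kappa> * m + \<epsilon> * \<bar>LINT x|lebesgue_on D. g x * \<phi> x\<bar>"
  proof -
    have "\<epsilon> * \<bar>LINT x|lebesgue_on D. g x * \<phi> x\<bar> = \<bar>(LINT y|lebesgue_on Q. f y * plane_bump \<epsilon> p y) - (LINT y|lebesgue_on Q. f y * plane_bump \<epsilon> q y)\<bar>"
      unfolding lhs using \<epsilon> by (simp add: abs_mult)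
    then show ?thesis
      using plane_bump_average[OF \<epsilon> sub(1) Q(1) cf \<kappa>(1)] plane_bump_average[OF \<epsilon> sub(2) Q(1) cf \<kappa>(2)]
      unfolding m_def by linarith
  qed
  also have "\<dots> \<le> 2 * \<kappa> * m + 12 * \<bar>M\<bar> * (\<delta> + 2 * \<epsilon>) * \<epsilon>\<^sup>2"
    using mult_left_mono[OF gphi, of \<epsilon>] \<epsilon> by (simp add: power2_eq_square algebra_simps)
  \<comment> \<open>Trading \<open>\<epsilon>\<^sup>2\<close> for the mass \<open>m\<close> lets
    \<open>m\<close> cancel at the end, so the bound stays finite as \<open>\<epsilon>\<close> tends
    to 0.\<close>
  also have "\<dots> \<le> 2 * \<kappa> * m + 12 * \<bar>M\<bar> * (\<delta> + 2 * \<epsilon>) * (exp 8 * m)"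
    using plane_bump_mass_ge[OF \<epsilon>] \<epsilon> \<delta> unfolding m_def
    by (intro add_left_mono mult_left_mono) (auto simp: exp_minus field_simps)
  finally have le: "\<bar>f q * m - f p * m\<bar> \<le> 2 * \<kappa> * m + 12 * \<bar>M\<bar> * (\<delta> + 2 * \<epsilon>) * (exp 8 * m)" .
  have "0 < exp (- 8) * \<epsilon>\<^sup>2" using \<epsilon> by simp
  then have m: "m > 0" using plane_bump_mass_ge[OF \<epsilon>] unfolding m_def by linarith
  then have "\<bar>f q * m - f p * m\<bar> = \<bar>f q - f p\<bar> * m" by (simp add: abs_mult flip: left_diff_distrib)
  then have "\<bar>f q - f p\<bar> * m \<le> (2 * \<kappa> + 12 * exp 8 * \<bar>M\<bar> * (\<delta> + 2 * \<epsilon>)) * m"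
    using le by (simp add: algebra_simps)
  then show ?thesis using m by simp
qed

section \<open>From weak derivatives to pointwise bounds\<close>

text \<open>The preceding estimate in the limit of narrow bumps: continuity of \<open>f\<close>
  makes the oscillation on the small squares disappear. Negative \<open>\<delta>\<close> is the same
  increment read backwards.\<close>

lemma weak_partial_axis_bound:
  assumes D: "open D" and f: "continuous_on D f" and g: "weak_partial D i f g" "Linf_norm_le D g M"
    and q: "q = p + \<delta> *\<^sub>R axis i 1" and sub: "square (2 * \<bar>\<delta>\<bar>) p \<subseteq> D" "square (2 * \<bar>\<delta>\<bar>) q \<subseteq> D"
  shows "\<bar>f q - f p\<bar> \<le> 12 * exp 8 * \<bar>M\<bar> * \<bar>\<delta>\<bar>"
proof -
  have pos: "\<bar>f b - f a\<bar> \<le> 12 * exp 8 * \<bar>M\<bar> * d"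
    if d: "d > 0" and b: "b = a + d *\<^sub>R axis i 1" and sa: "square (2 * d) a \<subseteq> D" and sb: "square (2 * d) b \<subseteq> D"
    for a b :: point and d
  proof (rule field_le_epsilon)
    fix e :: real assume "e > 0"
    define L where "L = 12 * exp 8 * \<bar>M\<bar>"
    \<comment> \<open>Chosen so that the total excess \<open>2 * \<kappa> + 2 * L * \<kappa>\<close>
      equals \<open>e\<close>, once the bump width is at most \<open>\<kappa>\<close>.\<close>
    define \<kappa> where "\<kappa> = e / (2 + 2 * L)"
    have L: "L \<ge> 0" by (simp add: L_def)
    have k: "\<kappa> > 0" using \<open>e > 0\<close> L by (simp add: \<kappa>_def)
    have "(2 + 2 * L) * \<kappa> = e" using L by (simp add: \<kappa>_def)
    then have k2: "2 * \<kappa> + 2 * L * \<kappa> = e" by (simp add: distrib_right)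
    have near: "\<exists>r>0. \<forall>\<epsilon>. 0 < \<epsilon> \<and> \<epsilon> < r \<longrightarrow> (\<forall>y\<in>square \<epsilon> c. \<bar>f y - f c\<bar> \<le> \<kappa>)" if "c \<in> D" for c
    proof -
      have "isCont f c" using f D that by (simp add: continuous_on_eq_continuous_at)
      then obtain s where s: "s > 0" "\<And>y. dist y c < s \<Longrightarrow> dist (f y) (f c) < \<kappa>"
        unfolding continuous_at_eps_delta using k by blast
      have "\<bar>f y - f c\<bar> \<le> \<kappa>" if "0 < \<epsilon>" "\<epsilon> < s / 2" "y \<in> square \<epsilon> c" for \<epsilon> y
      proof -
        have "norm (y - c) \<le> (\<Sum>l\<in>UNIV. \<bar>(y - c) $ l\<bar>)" by (rule norm_le_l1_cart)
        also have "\<dots> \<le> \<epsilon> + \<epsilon>" using that by (auto simp: UNIV_2 square_def forall_2 intro!: add_mono)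
        finally show ?thesis using s(2)[of y] that by (simp add: dist_norm)
      qed
      then show ?thesis using s(1) by (intro exI[of _ "s/2"]) auto
    qed
    have "a \<in> D" "b \<in> D" using sa sb d by (auto simp: square_def subset_iff)
    then obtain r1 r2 where r: "r1 > 0" "r2 > 0"
      "\<And>\<epsilon> y. 0 < \<epsilon> \<Longrightarrow> \<epsilon> < r1 \<Longrightarrow> y \<in> square \<epsilon> a \<Longrightarrow> \<bar>f y - f a\<bar> \<le> \<kappa>"
      "\<And>\<epsilon> y. 0 < \<epsilon> \<Longrightarrow> \<epsilon> < r2 \<Longrightarrow> y \<in> square \<epsilon> b \<Longrightarrow> \<bar>f y - f b\<bar> \<le> \<kappa>"
      using near by (metis (no_types, lifting))
    define \<epsilon> where "\<epsilon> = min (min (r1 / 2) (r2 / 2)) (min \<kappa> (d / 2))"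
    have \<epsilon>: "\<epsilon> > 0" "\<epsilon> < r1" "\<epsilon> < r2" "\<epsilon> \<le> \<kappa>" "2 * \<epsilon> \<le> d"
      using r(1,2) k d by (auto simp: \<epsilon>_def min_def)
    have "square (d + 2 * \<epsilon>) a \<subseteq> square (2 * d) a"
    proof
      fix y assume "y \<in> square (d + 2 * \<epsilon>) a"
      then have "\<bar>y $ l - a $ l\<bar> \<le> d + 2 * \<epsilon>" for l by (simp add: square_def)
      then have "\<bar>y $ l - a $ l\<bar> \<le> 2 * d" for l
        by (rule order_trans) (use \<epsilon>(5) in simp)
      then show "y \<in> square (2 * d) a" by (simp add: square_def)
    qed
    then have "square (d + 2 * \<epsilon>) a \<subseteq> D" using sa by blast
    from weak_partial_increment[OF D f g \<epsilon>(1) d this b, of \<kappa>] r(3,4) \<epsilon>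
    have "\<bar>f b - f a\<bar> \<le> 2 * \<kappa> + L * (d + 2 * \<epsilon>)" by (simp add: L_def)
    also have "\<dots> \<le> 2 * \<kappa> + L * (d + 2 * \<kappa>)"
      using \<epsilon> L by (intro add_left_mono mult_left_mono) auto
    also have "\<dots> = L * d + e" using k2 by (simp add: algebra_simps)
    finally show "\<bar>f b - f a\<bar> \<le> 12 * exp 8 * \<bar>M\<bar> * d + e" by (simp add: L_def)
  qed
  consider "\<delta> > 0" | "\<delta> = 0" | "\<delta> < 0" by linarith
  then show ?thesis
  proof cases
    case 1 then show ?thesis using pos[OF 1 q] sub by simp
  next
    case 2 then show ?thesis using q by simp
  next
    case 3
    then have "p = q + (-\<delta>) *\<^sub>R axis i 1" using q by simp
    then show ?thesis using pos[of "-\<delta>" p q] 3 sub by (simp add: abs_minus_commute)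
  qed
qed

text \<open>The point \<open>y\<close> is reached from \<open>x\<close> by two axis-parallel moves,
  hence 24 = 12 + 12. The radius R/8 leaves room in \<open>D\<close> for the squares around the end
  points of both moves.\<close>

lemma W1inf_locally_lipschitz:
  assumes D: "open D" and f: "continuous_on D f" and w: "W1inf_seminorm_le D f M" and x: "x \<in> D"
  shows "\<exists>r>0. \<forall>y. dist x y < r \<longrightarrow> \<bar>f y - f x\<bar> \<le> 24 * exp 8 * \<bar>M\<bar> * dist x y"
proof -
  obtain g where g: "\<And>i. weak_partial D i f (g i)" "\<And>i. Linf_norm_le D (g i) M"
    using w unfolding W1inf_seminorm_le_def by metis
  obtain R where R: "R > 0" "ball x R \<subseteq> D" using D x open_contains_ball by blast
  have sq: "square (2 * s) p \<subseteq> D" if "dist x p < R / 8" "s < R / 8" for p s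
  proof
    fix y assume "y \<in> square (2 * s) p"
    then have "norm (y - p) \<le> 2 * s + 2 * s"
      using norm_le_l1_cart[of "y - p"] unfolding UNIV_2 square_def
      by (simp add: forall_2)
    then have "dist p y \<le> 4 * s" by (simp add: dist_norm norm_minus_commute)
    then have "dist x y < R" using that dist_triangle[of x y p] R(1) by linarith
    then show "y \<in> D" using R by auto
  qed
  have "\<bar>f y - f x\<bar> \<le> 24 * exp 8 * \<bar>M\<bar> * dist x y" if y: "dist x y < R / 8" for y
  proof -
    define w where "w = x + (y $ 1 - x $ 1) *\<^sub>R axis 1 1"
    have yw: "y = w + (y $ 2 - x $ 2) *\<^sub>R axis 2 1"
      by (simp add: w_def vec_eq_iff forall_2 axis_def)
    have c: "\<bar>y $ l - x $ l\<bar> \<le> dist x y" for l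
      using component_le_norm_cart[of "x - y" l] by (simp add: dist_norm abs_minus_commute)
    have "dist x w = \<bar>y $ 1 - x $ 1\<bar>" by (simp add: w_def dist_norm)
    then have xw: "dist x w < R / 8" using c[of 1] y by simp
    have "\<bar>f w - f x\<bar> \<le> 12 * exp 8 * \<bar>M\<bar> * \<bar>y $ 1 - x $ 1\<bar>"
      by (rule weak_partial_axis_bound[OF D f g w_def]; rule sq) (use c[of 1] y xw R(1) in auto)
    moreover have "\<bar>f y - f w\<bar> \<le> 12 * exp 8 * \<bar>M\<bar> * \<bar>y $ 2 - x $ 2\<bar>"
      by (rule weak_partial_axis_bound[OF D f g yw]; rule sq) (use c[of 2] y xw R(1) in auto)
    moreover have "12 * exp 8 * \<bar>M\<bar> * \<bar>y $ l - x $ l\<bar> \<le> 12 * exp 8 * \<bar>M\<bar> * dist x y" for l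
      by (intro mult_left_mono c) auto
    from this[of 1] this[of 2] calculation show ?thesis by linarith
  qed
  then show ?thesis using R(1) by (intro exI[of _ "R/8"]) auto
qed

text \<open>The local constant is the same at all points although the radius is not. On a segment
  the increment bound is additive over adjacent parameter intervals and holds on short intervals
  around each parameter, so \<open>Bolzano\<close> extends it to the whole segment.\<close>

lemma W1inf_lipschitz_on_convex:
  assumes D: "open D" and f: "continuous_on D f" and w: "W1inf_seminorm_le D f M"
    and U: "convex U" "U \<subseteq> D"
  shows "(24 * exp 8 * \<bar>M\<bar>)-lipschitz_on U f"
proof (rule lipschitz_onI)
  define L where "L = 24 * exp 8 * \<bar>M\<bar>"
  show "0 \<le> 24 * exp 8 * \<bar>M\<bar>" by simp
  fix x y assume xy: "x \<in> U" "y \<in> U"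
  define F where "F t = f (linepath x y t)" for t
  have "\<bar>F 1 - F 0\<bar> \<le> L * dist x y * (1 - 0)"
  proof (rule Bolzano[of 0 1 "\<lambda>s t. \<bar>F t - F s\<bar> \<le> L * dist x y * (t - s)"])
    fix a b c :: real assume "\<bar>F b - F a\<bar> \<le> L * dist x y * (b - a)" "\<bar>F c - F b\<bar> \<le> L * dist x y * (c - b)"
    then show "\<bar>F c - F a\<bar> \<le> L * dist x y * (c - a)"
      by (simp add: algebra_simps)
  next
    fix t :: real assume t: "0 \<le> t" "t \<le> 1"
    have "linepath x y t \<in> D"
      using U xy t linepath_in_path[of t x y] convex_contains_segment[of U] by auto
    from W1inf_locally_lipschitz[OF D f w this] obtain r where r: "r > 0"
      "\<And>z. dist (linepath x y t) z < r \<Longrightarrow> \<bar>f z - f (linepath x y t)\<bar> \<le> L * dist (linepath x y t) z"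
      unfolding L_def by blast
    have dl: "dist (linepath x y t) (linepath x y s) = \<bar>t - s\<bar> * dist x y" for s
    proof -
      have "linepath x y t - linepath x y s = (t - s) *\<^sub>R (y - x)"
        by (simp add: linepath_def algebra_simps)
      then show ?thesis by (simp add: dist_norm norm_minus_commute)
    qed
    define d where "d = r / (1 + dist x y)"
    have pos: "1 + dist x y > 0" by (smt (verit) zero_le_dist)
    have d: "d > 0" using r(1) pos by (simp add: d_def)
    have F: "\<bar>F s - F t\<bar> \<le> L * dist x y * \<bar>t - s\<bar>" if "\<bar>t - s\<bar> < d" for s
    proof -
      have "\<bar>t - s\<bar> * dist x y \<le> \<bar>t - s\<bar> * (1 + dist x y)" by (simp add: algebra_simps)
      also have "\<dots> < r" using that pos by (simp add: d_def field_simps)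
      finally show ?thesis using r(2)[of "linepath x y s"] by (simp add: dl F_def mult_ac)
    qed
    show "\<exists>d>0. \<forall>a b. a \<le> t \<and> t \<le> b \<and> b - a < d \<longrightarrow> \<bar>F b - F a\<bar> \<le> L * dist x y * (b - a)"
    proof (intro exI[of _ d] conjI d allI impI)
      fix a b assume ab: "a \<le> t \<and> t \<le> b \<and> b - a < d"
      have "\<bar>F b - F a\<bar> \<le> L * dist x y * \<bar>t - b\<bar> + L * dist x y * \<bar>t - a\<bar>"
        using F[of a] F[of b] ab by linarith
      also have "\<dots> = L * dist x y * (b - a)" using ab by (simp add: algebra_simps)
      finally show "\<bar>F b - F a\<bar> \<le> L * dist x y * (b - a)" .
    qed
  qed auto
  then show "dist (f x) (f y) \<le> 24 * exp 8 * \<bar>M\<bar> * dist x y"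
    by (simp add: F_def L_def dist_real_def abs_minus_commute linepath_0' linepath_1')
qed

text \<open>By continuity the set where the bound fails is open, and a nonempty open set is not
  negligible.\<close>

lemma AE_bound_imp_bound_on_open:
  fixes f :: "point \<Rightarrow> real"
  assumes D: "open D" and f: "continuous_on D f" and b: "AE x in lebesgue_on D. \<bar>f x\<bar> \<le> B" and x: "x \<in> D"
  shows "\<bar>f x\<bar> \<le> B"
proof (rule ccontr)
  assume *: "\<not> \<bar>f x\<bar> \<le> B"
  define V where "V = {y \<in> D. f y \<in> - {-B..B}}"
  have "open V" unfolding V_def using D f
    using continuous_open_preimage[of D f "- {-B..B}"] by (simp add: vimage_def Int_def closed_real_atLeastAtMost open_Compl)
  moreover have "x \<in> V" using x * by (auto simp: V_def)
  moreover have "negligible V"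
  proof -
    have "AE y in lebesgue. y \<in> D \<longrightarrow> \<bar>f y\<bar> \<le> B"
      using b D by (subst (asm) AE_restrict_space_iff) auto
    then have "AE y in lebesgue. y \<notin> V" by (rule AE_mp) (auto simp: V_def)
    then show ?thesis using \<open>open V\<close> by (simp add: negligible_iff_null_sets AE_iff_null_sets)
  qed
  ultimately show False using open_not_negligible by blast
qed


section \<open>Triangles and triangulations\<close>

definition cross2 :: "point \<Rightarrow> point \<Rightarrow> real" where
  "cross2 x y = x $ 1 * y $ 2 - x $ 2 * y $ 1"

text \<open>The quarter turn: it yields the normals of edges, and \<open>rot_inner\<close> links
  fluxes through segments with signed areas.\<close>

definition rot :: "point \<Rightarrow> point" where
  "rot x = vector [- x $ 2, x $ 1]"

lemma rot_nth [simp]: "rot x $ 1 = - x $ 2" "rot x $ 2 = x $ 1"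
  by (simp_all add: rot_def)

lemma inner_2: "(x::point) \<bullet> y = x $ 1 * y $ 1 + x $ 2 * y $ 2"
  by (simp add: inner_vec_def UNIV_2)

lemma rot_inner: "rot x \<bullet> y = cross2 x y"
  by (simp add: inner_2 cross2_def)

lemma norm_rot [simp]: "norm (rot x) = norm x"
  by (simp add: norm_eq_sqrt_inner inner_2)

lemma point_eq_iff: "(x::point) = y \<longleftrightarrow> x $ 1 = y $ 1 \<and> x $ 2 = y $ 2"
  by (simp add: vec_eq_iff forall_2)

lemma eq_0_if_inner_0:
  assumes "cross2 x y \<noteq> 0" "g \<bullet> x = 0" "g \<bullet> y = 0"
  shows "g = 0"
proof -
  have "g $ 1 * cross2 x y = (g \<bullet> x) * y $ 2 - (g \<bullet> y) * x $ 2"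
    "g $ 2 * cross2 x y = (g \<bullet> y) * x $ 1 - (g \<bullet> x) * y $ 1"
    by (simp_all add: inner_2 cross2_def algebra_simps)
  then show ?thesis using assms by (simp add: point_eq_iff)
qed

definition triangle :: "point \<Rightarrow> point \<Rightarrow> point \<Rightarrow> bool" where
  "triangle a b c \<longleftrightarrow> cross2 (b - a) (c - a) \<noteq> 0"

lemma content_triangle_cross: "measure lebesgue (convex hull {a, b, c}) = \<bar>cross2 (b - a) (c - a)\<bar> / 2"
proof -
  have "measure lebesgue (convex hull {a, b, c}) = measure lborel (convex hull {a, b, c})"
    by (rule measure_completion) (simp add: compact_imp_closed finite_imp_compact_convex_hull)
  then show ?thesis by (simp add: content_triangle cross2_def abs_minus_commute mult.commute)
qed

text \<open>Affine independence is turned into a nonzero determinant by way of the area: a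
  two-dimensional simplex has interior points, hence positive measure.\<close>

lemma simplex_2_obtain:
  assumes "2 simplex (K :: point set)"
  obtains a b c where "K = convex hull {a, b, c}" "triangle a b c" "\<not> affine_dependent {a, b, c}"
    "a \<noteq> b" "b \<noteq> c" "a \<noteq> c"
proof -
  obtain C where C: "\<not> affine_dependent C" "int (card C) = 3" "K = convex hull C"
    using assms by (auto simp: simplex)
  then have "card C = 3" by simp
  then obtain a b c where abc: "C = {a, b, c}" "a \<noteq> b" "a \<noteq> c" "b \<noteq> c"
    by (auto simp: card_3_iff)
  have "aff_dim K = 2" using assms by (rule aff_dim_simplex)
  then have "interior K \<noteq> {}" using C(3) rel_interior_eq_empty[of K] abc
    by (simp add: interior_rel_interior_gen)
  then have "\<not> negligible K" using open_not_negligible[of "interior K"] interior_subset negligible_subset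
    by (metis open_interior)
  moreover have "K \<in> lmeasurable" using C(3) abc by (simp add: lmeasurable_compact finite_imp_compact_convex_hull)
  ultimately have "measure lebesgue K \<noteq> 0" by (simp add: measure_eq_0_null_sets negligible_iff_measure0)
  then have "triangle a b c" using C(3) abc content_triangle_cross[of a b c] by (simp add: triangle_def)
  then show ?thesis using that C abc by auto
qed

text \<open>Faces of a simplex are the hulls of subsets of its vertices, and dimension one singles
  out the two-element subsets.\<close>

lemma edge_of_triangle:
  assumes "\<not> affine_dependent {a, b, c :: point}" "a \<noteq> b" "b \<noteq> c" "a \<noteq> c"
  shows "e edge_of convex hull {a, b, c} \<longleftrightarrow>
    e = closed_segment a b \<or> e = closed_segment b c \<or> e = closed_segment c a"
proof
  assume "e edge_of convex hull {a, b, c}"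
  then obtain S where S: "S \<subseteq> {a, b, c}" "e = convex hull S" "aff_dim S = 1"
    using face_of_convex_hull_affine_independent[OF assms(1)]
    by (auto simp: edge_of_def aff_dim_convex_hull)
  have "aff_dim S = int (card S) - 1"
    using aff_dim_affine_independent[OF affine_independent_subset[OF assms(1) S(1)]] by simp
  then have "card S = 2" using S by simp
  then have "S = {a, b} \<or> S = {b, c} \<or> S = {c, a}"
    using S(1) by (auto simp: card_2_iff)
  then show "e = closed_segment a b \<or> e = closed_segment b c \<or> e = closed_segment c a"
    using S(2) by (auto simp: segment_convex_hull)
next
  have "closed_segment p q edge_of convex hull {a, b, c}" if "{p, q} \<subseteq> {a, b, c}" "p \<noteq> q" for p q
  proof -
    have "\<not> affine_dependent {p, q}" using that assms(1) affine_independent_subset by blast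
    then have "aff_dim {p, q} = 1" using that by (simp add: aff_dim_2)
    moreover have "closed_segment p q face_of convex hull {a, b, c}"
      using face_of_convex_hull_affine_independent[OF assms(1)] that by (metis segment_convex_hull)
    ultimately show ?thesis by (simp add: edge_of_def segment_convex_hull aff_dim_convex_hull)
  qed
  then show "e = closed_segment a b \<or> e = closed_segment b c \<or> e = closed_segment c a \<Longrightarrow>
      e edge_of convex hull {a, b, c}" using assms by auto
qed

lemma edge_mid_segment [simp]: "edge_mid (closed_segment a b) = midpoint a b"
  unfolding edge_mid_def
proof (rule the_equality)
  show "\<exists>aa ba. closed_segment a b = closed_segment aa ba \<and> midpoint a b = midpoint aa ba" by blast
  fix m assume "\<exists>aa ba. closed_segment a b = closed_segment aa ba \<and> m = midpoint aa ba"
  then obtain p q where "{a, b} = {p, q}" "m = midpoint p q" by (auto simp: closed_segment_eq)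
  then show "m = midpoint a b" by (auto simp: doubleton_eq_iff midpoint_sym)
qed

lemma mids_triangle:
  assumes "\<not> affine_dependent {a, b, c :: point}" "a \<noteq> b" "b \<noteq> c" "a \<noteq> c"
  shows "mids {convex hull {a, b, c}} = {midpoint a b, midpoint b c, midpoint c a}"
proof -
  have "edges {convex hull {a, b, c}} = {closed_segment a b, closed_segment b c, closed_segment c a}"
    using edge_of_triangle[OF assms] by (auto simp: edges_def)
  then show ?thesis by (simp add: mids_def)
qed

lemma edge_of_obtain:
  assumes "2 simplex (K :: point set)" "e edge_of K"
  obtains a b where "e = closed_segment a b" "a \<noteq> b" "edge_mid e = midpoint a b" "a \<in> K" "b \<in> K"
proof -
  obtain a b c where abc: "K = convex hull {a, b, c}" "\<not> affine_dependent {a, b, c}" "a \<noteq> b" "b \<noteq> c" "a \<noteq> c"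
    using simplex_2_obtain[OF assms(1)] by metis
  have v: "{a, b, c} \<subseteq> K" unfolding abc(1) by (rule hull_subset)
  have "e = closed_segment a b \<or> e = closed_segment b c \<or> e = closed_segment c a"
    using edge_of_triangle[OF abc(2-5)] assms(2) abc(1) by auto
  then show ?thesis using that[of a b] that[of b c] that[of c a] abc v by (elim disjE) auto
qed

lemma edge_mid_in_edge:
  assumes "2 simplex (K :: point set)" "e edge_of K" shows "edge_mid e \<in> e"
  using edge_of_obtain[OF assms] by (metis midpoint_in_closed_segment)

text \<open>The midpoint is a relative interior point of the edge, and a face that contains such a
  point contains both end points. In this way midpoints can stand for edges.\<close>

lemma edge_subset_face:
  assumes "2 simplex (K :: point set)" "e edge_of K" "F face_of K" "edge_mid e \<in> F"
  shows "e \<subseteq> F"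
proof -
  obtain a b where ab: "e = closed_segment a b" "a \<noteq> b" "edge_mid e = midpoint a b" "a \<in> K" "b \<in> K"
    using edge_of_obtain[OF assms(1,2)] .
  have "midpoint a b \<in> open_segment a b" using ab(2) by simp
  moreover have "midpoint a b \<in> F" using assms(4) ab by simp
  ultimately have "a \<in> F" "b \<in> F" using assms(3) ab unfolding face_of_def by blast+
  then show ?thesis using ab(1) face_of_imp_convex[OF assms(3)] by (simp add: closed_segment_subset)
qed

section \<open>Conforming meshes\<close>

locale triangle_mesh =
  fixes \<T> :: "point set set"
  assumes triangulation: "triangulation \<T>"
    and simplex2: "\<And>K. K \<in> \<T> \<Longrightarrow> 2 simplex K"
begin

lemma finite_mesh: "finite \<T>"
  using triangulation by (simp add: triangulation_def)

lemma face_inter: "K \<in> \<T> \<Longrightarrow> K' \<in> \<T> \<Longrightarrow> (K \<inter> K') face_of K"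
  using triangulation by (auto simp: triangulation_def)

lemma compact_tri: "K \<in> \<T> \<Longrightarrow> compact K"
  and convex_tri: "K \<in> \<T> \<Longrightarrow> convex K"
  and aff_dim_tri: "K \<in> \<T> \<Longrightarrow> aff_dim K = 2"
  using simplex2 compact_simplex convex_simplex aff_dim_simplex by blast+

lemma closed_tri: "K \<in> \<T> \<Longrightarrow> closed K"
  using compact_tri compact_imp_closed by blast

lemma interior_tri: "K \<in> \<T> \<Longrightarrow> interior K \<noteq> {}"
  using convex_tri[of K] aff_dim_tri[of K] rel_interior_eq_empty[of K]
  by (auto simp: interior_rel_interior_gen)

lemma closure_interior_tri: "K \<in> \<T> \<Longrightarrow> closure (interior K) = K"
  using convex_closure_interior[OF convex_tri interior_tri] closed_tri by (simp add: closure_closed)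

text \<open>The intersection is a face of both triangles, and a face that meets the interior is the
  whole triangle; used twice, this gives K = K'.\<close>

lemma interior_Int_tri:
  assumes "K \<in> \<T>" "K' \<in> \<T>" "K \<noteq> K'"
  shows "interior K \<inter> K' = {}"
proof (rule ccontr)
  assume ne: "interior K \<inter> K' \<noteq> {}"
  then have "(K \<inter> K') \<inter> interior K \<noteq> {}" using interior_subset by blast
  then have 1: "K \<inter> K' = K" using face_of_disjoint_interior[OF face_inter[OF assms(1,2)]] by blast
  then have "interior K \<subseteq> interior K'" by (metis Int_lower2 interior_mono)
  then have "(K' \<inter> K) \<inter> interior K' \<noteq> {}" using ne interior_subset by blast
  then have "K' \<inter> K = K'" using face_of_disjoint_interior[OF face_inter[OF assms(2,1)]] by blast
  then show False using 1 assms(3) by blast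
qed

text \<open>The interior of a triangle avoids the boundaries of all triangles, hence the frontier of
  an aligned set, and it is connected.\<close>

lemma interior_subset_or_disjoint:
  assumes S: "open S" "aligned \<T> S" and K: "K \<in> \<T>"
  shows "interior K \<subseteq> S \<or> interior K \<inter> S = {}"
proof -
  have "interior K \<inter> frontier K' = {}" if "K' \<in> \<T>" for K'
    using interior_Int_tri[OF K that] closed_tri[OF that] by (cases "K = K'") (auto simp: frontier_def)
  then have "interior K \<inter> frontier S = {}" using S(2) unfolding aligned_def by blast
  then show ?thesis
    using connected_Int_frontier[of "interior K" S] convex_connected[OF convex_interior[OF convex_tri[OF K]]]
    by blast
qed

text \<open>By conformity the midpoint lies in the common face of the two triangles, which then
  contains the whole edge.\<close>

lemma edge_of_if_mid:
  assumes "K \<in> \<T>" "e \<in> edges \<T>" "edge_mid e \<in> K"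
  shows "e edge_of K"
proof -
  obtain K' where K': "K' \<in> \<T>" "e edge_of K'" using assms(2) by (auto simp: edges_def)
  have F: "(K' \<inter> K) face_of K'" "(K \<inter> K') face_of K" by (simp_all add: face_inter assms(1) K'(1))
  have s: "e \<subseteq> K' \<inter> K"
    using edge_subset_face[OF simplex2[OF K'(1)] K'(2) F(1)] assms(3) edge_mid_in_edge[OF simplex2[OF K'(1)] K'(2)]
      edge_of_imp_subset[OF K'(2)] by blast
  have "e face_of (K' \<inter> K)"
    using K'(2) face_of_subset[of e K' "K' \<inter> K"] s by (auto simp: edge_of_def)
  then have "e face_of K" using face_of_trans F(2) by (metis inf_commute)
  then show ?thesis using K'(2) by (simp add: edge_of_def)
qed

lemma mids_iff: "K \<in> \<T> \<Longrightarrow> m \<in> mids {K} \<longleftrightarrow> m \<in> mids \<T> \<and> m \<in> K"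
proof
  assume K: "K \<in> \<T>" and "m \<in> mids {K}"
  then obtain e where "e edge_of K" "m = edge_mid e" by (auto simp: mids_def edges_def)
  then show "m \<in> mids \<T> \<and> m \<in> K"
    using K edge_mid_in_edge[OF simplex2[OF K]] edge_of_imp_subset by (fastforce simp: mids_def edges_def)
next
  assume K: "K \<in> \<T>" and "m \<in> mids \<T> \<and> m \<in> K"
  then show "m \<in> mids {K}" using edge_of_if_mid[OF K] by (auto simp: mids_def edges_def)
qed

text \<open>Both are edges of one triangle, and a face contained in another of the same dimension
  coincides with it.\<close>

lemma edge_unique:
  assumes "e \<in> edges \<T>" "e' \<in> edges \<T>" "edge_mid e \<in> e'"
  shows "e = e'"
proof -
  obtain K where K: "K \<in> \<T>" "e' edge_of K" using assms(2) by (auto simp: edges_def)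
  then have e: "e edge_of K" using assms edge_of_if_mid edge_of_imp_subset by blast
  have "e \<subseteq> e'"
    using edge_subset_face[OF simplex2[OF K(1)] e _ assms(3)] K(2) by (simp add: edge_of_def)
  then have f: "e face_of e'" using e face_of_subset K(2) by (metis edge_of_def face_of_imp_subset)
  have "convex e'" using K(2) face_of_imp_convex by (auto simp: edge_of_def)
  then show ?thesis using face_of_aff_dim_lt[OF _ f] e K(2) by (auto simp: edge_of_def)
qed

lemma mids_not_interior:
  assumes "m \<in> mids \<T>" "K \<in> \<T>" shows "m \<notin> interior K"
proof
  assume m: "m \<in> interior K"
  obtain e where e: "e \<in> edges \<T>" "m = edge_mid e" using assms by (auto simp: mids_def)
  then have ek: "e edge_of K" using edge_of_if_mid[OF assms(2)] m interior_subset by blast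
  then have "e \<noteq> K" using aff_dim_tri[OF assms(2)] by (auto simp: edge_of_def)
  then have "e \<inter> interior K = {}" using ek face_of_disjoint_interior by (auto simp: edge_of_def)
  then show False using m e edge_mid_in_edge[OF simplex2[OF assms(2)] ek] by blast
qed

text \<open>The common face is the hull of a set of vertices: not of all three, since interiors are
  disjoint, and not of a single one, since \<open>q\<close> is no vertex. So it is an edge, and its
  midpoint is shared.\<close>

lemma common_mid:
  assumes K: "K \<in> \<T>" "K' \<in> \<T>" "K \<noteq> K'" and q: "q \<in> K" "q \<in> K'" "\<not> q extreme_point_of K"
  shows "mids {K} \<inter> mids {K'} \<noteq> {}"
proof -
  obtain a b c where abc: "K = convex hull {a, b, c}" "\<not> affine_dependent {a, b, c}" "a \<noteq> b" "b \<noteq> c" "a \<noteq> c"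
    using simplex_2_obtain[OF simplex2[OF K(1)]] by metis
  obtain S where S: "S \<subseteq> {a, b, c}" "K \<inter> K' = convex hull S"
    using face_inter[OF K(1,2)] face_of_convex_hull_affine_independent[OF abc(2)] abc(1) by auto
  have "S \<noteq> {a, b, c}"
  proof
    assume "S = {a, b, c}"
    then have "K \<subseteq> K'" using S abc by blast
    then show False using interior_Int_tri[OF K] interior_tri[OF K(1)] interior_subset by blast
  qed
  moreover have "\<not> (\<exists>x. S \<subseteq> {x})"
  proof
    assume "\<exists>x. S \<subseteq> {x}"
    then have "S = {} \<or> (\<exists>x. S = {x})" by blast
    moreover have "q \<in> convex hull S" using q S(2) by blast
    ultimately have S1: "S = {q}" by auto
    then have "{q} face_of K" using face_inter[OF K(1,2)] S(2) q by auto
    then show False using q(3) by (simp add: face_of_singleton)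
  qed
  ultimately have "\<exists>p q. p \<noteq> q \<and> S = {p, q} \<and> {p, q} \<subseteq> {a, b, c}"
  proof -
    have fin: "finite S" using S(1) finite_subset by blast
    have "card S < card {a, b, c}"
      using S(1) \<open>S \<noteq> {a, b, c}\<close> by (intro psubset_card_mono) auto
    then have "card S < 3" using abc(3-5) by simp
    moreover have "card S \<noteq> 0" using \<open>\<not> (\<exists>x. S \<subseteq> {x})\<close> fin by auto
    moreover have "card S \<noteq> 1" using \<open>\<not> (\<exists>x. S \<subseteq> {x})\<close> by (auto simp: card_1_singleton_iff)
    ultimately have "card S = 2" by linarith
    then show ?thesis using S(1) by (metis card_2_iff)
  qed
  then obtain p r where pr: "p \<noteq> r" "S = {p, r}" "{p, r} \<subseteq> {a, b, c}" by blast
  have e: "closed_segment p r edge_of K"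
    using edge_of_triangle[OF abc(2-5), of "closed_segment p r"] pr abc(1) by (auto simp: closed_segment_commute)
  have "midpoint p r \<in> K \<inter> K'" using S(2) pr(2) by (metis midpoint_in_closed_segment segment_convex_hull)
  moreover have "midpoint p r \<in> mids {K}" using e by (force simp: mids_def edges_def)
  ultimately show ?thesis using mids_iff[OF K(1)] mids_iff[OF K(2)] by blast
qed

end


section \<open>Crouzeix-Raviart functions\<close>

text \<open>The affine piece on a triangle is unique, which makes the choice harmless. Attaching the
  gradient to the triangle instead of the point turns both forms into finite sums.\<close>

definition cr_grad :: "(point \<Rightarrow> real) \<Rightarrow> point set \<Rightarrow> point" where
  "cr_grad v K = (SOME g. \<exists>c. \<forall>x \<in> interior K \<union> mids {K}. v x = g \<bullet> x + c)"

lemma solve_inner_2: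
  assumes "cross2 x y \<noteq> 0"
  shows "\<exists>g. g \<bullet> x = s \<and> g \<bullet> y = (t::real)"
proof -
  define g where "g = (1 / cross2 x y) *\<^sub>R (t *\<^sub>R rot x - s *\<^sub>R rot y)"
  have "cross2 y x = - cross2 x y" "cross2 x x = 0" "cross2 y y = 0" by (simp_all add: cross2_def)
  then have "g \<bullet> x = s \<and> g \<bullet> y = t"
    using assms by (simp add: g_def inner_diff_left rot_inner)
  then show ?thesis by blast
qed

context triangle_mesh
begin

lemma tri_obtain:
  assumes "K \<in> \<T>"
  obtains a b c where "K = convex hull {a, b, c}" "triangle a b c"
    "mids {K} = {midpoint a b, midpoint b c, midpoint c a}"
    "a \<noteq> b" "b \<noteq> c" "a \<noteq> c" "\<not> affine_dependent {a, b, c}"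
  using simplex_2_obtain[OF simplex2[OF assms]] mids_triangle by metis

lemma mids_eq_UN: "mids \<T> = (\<Union>K\<in>\<T>. mids {K})"
  by (auto simp: mids_def edges_def)

lemma finite_mids_single: "K \<in> \<T> \<Longrightarrow> finite (mids {K})"
  by (erule tri_obtain) simp

lemma finite_mids: "finite (mids \<T>)"
  unfolding mids_eq_UN using finite_mesh finite_mids_single by blast

lemma mids_subset_tri: "K \<in> \<T> \<Longrightarrow> mids {K} \<subseteq> K"
  using mids_iff by blast

lemma finite_edges: "finite (edges \<T>)"
proof -
  have "inj_on edge_mid (edges \<T>)"
  proof (rule inj_onI)
    fix e e' assume e: "e \<in> edges \<T>" "e' \<in> edges \<T>" "edge_mid e = edge_mid e'"
    then have "edge_mid e \<in> e'" using edge_mid_in_edge simplex2 by (auto simp: edges_def)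
    then show "e = e'" using edge_unique e by blast
  qed
  then show ?thesis using finite_mids finite_imageD unfolding mids_def by blast
qed

text \<open>Twice the difference of two midpoints is an edge vector, and two edge vectors span the
  plane.\<close>

lemma inner_mids_eq_0:
  assumes "K \<in> \<T>" "\<And>m m'. m \<in> mids {K} \<Longrightarrow> m' \<in> mids {K} \<Longrightarrow> g \<bullet> (m - m') = 0"
  shows "g = 0"
proof -
  obtain a b c where abc: "triangle a b c" "mids {K} = {midpoint a b, midpoint b c, midpoint c a}"
    using tri_obtain[OF assms(1)] by metis
  have "g \<bullet> (b - a) = 2 * (g \<bullet> (midpoint b c - midpoint c a))"
    "g \<bullet> (c - a) = 2 * (g \<bullet> (midpoint b c - midpoint a b))"
    by (simp_all add: midpoint_def inner_diff_right inner_add_right field_simps)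
  then have "g \<bullet> (b - a) = 0" "g \<bullet> (c - a) = 0" using assms(2) abc(2) by auto
  then show ?thesis using abc(1) eq_0_if_inner_0 unfolding triangle_def by blast
qed

lemma cr_affine:
  assumes "v \<in> CR \<Omega> \<T>" "K \<in> \<T>"
  shows "\<exists>c. \<forall>x \<in> interior K \<union> mids {K}. v x = cr_grad v K \<bullet> x + c"
  unfolding cr_grad_def by (rule someI_ex) (use assms in \<open>auto simp: CR_def\<close>)

lemma cr_grad_diff:
  assumes "v \<in> CR \<Omega> \<T>" "K \<in> \<T>" "m \<in> mids {K}" "m' \<in> mids {K}"
  shows "v m - v m' = cr_grad v K \<bullet> (m - m')"
  using cr_affine[OF assms(1,2)] assms(3,4) by (auto simp: inner_diff_right)

lemma cr_grad_unique:
  assumes "v \<in> CR \<Omega> \<T>" "K \<in> \<T>"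
    and "\<And>m m'. m \<in> mids {K} \<Longrightarrow> m' \<in> mids {K} \<Longrightarrow> v m - v m' = g \<bullet> (m - m')"
  shows "cr_grad v K = g"
proof -
  have "(cr_grad v K - g) \<bullet> (m - m') = 0" if "m \<in> mids {K}" "m' \<in> mids {K}" for m m'
    using cr_grad_diff[OF assms(1,2) that] assms(3)[OF that] by (simp add: inner_diff_left)
  then show ?thesis using inner_mids_eq_0[OF assms(2)] by fastforce
qed

lemma grad_eq_cr_grad:
  assumes "v \<in> CR \<Omega> \<T>" "K \<in> \<T>" "x \<in> interior K"
  shows "grad v x = cr_grad v K"
proof -
  obtain c where c: "\<And>y. y \<in> interior K \<Longrightarrow> v y = cr_grad v K \<bullet> y + c"
    using cr_affine[OF assms(1,2)] by blast
  have "((\<lambda>y. cr_grad v K \<bullet> y + c) has_derivative (\<lambda>h. h \<bullet> cr_grad v K)) (at x)"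
    by (auto intro!: derivative_eq_intros simp: inner_commute)
  then have D: "GDERIV v x :> cr_grad v K"
    unfolding gderiv_def
    by (rule has_derivative_transform_within_open[of _ _ _ _ "interior K"]) (use c assms(3) in auto)
  have "G = cr_grad v K" if "GDERIV v x :> G" for G
  proof -
    have "(\<lambda>h. h \<bullet> G) = (\<lambda>h. h \<bullet> cr_grad v K)"
      using has_derivative_unique that D unfolding gderiv_def by blast
    then have "\<forall>h. h \<bullet> G = h \<bullet> cr_grad v K" by (rule fun_cong[THEN allI])
    then show ?thesis by (simp only: vector_eq_ldot)
  qed
  then show ?thesis using D unfolding grad_def by blast
qed

lemma CR_lincomb:
  assumes "u \<in> CR \<Omega> \<T>" "w \<in> CR \<Omega> \<T>"
  shows "(\<lambda>x. s * u x + t * w x) \<in> CR \<Omega> \<T>"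
proof -
  have "\<exists>g c. \<forall>x \<in> interior K \<union> mids {K}. s * u x + t * w x = g \<bullet> x + c" if K: "K \<in> \<T>" for K
  proof -
    obtain c d where "\<forall>x \<in> interior K \<union> mids {K}. u x = cr_grad u K \<bullet> x + c"
      "\<forall>x \<in> interior K \<union> mids {K}. w x = cr_grad w K \<bullet> x + d"
      using cr_affine K assms by meson
    then show ?thesis
      by (intro exI[of _ "s *\<^sub>R cr_grad u K + t *\<^sub>R cr_grad w K"] exI[of _ "s * c + t * d"])
        (auto simp: inner_add_left algebra_simps)
  qed
  then show ?thesis using assms by (auto simp: CR_def)
qed

lemma cr_grad_lincomb:
  assumes "u \<in> CR \<Omega> \<T>" "w \<in> CR \<Omega> \<T>" "K \<in> \<T>"
  shows "cr_grad (\<lambda>x. s * u x + t * w x) K = s *\<^sub>R cr_grad u K + t *\<^sub>R cr_grad w K"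
proof (rule cr_grad_unique[OF CR_lincomb[OF assms(1,2)] assms(3)])
  fix m m' assume m: "m \<in> mids {K}" "m' \<in> mids {K}"
  have "(s *\<^sub>R cr_grad u K + t *\<^sub>R cr_grad w K) \<bullet> (m - m') = s * (u m - u m') + t * (w m - w m')"
    unfolding cr_grad_diff[OF assms(1,3) m] cr_grad_diff[OF assms(2,3) m] by (simp add: inner_add_left)
  then show "s * u m + t * w m - (s * u m' + t * w m') = (s *\<^sub>R cr_grad u K + t *\<^sub>R cr_grad w K) \<bullet> (m - m')"
    by (simp add: algebra_simps)
qed

lemma zero_CR: "(\<lambda>x. 0) \<in> CR \<Omega> \<T>"
  by (auto simp: CR_def intro: exI[of _ 0])

text \<open>Midpoint values are the degrees of freedom. Equality holds at every point because
  representatives are normalised to 0 away from open triangles and midpoints.\<close>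

lemma CR_ext:
  assumes "v \<in> CR \<Omega> \<T>" "w \<in> CR \<Omega> \<T>" "\<And>m. m \<in> mids \<T> \<Longrightarrow> v m = w m"
  shows "v = w"
proof
  fix x
  show "v x = w x"
  proof (cases "\<exists>K\<in>\<T>. x \<in> interior K")
    case True
    then obtain K where K: "K \<in> \<T>" "x \<in> interior K" by blast
    have m: "v m = w m" if "m \<in> mids {K}" for m using assms(3) mids_iff[OF K(1)] that by blast
    have g: "cr_grad v K = cr_grad w K"
      by (rule cr_grad_unique[OF assms(1) K(1)]) (simp add: m cr_grad_diff[OF assms(2) K(1)])
    obtain m where mk: "m \<in> mids {K}" using tri_obtain[OF K(1)] by (metis insertI1)
    obtain c d where "\<forall>x \<in> interior K \<union> mids {K}. v x = cr_grad v K \<bullet> x + c"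
      "\<forall>x \<in> interior K \<union> mids {K}. w x = cr_grad w K \<bullet> x + d"
      using cr_affine K assms by meson
    then show ?thesis using m[OF mk] mk g K(2) by auto
  next
    case False
    then show ?thesis using assms(3)[of x] assms(1,2) by (cases "x \<in> mids \<T>") (auto simp: CR_def)
  qed
qed

lemma CR_interpolation:
  assumes f: "\<And>e. e \<in> edges \<T> - interior_edges \<Omega> \<T> \<Longrightarrow> f (edge_mid e) = 0"
  shows "\<exists>v\<in>CR \<Omega> \<T>. \<forall>m\<in>mids \<T>. v m = f m"
proof -
  have "\<exists>g c. \<forall>m\<in>mids {K}. f m = g \<bullet> m + c" if K: "K \<in> \<T>" for K
  proof -
    obtain a b c where abc: "triangle a b c" "mids {K} = {midpoint a b, midpoint b c, midpoint c a}"
      using tri_obtain[OF K] by metis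
    \<comment> \<open>The triangle of the midpoints has a quarter of the area, so it is
      nondegenerate and any three values at its corners are interpolated by an affine
      function.\<close>
    have "4 * cross2 (midpoint b c - midpoint a b) (midpoint c a - midpoint a b) = cross2 (b - a) (c - a)"
      by (simp add: midpoint_def cross2_def field_simps)
    then have "cross2 (midpoint b c - midpoint a b) (midpoint c a - midpoint a b) \<noteq> 0"
      using abc(1) by (simp add: triangle_def)
    then obtain g where "g \<bullet> (midpoint b c - midpoint a b) = f (midpoint b c) - f (midpoint a b)"
      "g \<bullet> (midpoint c a - midpoint a b) = f (midpoint c a) - f (midpoint a b)"
      using solve_inner_2 by blast
    then show ?thesis unfolding abc(2)
      by (intro exI[of _ g] exI[of _ "f (midpoint a b) - g \<bullet> midpoint a b"]) (auto simp: inner_diff_right)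
  qed
  then obtain g c where gc: "\<And>K m. K \<in> \<T> \<Longrightarrow> m \<in> mids {K} \<Longrightarrow> f m = g K \<bullet> m + c K" by metis
  define v where "v x = (if x \<in> mids \<T> then f x else if \<exists>K\<in>\<T>. x \<in> interior K
     then let K = (THE K. K \<in> \<T> \<and> x \<in> interior K) in g K \<bullet> x + c K else 0)" for x
  have vi: "v x = g K \<bullet> x + c K" if "K \<in> \<T>" "x \<in> interior K" for K x
  proof -
    have "(THE K. K \<in> \<T> \<and> x \<in> interior K) = K"
      using that interior_Int_tri interior_subset by (intro the_equality) blast+
    then show ?thesis using that mids_not_interior[of x K] by (auto simp: v_def)
  qed
  have vm: "v m = f m" if "m \<in> mids \<T>" for m using that by (simp add: v_def)
  have "v \<in> CR \<Omega> \<T>"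
    unfolding CR_def
  proof (intro CollectI conjI ballI allI impI)
    fix K assume K: "K \<in> \<T>"
    show "\<exists>g c. \<forall>x\<in>interior K \<union> mids {K}. v x = g \<bullet> x + c"
      by (intro exI[of _ "g K"] exI[of _ "c K"]) (use vi[OF K] vm mids_iff[OF K] gc[OF K] in auto)
  next
    fix e assume e: "e \<in> edges \<T> - interior_edges \<Omega> \<T>"
    then show "v (edge_mid e) = 0" using f[OF e] vm by (auto simp: mids_def)
  next
    fix x assume "x \<notin> (\<Union>K\<in>\<T>. interior K) \<union> mids \<T>"
    then show "v x = 0" by (auto simp: v_def)
  qed
  then show ?thesis using vm by blast
qed

end


section \<open>Comparison of the two forms on one triangle\<close>

text \<open>The integrands of \<open>a_FE\<close> are controlled only inside triangles, as \<alpha>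
  is arbitrary on interfaces. Completeness of Lebesgue measure gives measurability all the
  same.\<close>

lemma lebesgue_measurable_spike:
  fixes f g :: "'a::euclidean_space \<Rightarrow> real"
  assumes "g \<in> borel_measurable lebesgue" "negligible N" "\<And>x. x \<notin> N \<Longrightarrow> f x = g x"
  shows "f \<in> borel_measurable lebesgue"
  unfolding borel_measurable_iff_less
proof
  fix a
  have eq: "{w. f w < a} = ({w \<in> space lebesgue. g w < a} - N) \<union> ({w. f w < a} \<inter> N)"
    by (auto; metis assms(3))
  have g: "{w \<in> space lebesgue. g w < a} \<in> sets lebesgue"
    using assms(1) borel_measurable_iff_less by blast
  have n: "negligible ({w. f w < a} \<inter> N)"
    using assms(2) by (rule negligible_subset) simp
  have "{w. f w < a} \<in> sets lebesgue"
    by (subst eq) (rule sets.Un[OF sets.Diff[OF g negligible_imp_sets[OF assms(2)]] negligible_imp_sets[OF n]])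
  then show "{w \<in> space lebesgue. f w < a} \<in> sets lebesgue" by simp
qed

lemma lebesgue_integral_spike:
  fixes f g :: "'a::euclidean_space \<Rightarrow> real"
  assumes "g \<in> borel_measurable lebesgue" "negligible N" "\<And>x. x \<notin> N \<Longrightarrow> f x = g x"
  shows "(LINT x|lebesgue. f x) = (LINT x|lebesgue. g x)"
proof (rule integral_cong_AE)
  show "f \<in> borel_measurable lebesgue" by (rule lebesgue_measurable_spike[OF assms])
  show "AE x in lebesgue. f x = g x"
  proof (rule AE_I')
    show "N \<in> null_sets lebesgue" using assms(2) by (simp add: negligible_iff_null_sets)
  qed (use assms(3) in auto)
qed (rule assms(1))

lemma set_integrable_compact_lebesgue:
  fixes \<beta> :: "'a::euclidean_space \<Rightarrow> real"
  assumes "compact K" "continuous_on K \<beta>"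
  shows "integrable lebesgue (\<lambda>x. indicator K x * \<beta> x)"
proof -
  have i: "integrable lborel (\<lambda>x. indicator K x * \<beta> x)"
    using borel_integrable_compact[OF assms] by simp
  show ?thesis using i by (subst integrable_completion[OF borel_measurable_integrable[OF i]])
qed

lemma set_integral_interior_cong:
  fixes \<beta> F :: "'a::euclidean_space \<Rightarrow> real"
  assumes "compact K" "convex K" "continuous_on K \<beta>" "\<And>x. x \<in> interior K \<Longrightarrow> F x = \<beta> x"
  shows "(LINT x:K|lebesgue. F x) = (LINT x:K|lebesgue. \<beta> x)"
  unfolding set_lebesgue_integral_def
proof (rule lebesgue_integral_spike[where N = "frontier K"])
  show "(\<lambda>x. indicat_real K x *\<^sub>R \<beta> x) \<in> borel_measurable lebesgue"
    using set_integrable_compact_lebesgue[OF assms(1,3)] by (simp add: borel_measurable_integrable)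
  show "negligible (frontier K)" by (rule negligible_convex_frontier[OF assms(2)])
  fix x assume "x \<notin> frontier K"
  then show "indicat_real K x *\<^sub>R F x = indicat_real K x *\<^sub>R \<beta> x"
    using assms(4)[of x] closure_subset[of K] by (cases "x \<in> K") (auto simp: frontier_def)
qed

lemma set_integral_bounds:
  fixes \<beta> :: "'a::euclidean_space \<Rightarrow> real"
  assumes "compact K" "continuous_on K \<beta>" "\<And>x. x \<in> K \<Longrightarrow> l \<le> \<beta> x \<and> \<beta> x \<le> u"
  shows "l * measure lebesgue K \<le> (LINT x:K|lebesgue. \<beta> x)" "(LINT x:K|lebesgue. \<beta> x) \<le> u * measure lebesgue K"
proof -
  have i: "integrable lebesgue (\<lambda>x. indicator K x * \<beta> x)"
    by (rule set_integrable_compact_lebesgue[OF assms(1,2)])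
  have c: "integrable lebesgue (\<lambda>x. indicator K x * c)" for c :: real
    by (rule set_integrable_compact_lebesgue[OF assms(1)]) auto
  have "K \<in> lmeasurable" using assms(1) by (rule lmeasurable_compact)
  then have m: "(LINT x|lebesgue. indicator K x * c) = c * measure lebesgue K" for c :: real
    by (simp add: lmeasure_integral mult.commute)
  have "(LINT x|lebesgue. indicator K x * l) \<le> (LINT x|lebesgue. indicator K x * \<beta> x)"
    by (rule integral_mono[OF c i]) (use assms(3) in \<open>auto simp: indicator_def\<close>)
  then show "l * measure lebesgue K \<le> (LINT x:K|lebesgue. \<beta> x)" by (simp add: m set_lebesgue_integral_def mult.commute)
  have "(LINT x|lebesgue. indicator K x * \<beta> x) \<le> (LINT x|lebesgue. indicator K x * u)"
    by (rule integral_mono[OF i c]) (use assms(3) in \<open>auto simp: indicator_def\<close>)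
  then show "(LINT x:K|lebesgue. \<beta> x) \<le> u * measure lebesgue K" by (simp add: m set_lebesgue_integral_def mult.commute)
qed

section \<open>Outward normals of control volumes\<close>

lemma outward_normal_eqI:
  assumes n: "norm n = 1" and r: "r > 0" and S: "S \<inter> ball x r = {y \<in> ball x r. (y - x) \<bullet> n \<le> 0}"
  shows "outward_normal S x = n"
  unfolding outward_normal_def
proof (rule the_equality)
  show "norm n = 1 \<and> (\<exists>r>0. S \<inter> ball x r = {y \<in> ball x r. (y - x) \<bullet> n \<le> 0})" using assms by blast
next
  fix n' assume "norm n' = 1 \<and> (\<exists>r>0. S \<inter> ball x r = {y \<in> ball x r. (y - x) \<bullet> n' \<le> 0})"
  then obtain r' where n': "norm n' = 1" "r' > 0" "S \<inter> ball x r' = {y \<in> ball x r'. (y - x) \<bullet> n' \<le> 0}" by blast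
  define \<epsilon> where "\<epsilon> = min r r' / 3"
  have \<epsilon>: "\<epsilon> > 0" "3 * \<epsilon> \<le> r" "3 * \<epsilon> \<le> r'" using r n'(2) by (auto simp: \<epsilon>_def)
  \<comment> \<open>This step stays in the half-plane of \<open>n\<close>, because n' . n is at most
    1, and it moves in the direction \<open>n'\<close> unless the two unit vectors agree. A third of
    the radius suffices since |n' - n| is at most 2.\<close>
  define y where "y = x + \<epsilon> *\<^sub>R (n' - n)"
  have "norm (n' - n) \<le> 2" using norm_triangle_ineq4[of n' n] n n' by simp
  then have "dist x y \<le> \<epsilon> * 2" using \<epsilon> by (simp add: y_def dist_norm)
  then have b: "y \<in> ball x r" "y \<in> ball x r'" using \<epsilon> by auto
  have nn: "n \<bullet> n = 1" "n' \<bullet> n' = 1" using n n' by (simp_all add: dot_square_norm)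
  have "n' \<bullet> n \<le> 1" using norm_cauchy_schwarz[of n' n] n n' by simp
  then have "(y - x) \<bullet> n \<le> 0" using \<epsilon> nn by (simp add: y_def inner_diff_left mult_le_0_iff)
  then have "y \<in> S" using S b by blast
  then have "(y - x) \<bullet> n' \<le> 0" using n' b by blast
  moreover have "(y - x) \<bullet> n' = \<epsilon> * (1 - n' \<bullet> n)"
    using nn by (simp add: y_def inner_diff_left inner_diff_right inner_commute)
  ultimately have "n' \<bullet> n \<ge> 1" using \<epsilon>(1) by (simp add: mult_le_0_iff)
  then have "(n' - n) \<bullet> (n' - n) \<le> 0" using nn by (simp add: inner_diff_left inner_diff_right inner_commute)
  then show "n' = n" by (metis inner_gt_zero_iff eq_iff_diff_eq_0 not_less)
qed

text \<open>In the affine coordinates \<open>\<xi>\<close>, \<open>\<mu>\<close> based at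
  \<open>z\<close> the triangle is cut out by three inequalities, and at a point of the open side
  from \<open>z\<close> to \<open>a\<close> only \<open>0 \<le> \<mu>\<close> is active. The sign
  function in the normal accounts for the orientation.\<close>

lemma triangle_locally_halfplane:
  fixes z a b :: point
  assumes D: "cross2 (a - z) (b - z) \<noteq> 0" and t: "0 < t" "t < 1"
  defines "x \<equiv> linepath z a t"
  shows "\<exists>r>0. \<forall>y\<in>ball x r. y \<in> convex hull {z, a, b} \<longleftrightarrow>
    (y - x) \<bullet> (- (sgn (cross2 (a - z) (b - z)) / norm (a - z)) *\<^sub>R rot (a - z)) \<le> 0"
proof -
  define D where "D = cross2 (a - z) (b - z)"
  have D0: "D \<noteq> 0" using assms by (simp add: D_def)
  define \<mu> where "\<mu> y = cross2 (a - z) (y - z) / D" for y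
  define \<xi> where "\<xi> y = cross2 (y - z) (b - z) / D" for y
  have az: "norm (a - z) > 0" using D by (auto simp: cross2_def)
  have rep: "y = z + \<xi> y *\<^sub>R (a - z) + \<mu> y *\<^sub>R (b - z)" for y
  proof -
    have "D * (y $ 1 - z $ 1) = cross2 (y - z) (b - z) * (a $ 1 - z $ 1) + cross2 (a - z) (y - z) * (b $ 1 - z $ 1)"
      "D * (y $ 2 - z $ 2) = cross2 (y - z) (b - z) * (a $ 2 - z $ 2) + cross2 (a - z) (y - z) * (b $ 2 - z $ 2)"
      unfolding D_def cross2_def by (simp_all add: algebra_simps)
    then have "y $ 1 - z $ 1 = (cross2 (y - z) (b - z) * (a $ 1 - z $ 1) + cross2 (a - z) (y - z) * (b $ 1 - z $ 1)) / D"
      "y $ 2 - z $ 2 = (cross2 (y - z) (b - z) * (a $ 2 - z $ 2) + cross2 (a - z) (y - z) * (b $ 2 - z $ 2)) / D"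
      using D0 by (simp_all add: eq_divide_eq mult.commute)
    then show ?thesis unfolding point_eq_iff \<xi>_def \<mu>_def by (simp add: add_divide_distrib diff_divide_distrib algebra_simps)
  qed
  have uniq: "\<xi> y = l \<and> \<mu> y = m" if "y = z + l *\<^sub>R (a - z) + m *\<^sub>R (b - z)" for y l m
  proof -
    have "cross2 (y - z) (b - z) = l * D" "cross2 (a - z) (y - z) = m * D"
      unfolding that D_def cross2_def by (simp_all add: algebra_simps)
    then show ?thesis using D0 by (simp add: \<xi>_def \<mu>_def)
  qed
  have hull: "y \<in> convex hull {z, a, b} \<longleftrightarrow> 0 \<le> \<xi> y \<and> 0 \<le> \<mu> y \<and> \<xi> y + \<mu> y \<le> 1" for y
    unfolding convex_hull_3_alt using rep[of y] uniq[of y] by auto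
  have x: "\<xi> x = t" "\<mu> x = 0" using uniq[of x t 0] by (auto simp: x_def linepath_def algebra_simps)
  have c: "continuous_on UNIV \<xi>" "continuous_on UNIV \<mu>"
    unfolding \<xi>_def[abs_def] \<mu>_def[abs_def] cross2_def by (intro continuous_intros D0; simp)+
  have "open {y. 0 < \<xi> y \<and> \<xi> y + \<mu> y < 1}"
    using c by (intro open_Collect_conj open_Collect_less continuous_intros) auto
  moreover have "x \<in> {y. 0 < \<xi> y \<and> \<xi> y + \<mu> y < 1}" using x t by simp
  ultimately obtain r where r: "r > 0" "ball x r \<subseteq> {y. 0 < \<xi> y \<and> \<xi> y + \<mu> y < 1}"
    using open_contains_ball by blast
  have "(y - x) \<bullet> (- (sgn D / norm (a - z)) *\<^sub>R rot (a - z)) \<le> 0 \<longleftrightarrow> 0 \<le> \<mu> y" for y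
  proof -
    have "(y - x) \<bullet> rot (a - z) = cross2 (a - z) (y - z)"
      by (simp add: inner_commute[of _ "rot _"] rot_inner x_def linepath_def cross2_def algebra_simps)
    then show ?thesis using D0 az
      by (auto simp: \<mu>_def sgn_real_def mult_le_0_iff zero_le_mult_iff zero_le_divide_iff)
  qed
  then show ?thesis using r hull unfolding D_def[symmetric]
    by (intro exI[of _ r]) (auto simp: subset_iff)
qed

text \<open>The divergence theorem for constant fields, summed by parts over the three segments from \<open>z\<close> to
  the vertices: the terms in \<open>z\<close> cancel.\<close>

lemma triangle_flux_identity:
  fixes a b c p q z :: point
  shows "(p \<bullet> rot (a - z)) * (q \<bullet> (b - c)) + (p \<bullet> rot (b - z)) * (q \<bullet> (c - a)) + (p \<bullet> rot (c - z)) * (q \<bullet> (a - b))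
    = cross2 (b - a) (c - a) * (p \<bullet> q)"
  by (simp add: inner_2 cross2_def algebra_simps)

context triangle_mesh
begin

text \<open>Barycentric weights are ratios of signed areas, so all three subtriangles inherit the
  orientation of the triangle.\<close>

lemma interior_tri_obtain:
  assumes K: "K \<in> \<T>" "K = convex hull {a, b, c}" "\<not> affine_dependent {a, b, c}" "a \<noteq> b" "b \<noteq> c" "a \<noteq> c"
    and z: "z \<in> interior K"
  obtains x y w where "x > 0" "y > 0" "w > 0"
    "cross2 (a - z) (b - z) = w * cross2 (b - a) (c - a)"
    "cross2 (b - z) (c - z) = x * cross2 (b - a) (c - a)"
    "cross2 (c - z) (a - z) = y * cross2 (b - a) (c - a)"
proof -
  have "\<not> collinear {a, b, c}" using K by (simp add: collinear_3_eq_affine_dependent)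
  then obtain x y w where w: "x > 0" "y > 0" "w > 0" "x + y + w = 1" "x *\<^sub>R a + y *\<^sub>R b + w *\<^sub>R c = z"
    using z K(2) interior_convex_hull_3_minimal[of a b c] by auto
  then have x: "x = 1 - y - w" by simp
  have "cross2 (a - z) (b - z) = w * cross2 (b - a) (c - a)"
    "cross2 (b - z) (c - z) = x * cross2 (b - a) (c - a)"
    "cross2 (c - z) (a - z) = y * cross2 (b - a) (c - a)"
    unfolding w(5)[symmetric] x by (simp_all add: cross2_def algebra_simps)
  then show ?thesis using that w by blast
qed

lemma linepath_interior_tri:
  assumes "K \<in> \<T>" "z \<in> interior K" "a \<in> K" "0 < t" "t < (1::real)"
  shows "linepath z a t \<in> interior K"
proof -
  have "linepath z a t = a - (1 - t) *\<^sub>R (a - z)" by (simp add: linepath_def algebra_simps)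
  then show ?thesis
    using mem_interior_convex_shrink[OF convex_tri[OF assms(1)] assms(2,3), of "1 - t"] assms(4,5) by simp
qed

text \<open>Near the segment only one subtriangle matters: the other half of the control volume lies
  in the neighbouring triangle, which misses the interior of \<open>K\<close>.\<close>

lemma outward_normal_control_volume:
  assumes K: "K \<in> \<T>" and e: "closed_segment a b edge_of K" and z: "\<And>K. K \<in> \<T> \<Longrightarrow> z K \<in> interior K"
    and D: "cross2 (a - z K) (b - z K) \<noteq> 0" and t: "0 < t" "t < 1"
  shows "outward_normal (control_volume \<T> z (closed_segment a b)) (linepath (z K) a t)
    = - (sgn (cross2 (a - z K) (b - z K)) / norm (a - z K)) *\<^sub>R rot (a - z K)"
proof -
  let ?S = "control_volume \<T> z (closed_segment a b)" and ?x = "linepath (z K) a t"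
  let ?n = "- (sgn (cross2 (a - z K) (b - z K)) / norm (a - z K)) *\<^sub>R rot (a - z K)"
  have aK: "a \<in> K" using edge_of_imp_subset[OF e] by auto
  have az: "norm (a - z K) > 0" using D by (auto simp: cross2_def)
  obtain r where r: "r > 0" "\<And>y. y \<in> ball ?x r \<Longrightarrow> y \<in> convex hull {z K, a, b} \<longleftrightarrow> (y - ?x) \<bullet> ?n \<le> 0"
    using triangle_locally_halfplane[OF D t] by blast
  have "?x \<in> interior K" by (rule linepath_interior_tri[OF K z[OF K] aK t])
  then obtain r' where r': "r' > 0" "ball ?x r' \<subseteq> interior K"
    using open_contains_ball open_interior by blast
  have "y \<in> ?S \<longleftrightarrow> y \<in> convex hull {z K, a, b}" if y: "y \<in> interior K" for y
  proof -
    have "convex hull insert (z K') (closed_segment a b) \<subseteq> K'" if "K' \<in> \<T>" "closed_segment a b edge_of K'" for K'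
      using that z[OF that(1)] interior_subset[of K'] edge_of_imp_subset[OF that(2)] convex_tri[OF that(1)]
      by (intro hull_minimal) auto
    moreover have "convex hull insert (z K) (closed_segment a b) = convex hull {z K, a, b}"
      unfolding segment_convex_hull by (simp add: hull_insert[of convex "z K" "{a, b}"])
    ultimately show ?thesis using y interior_Int_tri[OF K] K e unfolding control_volume_def by blast
  qed
  then have "?S \<inter> ball ?x (min r r') = {y \<in> ball ?x (min r r'). (y - ?x) \<bullet> ?n \<le> 0}"
    using r r' by (auto simp: subset_iff)
  moreover have "norm ?n = 1" using az D by (simp add: sgn_real_def)
  ultimately show ?thesis using r(1) r'(1) by (intro outward_normal_eqI[of _ "min r r'"]) auto
qed

end

section \<open>Both forms triangle by triangle\<close>

text \<open>The share of one triangle in the finite volume form once the sum over edges is regrouped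
  by triangles. Boundary edges may be included because test functions vanish at their
  midpoints.\<close>

definition tri_flux :: "(point \<Rightarrow> real) \<Rightarrow> point set set \<Rightarrow> (point set \<Rightarrow> point) \<Rightarrow>
    (point \<Rightarrow> real) \<Rightarrow> (point \<Rightarrow> real) \<Rightarrow> point set \<Rightarrow> real" where
  "tri_flux \<alpha> \<T> z u v K = - (\<Sum>e\<in>{e\<in>edges \<T>. e edge_of K}. v (edge_mid e) *
     (\<Sum>a\<in>{a. a extreme_point_of e}.
        segment_flux (\<lambda>x. \<alpha> x *\<^sub>R grad u x) (control_volume \<T> z e) (z K) a))"

text \<open>All that the finite element form sees of \<alpha> on a triangle, gradients being
  constant there.\<close>

definition coef_mass :: "(point \<Rightarrow> real) \<Rightarrow> point set \<Rightarrow> real" where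
  "coef_mass \<alpha> K = (LINT x:K|lebesgue. \<alpha> x)"

context triangle_mesh
begin

lemma a_FE_eq:
  assumes uv: "u \<in> CR \<Omega> \<T>" "v \<in> CR \<Omega> \<T>"
    and lip: "\<And>K. K \<in> \<T> \<Longrightarrow> \<Lambda>-lipschitz_on (interior K) \<alpha>"
  shows "a_FE \<alpha> \<T> u v = (\<Sum>K\<in>\<T>. coef_mass \<alpha> K * (cr_grad u K \<bullet> cr_grad v K))"
  unfolding a_FE_def
proof (rule sum.cong[OF refl])
  fix K assume K: "K \<in> \<T>"
  \<comment> \<open>As \<alpha> may jump across the sides, it is replaced by the continuous
    extension of its values from the inside.\<close>
  obtain \<beta> where \<beta>: "\<Lambda>-lipschitz_on K \<beta>" "\<And>x. x \<in> interior K \<Longrightarrow> \<beta> x = \<alpha> x"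
    using lipschitz_extend_closure[OF lip[OF K]] closure_interior_tri[OF K] by auto
  have c: "continuous_on K \<beta>" using \<beta>(1) by (rule lipschitz_on_continuous_on)
  let ?s = "cr_grad u K \<bullet> cr_grad v K"
  have "(LINT x:K|lebesgue. \<alpha> x * (grad u x \<bullet> grad v x)) = (LINT x:K|lebesgue. \<beta> x * ?s)"
    by (rule set_integral_interior_cong[OF compact_tri[OF K] convex_tri[OF K]])
      (use c \<beta>(2) grad_eq_cr_grad[OF uv(1) K] grad_eq_cr_grad[OF uv(2) K] in \<open>auto intro!: continuous_intros\<close>)
  also have "\<dots> = (LINT x:K|lebesgue. \<beta> x) * ?s"
    by (simp add: set_lebesgue_integral_def flip: mult.assoc)
  also have "(LINT x:K|lebesgue. \<beta> x) = coef_mass \<alpha> K"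
    unfolding coef_mass_def
    by (rule set_integral_interior_cong[OF compact_tri[OF K] convex_tri[OF K] c, symmetric]) (simp add: \<beta>(2))
  finally show "(LINT x:K|lebesgue. \<alpha> x * (grad u x \<bullet> grad v x)) = coef_mass \<alpha> K * ?s" .
qed

lemma coef_mass_bounds:
  assumes K: "K \<in> \<T>" and lip: "\<Lambda>-lipschitz_on (interior K) \<alpha>"
    and b: "\<And>x. x \<in> interior K \<Longrightarrow> l \<le> \<alpha> x \<and> \<alpha> x \<le> r"
  shows "l * measure lebesgue K \<le> coef_mass \<alpha> K \<and> coef_mass \<alpha> K \<le> r * measure lebesgue K"
proof -
  obtain \<beta> where \<beta>: "\<Lambda>-lipschitz_on K \<beta>" "\<And>x. x \<in> interior K \<Longrightarrow> \<beta> x = \<alpha> x"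
    using lipschitz_extend_closure[OF lip] closure_interior_tri[OF K] by auto
  have c: "continuous_on K \<beta>" using \<beta>(1) by (rule lipschitz_on_continuous_on)
  have "coef_mass \<alpha> K = (LINT x:K|lebesgue. \<beta> x)"
    unfolding coef_mass_def
    by (rule set_integral_interior_cong[OF compact_tri[OF K] convex_tri[OF K] c]) (simp add: \<beta>(2))
  moreover have "l \<le> \<beta> x" "\<beta> x \<le> r" if "x \<in> K" for x
    using continuous_ge_on_closure[of "interior K" \<beta> x l] continuous_le_on_closure[of "interior K" \<beta> x r]
      c \<beta>(2) b that closure_interior_tri[OF K] by auto
  ultimately show ?thesis using set_integral_bounds[OF compact_tri[OF K] c, of l r] by simp
qed

lemma segment_flux_eq:
  assumes K: "K \<in> \<T>" and e: "closed_segment a b edge_of K" and z: "\<And>K. K \<in> \<T> \<Longrightarrow> z K \<in> interior K"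
    and D: "cross2 (a - z K) (b - z K) \<noteq> 0" and u: "u \<in> CR \<Omega> \<T>"
    and \<beta>: "\<And>x. x \<in> interior K \<Longrightarrow> \<beta> x = \<alpha> x"
  shows "segment_flux (\<lambda>x. \<alpha> x *\<^sub>R grad u x) (control_volume \<T> z (closed_segment a b)) (z K) a
    = - sgn (cross2 (a - z K) (b - z K)) * (cr_grad u K \<bullet> rot (a - z K)) * integral {0..1} (\<lambda>t. \<beta> (linepath (z K) a t))"
proof -
  let ?S = "control_volume \<T> z (closed_segment a b)"
  let ?s = "sgn (cross2 (a - z K) (b - z K))"
  let ?n = "- (?s / norm (a - z K)) *\<^sub>R rot (a - z K)"
  have az: "norm (a - z K) > 0" using D by (auto simp: cross2_def)
  have aK: "a \<in> K" using edge_of_imp_subset[OF e] by auto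
  have eq: "(\<alpha> x *\<^sub>R grad u x) \<bullet> outward_normal ?S x = \<beta> x * (cr_grad u K \<bullet> ?n)"
    if "x = linepath (z K) a t" "0 < t" "t < 1" for x t
  proof -
    have "x \<in> interior K" using linepath_interior_tri[OF K z[OF K] aK] that by blast
    then show ?thesis
      unfolding that(1) using outward_normal_control_volume[OF K e z D that(2,3)]
        grad_eq_cr_grad[OF u K] \<beta> that by simp
  qed
  \<comment> \<open>The parameters 0 and 1 are corners, where no normal is available; two parameters
    do not affect the integral.\<close>
  have "integral {0..1} (\<lambda>t. (\<alpha> (linepath (z K) a t) *\<^sub>R grad u (linepath (z K) a t)) \<bullet> outward_normal ?S (linepath (z K) a t))
      = integral {0..1} (\<lambda>t. \<beta> (linepath (z K) a t) * (cr_grad u K \<bullet> ?n))"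
    by (rule integral_spike[of "{0, 1}"]) (use eq in \<open>auto simp: less_le\<close>)
  also have "\<dots> = integral {0..1} (\<lambda>t. \<beta> (linepath (z K) a t)) * (cr_grad u K \<bullet> ?n)"
    by (rule integral_mult_left)
  finally show ?thesis using az
    by (simp add: segment_flux_def dist_norm norm_minus_commute)
qed

text \<open>A point of the hull of \<open>z K'\<close> and an edge \<open>e'\<close> is interior to
  K' or lies on \<open>e'\<close>. A midpoint is never interior to a triangle, so it belongs to the
  control volume of its own edge alone.\<close>

lemma Ih_star_edge_mid:
  assumes z: "\<And>K. K \<in> \<T> \<Longrightarrow> z K \<in> interior K" and e: "e \<in> interior_edges \<Omega> \<T>"
  shows "Ih_star \<Omega> \<T> z v (edge_mid e) = v (edge_mid e)"
proof -
  have E: "e \<in> edges \<T>" using e by (simp add: interior_edges_def)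
  obtain K where K: "K \<in> \<T>" "e edge_of K" using E by (auto simp: edges_def)
  have in_own: "edge_mid e \<in> control_volume \<T> z e"
    unfolding control_volume_def using K edge_mid_in_edge[OF simplex2[OF K(1)] K(2)]
    by (auto intro!: bexI[of _ K] hull_inc)
  have other: "e' = e" if e': "e' \<in> interior_edges \<Omega> \<T>" "edge_mid e \<in> control_volume \<T> z e'" for e'
  proof -
    obtain K' where K': "K' \<in> \<T>" "e' edge_of K'" "edge_mid e \<in> convex hull (insert (z K') e')"
      using e'(2) by (auto simp: control_volume_def)
    have ne: "e' \<noteq> {}" using K'(2) by (auto simp: edge_of_def)
    have cv: "convex hull e' = e'" using K'(2) face_of_imp_convex unfolding edge_of_def convex_hull_eq by blast
    obtain t y where y: "0 \<le> t" "t \<le> 1" "y \<in> e'" "edge_mid e = (1 - t) *\<^sub>R z K' + t *\<^sub>R y"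
      using K'(3) ne cv unfolding convex_hull_insert[OF ne]
      by clarsimp
    have "edge_mid e \<notin> interior K'" using mids_not_interior[OF _ K'(1)] E by (auto simp: mids_def)
    moreover have "edge_mid e \<in> interior K'" if "t < 1"
    proof -
      have "y \<in> K'" using y(3) edge_of_imp_subset[OF K'(2)] by blast
      have "edge_mid e = y - (1 - t) *\<^sub>R (y - z K')" using y(4) by (simp add: algebra_simps)
      then show ?thesis
        using mem_interior_convex_shrink[OF convex_tri[OF K'(1)] z[OF K'(1)] \<open>y \<in> K'\<close>, of "1 - t"] y that by simp
    qed
    ultimately have "t = 1" using y by linarith
    then have "edge_mid e \<in> e'" using y by simp
    then show "e' = e" using edge_unique[OF E] e'(1) by (auto simp: interior_edges_def)
  qed
  have fin: "finite (interior_edges \<Omega> \<T>)" using finite_edges by (simp add: interior_edges_def)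
  have "Ih_star \<Omega> \<T> z v (edge_mid e) = (\<Sum>e'\<in>interior_edges \<Omega> \<T>. if e' = e then v (edge_mid e) else 0)"
    unfolding Ih_star_def by (rule sum.cong) (use in_own other in \<open>auto simp: indicator_def\<close>)
  then show ?thesis using e fin by simp
qed

lemma a_FV_eq:
  assumes v: "v \<in> CR \<Omega> \<T>" and z: "\<And>K. K \<in> \<T> \<Longrightarrow> z K \<in> interior K"
  shows "a_FV \<alpha> \<Omega> \<T> z u (Ih_star \<Omega> \<T> z v) = (\<Sum>K\<in>\<T>. tri_flux \<alpha> \<T> z u v K)"
proof -
  define f where "f e K = v (edge_mid e) * (\<Sum>a\<in>{a. a extreme_point_of e}.
      segment_flux (\<lambda>x. \<alpha> x *\<^sub>R grad u x) (control_volume \<T> z e) (z K) a)" for e K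
  have sub: "interior_edges \<Omega> \<T> \<subseteq> edges \<T>" by (auto simp: interior_edges_def)
  have "a_FV \<alpha> \<Omega> \<T> z u (Ih_star \<Omega> \<T> z v) = - (\<Sum>e\<in>interior_edges \<Omega> \<T>. \<Sum>K\<in>{K\<in>\<T>. e edge_of K}. f e K)"
    unfolding a_FV_def boundary_flux_def f_def using Ih_star_edge_mid[OF z]
    by (simp add: sum_distrib_left)
  also have "(\<Sum>e\<in>interior_edges \<Omega> \<T>. \<Sum>K\<in>{K\<in>\<T>. e edge_of K}. f e K) = (\<Sum>e\<in>edges \<T>. \<Sum>K\<in>{K\<in>\<T>. e edge_of K}. f e K)"
    by (rule sum.mono_neutral_left[OF finite_edges sub]) (use v in \<open>auto simp: CR_def f_def\<close>)
  also have "\<dots> = (\<Sum>K\<in>\<T>. \<Sum>e\<in>{e\<in>edges \<T>. e edge_of K}. f e K)"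
    by (rule sum.swap_restrict[OF finite_edges finite_mesh])
  finally show ?thesis by (simp add: tri_flux_def f_def sum_negf)
qed

text \<open>With the coefficient frozen at \<open>z K\<close> the two local forms agree exactly, and
  freezing costs at most \<Lambda> diam(K). The area in the bracket is the error of the volume
  integral; the 3/2 comes from three segments, each with the factor 1/2.\<close>

lemma tri_flux_estimate:
  assumes K: "K \<in> \<T>" and z: "\<And>K. K \<in> \<T> \<Longrightarrow> z K \<in> interior K"
    and uv: "u \<in> CR \<Omega> \<T>" "v \<in> CR \<Omega> \<T>" and lip: "\<Lambda>-lipschitz_on (interior K) \<alpha>"
  shows "\<bar>tri_flux \<alpha> \<T> z u v K - coef_mass \<alpha> K * (cr_grad u K \<bullet> cr_grad v K)\<bar>
    \<le> \<Lambda> * diameter K * (measure lebesgue K + 3/2 * (diameter K)\<^sup>2) * norm (cr_grad u K) * norm (cr_grad v K)"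
proof -
  obtain a b c where abc: "K = convex hull {a, b, c}" "triangle a b c" "mids {K} = {midpoint a b, midpoint b c, midpoint c a}"
    "a \<noteq> b" "b \<noteq> c" "a \<noteq> c" "\<not> affine_dependent {a, b, c}"
    using tri_obtain[OF K] .
  define D where "D = cross2 (b - a) (c - a)"
  define s where "s = sgn D"
  have D: "D \<noteq> 0" using abc(2) by (simp add: D_def triangle_def)
  then have s: "\<bar>s\<bar> = 1" "s * D = \<bar>D\<bar>" by (auto simp: s_def sgn_real_def)
  define y where "y = z K"
  have y: "y \<in> interior K" using z K by (simp add: y_def)
  obtain w1 w2 w3 where w: "w1 > 0" "w2 > 0" "w3 > 0" "cross2 (a - y) (b - y) = w3 * D"
      "cross2 (b - y) (c - y) = w1 * D" "cross2 (c - y) (a - y) = w2 * D"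
    using interior_tri_obtain[OF K abc(1,7,4,5,6) y] unfolding D_def .
  have anti: "cross2 x x' = - cross2 x' x" for x x' by (simp add: cross2_def)
  have sg: "sgn (cross2 (a - y) (b - y)) = s" "sgn (cross2 (b - y) (c - y)) = s" "sgn (cross2 (c - y) (a - y)) = s"
    "sgn (cross2 (b - y) (a - y)) = - s" "sgn (cross2 (c - y) (b - y)) = - s" "sgn (cross2 (a - y) (c - y)) = - s"
    unfolding anti[of "b - y" "a - y"] anti[of "c - y" "b - y"] anti[of "a - y" "c - y"] w s_def
    using w(1-3) by (simp_all add: sgn_mult sgn_minus)
  have nz: "cross2 (a - y) (b - y) \<noteq> 0" "cross2 (b - y) (c - y) \<noteq> 0" "cross2 (c - y) (a - y) \<noteq> 0"
    "cross2 (b - y) (a - y) \<noteq> 0" "cross2 (c - y) (b - y) \<noteq> 0" "cross2 (a - y) (c - y) \<noteq> 0"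
    using sg s(1) by force+
  obtain \<beta> where \<beta>: "\<Lambda>-lipschitz_on K \<beta>" "\<And>x. x \<in> interior K \<Longrightarrow> \<beta> x = \<alpha> x"
    using lipschitz_extend_closure[OF lip] closure_interior_tri[OF K] by auto
  define p q where "p = cr_grad u K" and "q = cr_grad v K"
  define B where "B x = integral {0..1} (\<lambda>t. \<beta> (linepath y x t))" for x
  define R where "R x = p \<bullet> rot (x - y)" for x
  have edges: "closed_segment a b edge_of K" "closed_segment b c edge_of K" "closed_segment c a edge_of K"
    "closed_segment b a edge_of K" "closed_segment c b edge_of K" "closed_segment a c edge_of K"
    using edge_of_triangle[OF abc(7,4,5,6)] abc(1) by (auto simp: closed_segment_commute)
  let ?F = "\<lambda>e x. segment_flux (\<lambda>x. \<alpha> x *\<^sub>R grad u x) (control_volume \<T> z e) (z K) x"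
  have fl: "?F (closed_segment x x') x = - sgn (cross2 (x - y) (x' - y)) * R x * B x"
    if "closed_segment x x' edge_of K" "cross2 (x - y) (x' - y) \<noteq> 0" for x x'
    using segment_flux_eq[OF K that(1) z _ uv(1), where \<beta> = \<beta>] that(2) \<beta>(2)
    by (simp add: R_def p_def B_def y_def)
  have fl': "?F (closed_segment x x') x' = - sgn (cross2 (x' - y) (x - y)) * R x' * B x'"
    if "closed_segment x' x edge_of K" "cross2 (x' - y) (x - y) \<noteq> 0" for x x'
    using fl[OF that] by (simp add: closed_segment_commute)
  have seg: "(\<Sum>w\<in>{w. w extreme_point_of (closed_segment x x')}. ?F (closed_segment x x') w)
      = ?F (closed_segment x x') x + ?F (closed_segment x x') x'" if "x \<noteq> x'" for x x'
  proof -
    have "{w. w extreme_point_of (closed_segment x x')} = {x, x'}"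
      by (auto simp: extreme_point_of_segment)
    then show ?thesis using that by simp
  qed
  have E: "{e \<in> edges \<T>. e edge_of K} = {closed_segment a b, closed_segment b c, closed_segment c a}"
    using edge_of_triangle[OF abc(7,4,5,6)] abc(1) K by (auto simp: edges_def)
  have dist3: "closed_segment a b \<noteq> closed_segment b c" "closed_segment b c \<noteq> closed_segment c a" "closed_segment a b \<noteq> closed_segment c a"
    using abc(4-6) by (auto simp: closed_segment_eq doubleton_eq_iff)
  \<comment> \<open>Each segment from \<open>y\<close> to a vertex serves two edges of
    \<open>K\<close> with opposite normals, so it collects a difference of midpoint values of
    \<open>v\<close>, that is, the derivative of \<open>v\<close> along half an edge.\<close>
  have "tri_flux \<alpha> \<T> z u v K = s * (R a * B a * (v (midpoint a b) - v (midpoint c a))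
      + R b * B b * (v (midpoint b c) - v (midpoint a b)) + R c * B c * (v (midpoint c a) - v (midpoint b c)))"
    unfolding tri_flux_def E using dist3 abc(4-6)
    by (simp add: seg fl[OF edges(1) nz(1)] fl[OF edges(2) nz(2)] fl[OF edges(3) nz(3)]
        fl'[OF edges(4) nz(4)] fl'[OF edges(5) nz(5)] fl'[OF edges(6) nz(6)] sg) (simp add: algebra_simps)
  also have "v (midpoint a b) - v (midpoint c a) = q \<bullet> (b - c) / 2"
    using cr_grad_diff[OF uv(2) K, of "midpoint a b" "midpoint c a"] unfolding abc(3) q_def
    by (simp add: midpoint_def inner_diff_right inner_add_right algebra_simps)
  also have "v (midpoint b c) - v (midpoint a b) = q \<bullet> (c - a) / 2"
    using cr_grad_diff[OF uv(2) K, of "midpoint b c" "midpoint a b"] unfolding abc(3) q_def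
    by (simp add: midpoint_def inner_diff_right inner_add_right algebra_simps)
  also have "v (midpoint c a) - v (midpoint b c) = q \<bullet> (a - b) / 2"
    using cr_grad_diff[OF uv(2) K, of "midpoint c a" "midpoint b c"] unfolding abc(3) q_def
    by (simp add: midpoint_def inner_diff_right inner_add_right algebra_simps)
  finally have flux: "tri_flux \<alpha> \<T> z u v K = s / 2 * (R a * B a * (q \<bullet> (b - c)) + R b * B b * (q \<bullet> (c - a)) + R c * B c * (q \<bullet> (a - b)))"
    by (simp add: algebra_simps add_divide_distrib diff_divide_distrib)
  define \<beta>0 where "\<beta>0 = \<beta> y"
  have meas: "measure lebesgue K = \<bar>D\<bar> / 2" unfolding abc(1) content_triangle_cross D_def ..
  have "s / 2 * (R a * \<beta>0 * (q \<bullet> (b - c)) + R b * \<beta>0 * (q \<bullet> (c - a)) + R c * \<beta>0 * (q \<bullet> (a - b)))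
     = s / 2 * \<beta>0 * (R a * (q \<bullet> (b - c)) + R b * (q \<bullet> (c - a)) + R c * (q \<bullet> (a - b)))"
    by (simp add: algebra_simps)
  also have "\<dots> = \<beta>0 * measure lebesgue K * (p \<bullet> q)"
    unfolding R_def triangle_flux_identity D_def[symmetric] meas using s(2) by (simp add: algebra_simps)
  finally have const: "\<beta>0 * measure lebesgue K * (p \<bullet> q) = s / 2 * (R a * \<beta>0 * (q \<bullet> (b - c)) + R b * \<beta>0 * (q \<bullet> (c - a)) + R c * \<beta>0 * (q \<bullet> (a - b)))" ..
  define d where "d = diameter K"
  have bK: "bounded K" using compact_tri[OF K] compact_imp_bounded by blast
  have yK: "y \<in> K" using y interior_subset by blast
  have vK: "a \<in> K" "b \<in> K" "c \<in> K" unfolding abc(1) by (auto intro: hull_inc)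
  have dd: "norm (x - x') \<le> d" if "x \<in> K" "x' \<in> K" for x x'
    using diameter_bounded_bound[OF bK that] by (simp add: d_def dist_norm)
  have d0: "d \<ge> 0" using dd[OF yK yK] by simp
  have \<Lambda>0: "\<Lambda> \<ge> 0" using \<beta>(1) lipschitz_on_nonneg by blast
  have osc: "\<bar>\<beta> x - \<beta>0\<bar> \<le> \<Lambda> * d" if "x \<in> K" for x
  proof -
    have "\<bar>\<beta> x - \<beta>0\<bar> \<le> \<Lambda> * dist x y"
      using lipschitz_onD[OF \<beta>(1) that yK] by (simp add: \<beta>0_def dist_real_def)
    also have "\<dots> \<le> \<Lambda> * d" using dd[OF that yK] \<Lambda>0 by (intro mult_left_mono) (simp_all add: dist_norm)
    finally show ?thesis .
  qed
  have Bosc: "\<bar>B x - \<beta>0\<bar> \<le> \<Lambda> * d" if x: "x \<in> K" for x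
  proof -
    have lK: "linepath y x t \<in> K" if "t \<in> {0..1}" for t
      using that linepath_in_path[of t y x] closed_segment_subset[OF yK x convex_tri[OF K]] by blast
    have c: "continuous_on {0..1} (\<lambda>t. \<beta> (linepath y x t))"
      using lK by (intro continuous_on_compose2[OF lipschitz_on_continuous_on[OF \<beta>(1)]] continuous_on_linepath) auto
    have "norm (integral {0..1} (\<lambda>t. \<beta> (linepath y x t) - \<beta>0)) \<le> \<Lambda> * d * (1 - 0)"
      by (rule integral_bound) (use c osc lK in \<open>auto intro!: continuous_intros\<close>)
    also have "integral {0..1} (\<lambda>t. \<beta> (linepath y x t) - \<beta>0) = B x - \<beta>0"
      using c by (subst Henstock_Kurzweil_Integration.integral_diff) (auto simp: B_def integrable_continuous_interval)
    finally show ?thesis by simp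
  qed
  have tm: "\<bar>R x * (B x - \<beta>0) * (q \<bullet> (x' - x''))\<bar> \<le> \<Lambda> * d ^ 3 * norm p * norm q"
    if "x \<in> K" "x' \<in> K" "x'' \<in> K" for x x' x''
  proof -
    have "\<bar>R x\<bar> \<le> norm p * d"
      using Cauchy_Schwarz_ineq2[of p "rot (x - y)"] dd[OF that(1) yK]
      unfolding R_def by (simp add: order_trans mult_left_mono)
    moreover have "\<bar>q \<bullet> (x' - x'')\<bar> \<le> norm q * d"
      using Cauchy_Schwarz_ineq2[of q "x' - x''"] dd[OF that(2,3)] by (meson mult_left_mono norm_ge_zero order_trans)
    ultimately have "\<bar>R x\<bar> * \<bar>B x - \<beta>0\<bar> * \<bar>q \<bullet> (x' - x'')\<bar> \<le> (norm p * d) * (\<Lambda> * d) * (norm q * d)"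
      using Bosc[OF that(1)] d0 \<Lambda>0 by (intro mult_mono) auto
    then show ?thesis by (simp add: abs_mult power3_eq_cube mult_ac)
  qed
  have "tri_flux \<alpha> \<T> z u v K - \<beta>0 * measure lebesgue K * (p \<bullet> q)
    = s / 2 * (R a * (B a - \<beta>0) * (q \<bullet> (b - c)) + R b * (B b - \<beta>0) * (q \<bullet> (c - a)) + R c * (B c - \<beta>0) * (q \<bullet> (a - b)))"
    unfolding flux const by (simp add: algebra_simps)
  then have "\<bar>tri_flux \<alpha> \<T> z u v K - \<beta>0 * measure lebesgue K * (p \<bullet> q)\<bar>
     = 1 / 2 * \<bar>R a * (B a - \<beta>0) * (q \<bullet> (b - c)) + R b * (B b - \<beta>0) * (q \<bullet> (c - a)) + R c * (B c - \<beta>0) * (q \<bullet> (a - b))\<bar>"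
    using s(1) by (simp only: abs_mult abs_divide)
  also have "\<dots> \<le> 1 / 2 * (3 * (\<Lambda> * d ^ 3 * norm p * norm q))"
  proof -
    have "\<bar>x1 + x2 + x3\<bar> \<le> 3 * m" if "\<bar>x1\<bar> \<le> m" "\<bar>x2\<bar> \<le> m" "\<bar>x3\<bar> \<le> m" for x1 x2 x3 m :: real
      using that by linarith
    from this[OF tm[OF vK(1,2,3)] tm[OF vK(2,3,1)] tm[OF vK(3,1,2)]] show ?thesis by simp
  qed
  finally have 1: "\<bar>tri_flux \<alpha> \<T> z u v K - \<beta>0 * measure lebesgue K * (p \<bullet> q)\<bar> \<le> 3 / 2 * \<Lambda> * d ^ 3 * norm p * norm q"
    by (simp add: algebra_simps)
  have cm: "(\<beta>0 - \<Lambda> * d) * measure lebesgue K \<le> coef_mass \<alpha> K \<and> coef_mass \<alpha> K \<le> (\<beta>0 + \<Lambda> * d) * measure lebesgue K"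
  proof (rule coef_mass_bounds[OF K lip])
    fix x assume x: "x \<in> interior K"
    then have "x \<in> K" using interior_subset by blast
    from osc[OF this] \<beta>(2)[OF x] show "\<beta>0 - \<Lambda> * d \<le> \<alpha> x \<and> \<alpha> x \<le> \<beta>0 + \<Lambda> * d" by linarith
  qed
  then have "\<bar>coef_mass \<alpha> K - \<beta>0 * measure lebesgue K\<bar> \<le> \<Lambda> * d * measure lebesgue K"
    by (simp add: algebra_simps abs_le_iff)
  then have "\<bar>coef_mass \<alpha> K - \<beta>0 * measure lebesgue K\<bar> * \<bar>p \<bullet> q\<bar> \<le> \<Lambda> * d * measure lebesgue K * (norm p * norm q)"
    using Cauchy_Schwarz_ineq2[of p q] d0 \<Lambda>0 by (intro mult_mono) auto
  then have 2: "\<bar>coef_mass \<alpha> K * (p \<bullet> q) - \<beta>0 * measure lebesgue K * (p \<bullet> q)\<bar> \<le> \<Lambda> * d * measure lebesgue K * (norm p * norm q)"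
    by (simp add: abs_mult flip: left_diff_distrib)
  have "\<bar>tri_flux \<alpha> \<T> z u v K - coef_mass \<alpha> K * (p \<bullet> q)\<bar> \<le> 3 / 2 * \<Lambda> * d ^ 3 * norm p * norm q + \<Lambda> * d * measure lebesgue K * (norm p * norm q)"
    using 1 2 by linarith
  also have "\<dots> = \<Lambda> * d * (measure lebesgue K + 3/2 * d\<^sup>2) * norm p * norm q"
    by (simp add: algebra_simps power2_eq_square power3_eq_cube)
  finally show ?thesis unfolding p_def q_def d_def .
qed

end


section \<open>Chains of triangles along curves\<close>

text \<open>Connectedness of the graph of shared midpoints, stated by cuts instead of paths: a cut
  of the family splits a connected set into two closed parts, which must meet.\<close>

definition mid_connected :: "point set set \<Rightarrow> bool" where
  "mid_connected F \<longleftrightarrow> (\<forall>A\<subseteq>F. A \<noteq> {} \<longrightarrow> A \<noteq> F \<longrightarrow>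
     (\<exists>K\<in>A. \<exists>K'\<in>F - A. mids {K} \<inter> mids {K'} \<noteq> {}))"

text \<open>A family of triangles is grown from \<open>K\<close> along links; each newcomer adds its
  own oscillation once. A maximal family with the bound is everything, so no path has to be
  constructed.\<close>

lemma mid_connected_oscillation:
  fixes v :: "point \<Rightarrow> real"
  assumes F: "finite F" "mid_connected F"
    and w: "\<And>K m m'. K \<in> F \<Longrightarrow> m \<in> mids {K} \<Longrightarrow> m' \<in> mids {K} \<Longrightarrow> \<bar>v m - v m'\<bar> \<le> w K"
    and K: "K \<in> F" "m \<in> mids {K}" and K': "K' \<in> F" "m' \<in> mids {K'}"
  shows "\<bar>v m - v m'\<bar> \<le> sum w F"
proof -
  define good where "good A \<longleftrightarrow> A \<subseteq> F \<and> K \<in> A \<and> (\<forall>L\<in>A. \<forall>l\<in>mids {L}. \<bar>v m - v l\<bar> \<le> sum w A)" for A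
  have "good {K}" using K w by (auto simp: good_def)
  moreover have "finite {A. good A}" using F(1) by (rule rev_finite_subset[OF finite_Pow_iff[THEN iffD2]]) (auto simp: good_def)
  ultimately obtain A where A: "good A" "\<And>B. good B \<Longrightarrow> A \<subseteq> B \<Longrightarrow> B = A"
    using finite_has_maximal[of "{A. good A}"] by (metis empty_iff mem_Collect_eq)
  have "A = F"
  proof (rule ccontr)
    assume "A \<noteq> F"
    then obtain L L' k where L: "L \<in> A" "L' \<in> F - A" "k \<in> mids {L}" "k \<in> mids {L'}"
      using A(1) F(2) unfolding mid_connected_def good_def by (metis IntE all_not_in_conv)
    have fA: "finite A" using A(1) F(1) finite_subset by (auto simp: good_def)
    have s: "sum w (insert L' A) = w L' + sum w A" using fA L(2) by simp
    have w0: "w L' \<ge> 0" using w[of L' k k] L by auto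
    have "\<bar>v m - v l\<bar> \<le> w L' + sum w A" if "l \<in> mids {L'}" for l
    proof -
      have "\<bar>v m - v k\<bar> \<le> sum w A" using A(1) L by (auto simp: good_def)
      moreover have "\<bar>v k - v l\<bar> \<le> w L'" using w[of L' k l] L that by auto
      ultimately show ?thesis by linarith
    qed
    moreover have "\<bar>v m - v l\<bar> \<le> w L' + sum w A" if "M \<in> A" "l \<in> mids {M}" for M l
      using A(1) that w0 by (fastforce simp: good_def)
    ultimately have "good (insert L' A)"
      using A(1) L(2) unfolding good_def s by auto
    then show False using A(2)[of "insert L' A"] L(2) by blast
  qed
  then show ?thesis using A(1) K' by (auto simp: good_def)
qed

section \<open>Local connectedness of subdomains\<close>

text \<open>Rules out that parts of \<open>S\<close> touch only at \<open>p\<close>: the triangles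
  around a vertex are then linked through edges, along which Crouzeix-Raviart functions do
  communicate, and not merely through the vertex.\<close>

definition punctured_connected :: "point set \<Rightarrow> bool" where
  "punctured_connected S \<longleftrightarrow> (\<forall>p\<in>closure S. \<forall>r>0. \<exists>C. connected C \<and> C \<subseteq> S \<inter> ball p r - {p} \<and>
     (\<exists>\<rho>>0. S \<inter> ball p \<rho> - {p} \<subseteq> C))"

lemma punctured_connected_interior_point:
  fixes p :: point
  assumes "open S" "p \<in> S" "r > 0"
  shows "\<exists>C. connected C \<and> C \<subseteq> S \<inter> ball p r - {p} \<and> (\<exists>\<rho>>0. S \<inter> ball p \<rho> - {p} \<subseteq> C)"
proof -
  obtain e where e: "e > 0" "ball p e \<subseteq> S" using assms open_contains_ball by blast
  have "connected (ball p (min e r) - {p})" by (rule connected_punctured_ball) simp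
  then show ?thesis using e assms(3)
    by (intro exI[of _ "ball p (min e r) - {p}"] conjI exI[of _ "min e r"]) auto
qed

lemma punctured_connected_convex:
  assumes "open S" "convex S" shows "punctured_connected S"
  unfolding punctured_connected_def
proof (intro ballI allI impI)
  fix p and r :: real assume p: "p \<in> closure S" and r: "r > 0"
  show "\<exists>C. connected C \<and> C \<subseteq> S \<inter> ball p r - {p} \<and> (\<exists>\<rho>>0. S \<inter> ball p \<rho> - {p} \<subseteq> C)"
  proof (cases "p \<in> S")
    case True
    then show ?thesis using punctured_connected_interior_point assms r by blast
  next
    case False
    have "connected (S \<inter> ball p r)" using assms by (intro convex_connected convex_Int) auto
    then show ?thesis using False r by (intro exI[of _ "S \<inter> ball p r"]) blast
  qed
qed

lemma orthonormal_decomposition: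
  fixes t n y :: point
  assumes "norm t = 1" "norm n = 1" "t \<bullet> n = 0"
  shows "y = (y \<bullet> t) *\<^sub>R t + (y \<bullet> n) *\<^sub>R n"
proof -
  define d where "d = y - ((y \<bullet> t) *\<^sub>R t + (y \<bullet> n) *\<^sub>R n)"
  have tt: "t \<bullet> t = 1" "n \<bullet> n = 1" using assms by (simp_all add: dot_square_norm)
  have "d \<bullet> t = 0" "d \<bullet> n = 0"
    using assms tt by (simp_all add: d_def inner_diff_left inner_add_left inner_diff_right inner_add_right inner_commute)
  moreover have "cross2 t n \<noteq> 0"
  proof -
    have "(cross2 t n)\<^sup>2 = (t \<bullet> t) * (n \<bullet> n) - (t \<bullet> n)\<^sup>2"
      by (simp add: cross2_def inner_2 power2_eq_square algebra_simps)
    then show ?thesis using tt assms by auto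
  qed
  ultimately have "d = 0" using eq_0_if_inner_0 by blast
  then show ?thesis by (simp add: d_def)
qed

text \<open>Beyond the half-plane description this places \<open>p\<close> on the graph: points of
  \<open>U\<close> strictly above it have a neighbourhood free of \<open>S\<close>, and
  \<open>p\<close> itself is not in the open set \<open>S\<close>.\<close>

lemma polytope_frontier_graph:
  assumes S: "lipschitz_polytope S" and p: "p \<in> frontier S"
  obtains U t n g L where "open U" "p \<in> U" "norm t = 1" "norm n = 1" "t \<bullet> n = 0"
    "L-lipschitz_on (UNIV :: real set) g" "S \<inter> U = {y\<in>U. y \<bullet> n < g (y \<bullet> t)}" "p \<bullet> n = g (p \<bullet> t)"
proof -
  obtain U t n g L where U: "open U" "p \<in> U" "norm t = 1" "norm n = 1" "t \<bullet> n = 0"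
    "L-lipschitz_on (UNIV :: real set) g" "S \<inter> U = {y\<in>U. y \<bullet> n < g (y \<bullet> t)}"
    using S p unfolding lipschitz_polytope_def by blast
  have "p \<notin> S" using S p by (auto simp: lipschitz_polytope_def frontier_def interior_open)
  then have ge: "g (p \<bullet> t) \<le> p \<bullet> n" using U by force
  have below: "y \<bullet> n < g (y \<bullet> t)" if "y \<in> S" "y \<in> U" for y using that U(7) by blast
  have cg: "continuous_on UNIV g" using U(6) lipschitz_on_continuous_on by blast
  have c: "continuous_on UNIV (\<lambda>y. y \<bullet> n - g (y \<bullet> t))"
    by (intro continuous_intros continuous_on_compose2[OF cg]) auto
  define W where "W = U \<inter> {y. 0 < y \<bullet> n - g (y \<bullet> t)}"
  have W: "open W" unfolding W_def using U(1) open_Collect_less[OF continuous_on_const c] by (rule open_Int)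
  have "S \<inter> W = {}" using below by (fastforce simp: W_def)
  then have "p \<notin> W" using p W by (auto simp: frontier_def closure_iff_nhds_not_empty)
  then have "p \<bullet> n = g (p \<bullet> t)" using ge U(2) by (simp add: W_def)
  then show ?thesis by (rule that[OF U])
qed

text \<open>There are no slits: arbitrarily close to a boundary point there are points above the
  graph, outside the closure.\<close>

lemma polytope_interior_closure:
  assumes S: "lipschitz_polytope S" shows "interior (closure S) = S"
proof
  have o: "open S" using S by (simp add: lipschitz_polytope_def)
  then show "S \<subseteq> interior (closure S)" by (simp add: closure_subset interior_maximal)
  show "interior (closure S) \<subseteq> S"
  proof
    fix p assume pi: "p \<in> interior (closure S)"
    show "p \<in> S"
    proof (rule ccontr)
      assume "p \<notin> S"
      then have "p \<in> frontier S" using pi interior_subset o by (auto simp: frontier_def interior_open)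
      then obtain U t n g L where U: "open U" "p \<in> U" "norm t = 1" "norm n = 1" "t \<bullet> n = 0"
        "L-lipschitz_on (UNIV :: real set) g" "S \<inter> U = {y\<in>U. y \<bullet> n < g (y \<bullet> t)}" "p \<bullet> n = g (p \<bullet> t)"
        by (rule polytope_frontier_graph[OF S])
      have cg: "continuous_on UNIV g" using U(6) lipschitz_on_continuous_on by blast
      have below: "y \<bullet> n < g (y \<bullet> t)" if "y \<in> S" "y \<in> U" for y using that U(7) by blast
      define W where "W = U \<inter> {y. 0 < y \<bullet> n - g (y \<bullet> t)}"
      have c: "continuous_on UNIV (\<lambda>y. y \<bullet> n - g (y \<bullet> t))"
        by (intro continuous_intros continuous_on_compose2[OF cg]) auto
      have W: "open W" unfolding W_def using U(1) open_Collect_less[OF continuous_on_const c] by (rule open_Int)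
      have "open (U \<inter> interior (closure S))" using U(1) by auto
      then obtain e where e: "e > 0" "ball p e \<subseteq> U \<inter> interior (closure S)"
        using U(2) pi open_contains_ball by (metis IntI)
      define q where "q = p + (e/2) *\<^sub>R n"
      have q: "q \<in> ball p e" using e(1) U(4) by (simp add: q_def dist_norm)
      have "n \<bullet> n = 1" "n \<bullet> t = 0" using U(4,5) by (simp_all add: dot_square_norm inner_commute)
      then have "q \<in> W" using q e U(8) by (auto simp: W_def q_def inner_add_left)
      moreover have "S \<inter> W = {}" using below by (fastforce simp: W_def)
      ultimately have "q \<notin> closure S" using W by (auto simp: closure_iff_nhds_not_empty)
      then show False using q e(2) interior_subset by blast
    qed
  qed
qed

text \<open>Near a boundary point, the set is the region below a Lipschitz graph; the box used here is
  deep enough for the graph to stay above its bottom, so that vertical segments fill it.\<close>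

lemma punctured_connected_polytope:
  assumes S: "lipschitz_polytope S" shows "punctured_connected S"
  unfolding punctured_connected_def
proof (intro ballI allI impI)
  fix p and r :: real assume pc: "p \<in> closure S" and r: "r > 0"
  have o: "open S" using S by (simp add: lipschitz_polytope_def)
  show "\<exists>C. connected C \<and> C \<subseteq> S \<inter> ball p r - {p} \<and> (\<exists>\<rho>>0. S \<inter> ball p \<rho> - {p} \<subseteq> C)"
  proof (cases "p \<in> S")
    case True
    then show ?thesis using punctured_connected_interior_point o r by blast
  next
    case False
    then have "p \<in> frontier S" using pc o by (simp add: frontier_def interior_open)
    then obtain U t n g L where U: "open U" "p \<in> U" "norm t = 1" "norm n = 1" "t \<bullet> n = 0"
      "L-lipschitz_on (UNIV :: real set) g" "S \<inter> U = {y\<in>U. y \<bullet> n < g (y \<bullet> t)}" "p \<bullet> n = g (p \<bullet> t)"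
      by (rule polytope_frontier_graph[OF S])
    have L: "L \<ge> 0" using U(6) lipschitz_on_nonneg by blast
    have cg: "continuous_on A g" for A using U(6) lipschitz_on_continuous_on continuous_on_subset by blast
    obtain e where e: "e > 0" "ball p e \<subseteq> U" using U(1,2) open_contains_ball by blast
    \<comment> \<open>Half the width of the box; its depth is \<open>(L + 1) * \<rho>\<close>, and
      the two together stay below the radius \<open>min e r\<close>.\<close>
    define \<rho> where "\<rho> = min e r / (2 * (L + 2))"
    have \<rho>: "\<rho> > 0" "\<rho> + (L + 1) * \<rho> < min e r"
    proof -
      show "\<rho> > 0" using e r L by (simp add: \<rho>_def)
      have "(L + 2) * \<rho> = min e r / 2" using L by (simp add: \<rho>_def field_simps)
      moreover have "min e r > 0" using e r by simp
      moreover have "\<rho> + (L + 1) * \<rho> = (L + 2) * \<rho>" by (simp add: algebra_simps)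
      ultimately show "\<rho> + (L + 1) * \<rho> < min e r" by linarith
    qed
    define G where "G s = g (p \<bullet> t + s) - g (p \<bullet> t)" for s
    have G: "\<bar>G s\<bar> \<le> L * \<bar>s\<bar>" for s
      using lipschitz_onD[OF U(6), of "p \<bullet> t + s" "p \<bullet> t"] by (simp add: G_def dist_real_def)
    \<comment> \<open>The parameter \<open>\<theta>\<close> runs from the bottom of the box at 0 to
      the graph at 1. Since |G s| is at most \<open>L * \<rho>\<close>, each vertical segment is
      nondegenerate.\<close>
    define f where "f = (\<lambda>(s, \<theta>). p + s *\<^sub>R t + (\<theta> * (G s + (L + 1) * \<rho>) - (L + 1) * \<rho>) *\<^sub>R n)"
    define Q where "Q = {-\<rho><..<\<rho>} \<times> {0<..<1::real}"
    define C where "C = f ` Q"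
    have tt: "t \<bullet> t = 1" "n \<bullet> n = 1" "n \<bullet> t = 0" using U(3-5) by (simp_all add: dot_square_norm inner_commute)
    have "connected C"
    proof -
      have "connected Q" unfolding Q_def by (intro convex_connected convex_Times) auto
      moreover have "continuous_on Q f"
        unfolding f_def G_def case_prod_beta by (intro continuous_intros continuous_on_compose2[OF cg[of UNIV]]) auto
      ultimately show ?thesis unfolding C_def by (rule connected_continuous_image[rotated])
    qed
    moreover have "C \<subseteq> S \<inter> ball p r - {p}"
    proof
      fix y assume "y \<in> C"
      then obtain s \<theta> where "(s, \<theta>) \<in> Q" "y = f (s, \<theta>)" by (auto simp: C_def)
      then have s: "\<bar>s\<bar> < \<rho>" "0 < \<theta>" "\<theta> < 1" "y = f (s, \<theta>)"
        by (auto simp: Q_def abs_less_iff)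
      define \<tau> where "\<tau> = \<theta> * (G s + (L + 1) * \<rho>) - (L + 1) * \<rho>"
      have y: "y = p + s *\<^sub>R t + \<tau> *\<^sub>R n" by (simp add: s(4) f_def \<tau>_def)
      have Gs: "\<bar>G s\<bar> \<le> L * \<rho>" using G[of s] s(1) L by (meson mult_left_mono less_imp_le order_trans)
      have pos: "G s + (L + 1) * \<rho> > 0" using Gs \<rho>(1) by (simp add: algebra_simps abs_le_iff)
      have up: "\<tau> < G s" using mult_strict_right_mono[OF s(3) pos] by (simp add: \<tau>_def)
      have lo: "\<tau> > - ((L + 1) * \<rho>)" using mult_pos_pos[OF s(2) pos] by (simp add: \<tau>_def)
      have "L * \<rho> \<le> (L + 1) * \<rho>" using \<rho>(1) by (simp add: algebra_simps)
      then have \<tau>b: "\<bar>\<tau>\<bar> \<le> (L + 1) * \<rho>" using up lo Gs by (simp add: abs_le_iff)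
      have "norm (s *\<^sub>R t + \<tau> *\<^sub>R n) \<le> \<bar>s\<bar> + \<bar>\<tau>\<bar>"
        using norm_triangle_ineq[of "s *\<^sub>R t" "\<tau> *\<^sub>R n"] U(3,4) by simp
      moreover have "y - p = s *\<^sub>R t + \<tau> *\<^sub>R n" by (simp add: y)
      then have "dist p y = norm (s *\<^sub>R t + \<tau> *\<^sub>R n)" by (metis dist_commute dist_norm)
      ultimately have d: "dist p y < min e r" using s(1) \<tau>b \<rho>(2) by linarith
      have yt: "y \<bullet> t = p \<bullet> t + s" "y \<bullet> n = p \<bullet> n + \<tau>"
        using tt U(5) by (simp_all add: y inner_add_left)
      have "y \<in> U" using d e(2) by auto
      moreover have "y \<bullet> n < g (y \<bullet> t)" using up U(8) by (simp add: yt G_def)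
      ultimately have "y \<in> S" using U(7) by blast
      then show "y \<in> S \<inter> ball p r - {p}" using d False by auto
    qed
    moreover have "S \<inter> ball p \<rho> - {p} \<subseteq> C"
    proof
      fix y assume y: "y \<in> S \<inter> ball p \<rho> - {p}"
      have "\<rho> < e" using \<rho> L by (smt (verit) mult_nonneg_nonneg)
      then have yU: "y \<in> U" using y e(2) by auto
      define s where "s = (y - p) \<bullet> t"
      define \<tau> where "\<tau> = (y - p) \<bullet> n"
      have "\<bar>s\<bar> \<le> norm (y - p)" "\<bar>\<tau>\<bar> \<le> norm (y - p)"
        using Cauchy_Schwarz_ineq2[of "y - p" t] Cauchy_Schwarz_ineq2[of "y - p" n] U(3,4) by (simp_all add: s_def \<tau>_def)
      then have b: "\<bar>s\<bar> < \<rho>" "\<bar>\<tau>\<bar> < \<rho>" using y by (simp_all add: dist_norm norm_minus_commute)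
      have "y \<bullet> n < g (y \<bullet> t)" using y yU U(7) by blast
      then have up: "\<tau> < G s" using U(8) by (simp add: \<tau>_def s_def G_def inner_diff_left)
      have Gs: "\<bar>G s\<bar> \<le> L * \<rho>" using G[of s] b(1) L by (meson mult_left_mono less_imp_le order_trans)
      have pos: "G s + (L + 1) * \<rho> > 0" using Gs \<rho>(1) by (simp add: algebra_simps abs_le_iff)
      define \<theta> where "\<theta> = (\<tau> + (L + 1) * \<rho>) / (G s + (L + 1) * \<rho>)"
      have "L * \<rho> \<ge> 0" using L \<rho>(1) by simp
      then have "\<tau> + (L + 1) * \<rho> > 0" using b(2) by (simp add: algebra_simps abs_less_iff)
      then have \<theta>: "0 < \<theta>" "\<theta> < 1" using pos up by (simp_all add: \<theta>_def)
      have "\<theta> * (G s + (L + 1) * \<rho>) - (L + 1) * \<rho> = \<tau>" using pos by (simp add: \<theta>_def)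
      moreover have "y = p + s *\<^sub>R t + \<tau> *\<^sub>R n"
        using orthonormal_decomposition[OF U(3-5), of "y - p"] by (simp add: s_def \<tau>_def algebra_simps)
      ultimately have "y = f (s, \<theta>)" by (simp add: f_def)
      moreover have "(s, \<theta>) \<in> Q" using b(1) \<theta> by (auto simp: Q_def abs_less_iff)
      ultimately show "y \<in> C" unfolding C_def by blast
    qed
    ultimately show ?thesis using \<rho>(1) by blast
  qed
qed

section \<open>Triangles met by a connected set, and their number\<close>

context triangle_mesh
begin

lemma mesh_on_subset: "mesh_on \<T> S \<subseteq> \<T>"
  by (auto simp: mesh_on_def)

lemma finite_mesh_on: "finite (mesh_on \<T> S)"
  using finite_mesh mesh_on_subset finite_subset by blast

lemma mesh_on_iff_interior:
  assumes S: "open S" "aligned \<T> S" and K: "K \<in> \<T>"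
  shows "K \<in> mesh_on \<T> S \<longleftrightarrow> interior K \<subseteq> S"
proof
  assume "K \<in> mesh_on \<T> S"
  then have "interior K \<subseteq> closure S" using interior_subset by (auto simp: mesh_on_def)
  then have "interior K \<inter> S \<noteq> {}"
    using interior_tri[OF K] open_Int_closure_eq_empty[OF open_interior, of K S] by blast
  then show "interior K \<subseteq> S" using interior_subset_or_disjoint[OF S K] by blast
next
  assume "interior K \<subseteq> S"
  then have "K \<subseteq> closure S" using closure_interior_tri[OF K] closure_mono by blast
  then show "K \<in> mesh_on \<T> S" using K by (simp add: mesh_on_def)
qed

lemma Union_mesh_on:
  assumes S: "open S" "aligned \<T> S" and cov: "S \<subseteq> \<Union>\<T>"
  shows "\<Union>(mesh_on \<T> S) = closure S"
proof
  show "\<Union>(mesh_on \<T> S) \<subseteq> closure S" by (auto simp: mesh_on_def)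
  have "S \<subseteq> \<Union>(mesh_on \<T> S)"
  proof
    fix x assume x: "x \<in> S"
    then obtain K where K: "K \<in> \<T>" "x \<in> K" using cov by blast
    then have "x \<in> closure (interior K)" using closure_interior_tri by blast
    then have "S \<inter> interior K \<noteq> {}" using x S(1) by (auto simp: closure_iff_nhds_not_empty)
    then have "interior K \<subseteq> S" using interior_subset_or_disjoint[OF S K(1)] by blast
    then show "x \<in> \<Union>(mesh_on \<T> S)" using mesh_on_iff_interior[OF S K(1)] K by blast
  qed
  moreover have "closed (\<Union>(mesh_on \<T> S))"
    using finite_mesh_on closed_tri mesh_on_subset by (intro closed_Union) auto
  ultimately show "closure S \<subseteq> \<Union>(mesh_on \<T> S)" by (rule closure_minimal)
qed

definition vertices :: "point set" where
  "vertices = (\<Union>K\<in>\<T>. {x. x extreme_point_of K})"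

lemma finite_vertices: "finite vertices"
  unfolding vertices_def
proof (rule finite_UN_I[OF finite_mesh])
  fix K assume "K \<in> \<T>"
  then obtain a b c where "K = convex hull {a, b, c}" using tri_obtain by metis
  then have "{x. x extreme_point_of K} \<subseteq> {a, b, c}" using extreme_point_of_convex_hull by blast
  then show "finite {x. x extreme_point_of K}" using finite_subset by blast
qed

text \<open>In a small punctured neighbourhood of \<open>p\<close> only the triangles of the star
  are present. Two complementary parts of the star cover it by closed sets that both meet it, so
  they share a point there, and this point is no vertex: the triangles share an edge.\<close>

lemma star_mid_connected:
  assumes S: "open S" "aligned \<T> S" and cov: "S \<subseteq> \<Union>\<T>" and pc: "punctured_connected S" and p: "p \<in> closure S"
  shows "mid_connected {K \<in> mesh_on \<T> S. p \<in> K}"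
  unfolding mid_connected_def
proof (intro allI impI)
  define F where "F = {K \<in> mesh_on \<T> S. p \<in> K}"
  fix A assume "A \<subseteq> {K \<in> mesh_on \<T> S. p \<in> K}" "A \<noteq> {}" "A \<noteq> {K \<in> mesh_on \<T> S. p \<in> K}"
  then have A: "A \<subseteq> F" "A \<noteq> {}" "A \<noteq> F" by (simp_all add: F_def)
  have FT: "F \<subseteq> \<T>" using mesh_on_subset by (auto simp: F_def)
  \<comment> \<open>Everything the neighbourhood has to avoid: triangles outside the star and
    vertices other than \<open>p\<close>.\<close>
  define Z where "Z = \<Union>{K \<in> mesh_on \<T> S. p \<notin> K} \<union> (vertices - {p})"
  have "closed (\<Union>{K \<in> mesh_on \<T> S. p \<notin> K})"
    using finite_mesh_on closed_tri mesh_on_subset by (intro closed_Union) auto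
  moreover have "closed (vertices - {p})" using finite_vertices by (intro finite_imp_closed) auto
  ultimately have "closed Z" unfolding Z_def by (rule closed_Un)
  moreover have "p \<notin> Z" by (auto simp: Z_def)
  ultimately obtain r where r: "r > 0" "ball p r \<inter> Z = {}"
    using open_contains_ball[of "- Z"] by (metis Compl_iff disjoint_eq_subset_Compl open_Compl)
  obtain C \<rho> where C: "connected C" "C \<subseteq> S \<inter> ball p r - {p}" "\<rho> > 0" "S \<inter> ball p \<rho> - {p} \<subseteq> C"
    using pc p r(1) unfolding punctured_connected_def by meson
  have cover: "C \<subseteq> \<Union>A \<union> \<Union>(F - A)"
  proof
    fix x assume x: "x \<in> C"
    then have "x \<in> \<Union>(mesh_on \<T> S)" using Union_mesh_on[OF S cov] C(2) closure_subset by blast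
    then obtain K where K: "K \<in> mesh_on \<T> S" "x \<in> K" by blast
    then have "p \<in> K" using x C(2) r(2) by (auto simp: Z_def)
    then show "x \<in> \<Union>A \<union> \<Union>(F - A)" using K by (auto simp: F_def)
  qed
  have meet: "C \<inter> K \<noteq> {}" if "K \<in> F" for K
  proof -
    have K: "K \<in> \<T>" "p \<in> K" "interior K \<subseteq> S"
      using that mesh_on_iff_interior[OF S] mesh_on_subset by (auto simp: F_def)
    have "p \<in> closure (interior K)" using closure_interior_tri K by blast
    then have "interior K \<inter> ball p \<rho> \<noteq> {}"
      using C(3) open_Int_closure_eq_empty[of "ball p \<rho>" "interior K"] centre_in_ball by blast
    moreover have "open (interior K \<inter> ball p \<rho>)" by blast
    ultimately have "interior K \<inter> ball p \<rho> \<noteq> {p}" "interior K \<inter> ball p \<rho> \<noteq> {}"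
      using not_open_singleton by metis+
    then obtain y where "y \<in> interior K" "y \<in> ball p \<rho>" "y \<noteq> p" by blast
    then show ?thesis using C(4) K(3) interior_subset by blast
  qed
  have closedU: "closed (\<Union>B)" if "B \<subseteq> F" for B
    using that FT finite_mesh closed_tri finite_subset by (intro closed_Union) (blast intro: finite_subset)+
  have "\<Union>A \<inter> C \<noteq> {}" using A meet by blast
  moreover have "\<Union>(F - A) \<inter> C \<noteq> {}" using A meet by blast
  ultimately have "\<Union>A \<inter> \<Union>(F - A) \<inter> C \<noteq> {}"
    using C(1) cover closedU[OF A(1)] closedU[of "F - A"] unfolding connected_closed by blast
  then obtain K K' q where K: "K \<in> A" "K' \<in> F - A" "q \<in> K" "q \<in> K'" "q \<in> C" by blast
  have "q \<noteq> p" "q \<in> ball p r" using K(5) C(2) by auto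
  then have "q \<notin> vertices" using r(2) by (auto simp: Z_def)
  then have "\<not> q extreme_point_of K" using K(1) A(1) FT by (auto simp: vertices_def)
  then have "mids {K} \<inter> mids {K'} \<noteq> {}" using common_mid[of K K' q] K A(1) FT by blast
  then show "\<exists>K\<in>A. \<exists>K'\<in>{K \<in> mesh_on \<T> S. p \<in> K} - A. mids {K} \<inter> mids {K'} \<noteq> {}"
    using K(1,2) unfolding F_def by blast
qed

text \<open>The same closed covering, now of \<open>\<gamma>\<close>, yields triangles on both sides
  of the cut with a common point \<open>p\<close> on \<open>\<gamma>\<close>. That point may be a
  vertex; then the link is found inside its star, which belongs to the family.\<close>

lemma connected_mid_connected:
  assumes S: "open S" "aligned \<T> S" and cov: "S \<subseteq> \<Union>\<T>" and pc: "punctured_connected S"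
    and \<gamma>: "connected \<gamma>" "\<gamma> \<subseteq> closure S"
  shows "mid_connected {K \<in> mesh_on \<T> S. K \<inter> \<gamma> \<noteq> {}}"
  unfolding mid_connected_def
proof (intro allI impI)
  define F where "F = {K \<in> mesh_on \<T> S. K \<inter> \<gamma> \<noteq> {}}"
  fix A assume "A \<subseteq> {K \<in> mesh_on \<T> S. K \<inter> \<gamma> \<noteq> {}}" "A \<noteq> {}" "A \<noteq> {K \<in> mesh_on \<T> S. K \<inter> \<gamma> \<noteq> {}}"
  then have A: "A \<subseteq> F" "A \<noteq> {}" "A \<noteq> F" by (simp_all add: F_def)
  have FT: "F \<subseteq> \<T>" using mesh_on_subset by (auto simp: F_def)
  have closedU: "closed (\<Union>B)" if "B \<subseteq> F" for B
    using that FT finite_mesh closed_tri finite_subset by (intro closed_Union) (blast intro: finite_subset)+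
  have "\<gamma> \<subseteq> \<Union>A \<union> \<Union>(F - A)"
    using \<gamma>(2) Union_mesh_on[OF S cov] unfolding F_def by blast
  moreover have "\<Union>A \<inter> \<gamma> \<noteq> {}" "\<Union>(F - A) \<inter> \<gamma> \<noteq> {}" using A unfolding F_def by blast+
  ultimately have "\<Union>A \<inter> \<Union>(F - A) \<inter> \<gamma> \<noteq> {}"
    using \<gamma>(1) closedU[OF A(1)] closedU[of "F - A"] unfolding connected_closed by blast
  then obtain K K' p where K: "K \<in> A" "K' \<in> F - A" "p \<in> K" "p \<in> K'" "p \<in> \<gamma>" by blast
  define St where "St = {K \<in> mesh_on \<T> S. p \<in> K}"
  have St: "mid_connected St" unfolding St_def using star_mid_connected[OF S cov pc] K(5) \<gamma>(2) by blast
  have "St \<subseteq> F" using K(5) by (auto simp: St_def F_def)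
  have 1: "A \<inter> St \<subseteq> St" "A \<inter> St \<noteq> {}" "A \<inter> St \<noteq> St"
    using K A(1) by (auto simp: St_def F_def)
  then obtain M M' where "M \<in> A \<inter> St" "M' \<in> St - (A \<inter> St)" "mids {M} \<inter> mids {M'} \<noteq> {}"
    using St unfolding mid_connected_def by meson
  then show "\<exists>K\<in>A. \<exists>K'\<in>{K \<in> mesh_on \<T> S. K \<inter> \<gamma> \<noteq> {}} - A. mids {K} \<inter> mids {K'} \<noteq> {}"
    using \<open>St \<subseteq> F\<close> unfolding F_def by blast
qed

text \<open>A packing argument: the balls inside different triangles are disjoint and all lie in the
  large ball, and the area of the unit disc cancels.\<close>

lemma card_triangles_in_ball:
  assumes F: "F \<subseteq> \<T>" and r: "r > 0" "\<And>K. K \<in> F \<Longrightarrow> \<exists>x. ball x r \<subseteq> K" and R: "\<And>K. K \<in> F \<Longrightarrow> K \<subseteq> cball c R"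
  shows "real (card F) * r\<^sup>2 \<le> R\<^sup>2"
proof (cases "F = {}")
  case False
  then obtain K0 x0 where "K0 \<in> F" "ball x0 r \<subseteq> K0" using r by blast
  then have "x0 \<in> cball c R" using R r(1) centre_in_ball by blast
  then have R0: "R \<ge> 0" by (meson dual_order.trans mem_cball zero_le_dist)
  have fin: "finite F" using F finite_mesh finite_subset by blast
  obtain x where x: "\<And>K. K \<in> F \<Longrightarrow> ball (x K) r \<subseteq> K" using r(2) by metis
  define V where "V = unit_ball_vol (real DIM(point))"
  have mb: "measure lborel (ball y s) = V * s\<^sup>2" "measure lborel (cball y s) = V * s\<^sup>2" if "s \<ge> 0" for y :: point and s
    using content_ball[OF that, of y] content_cball[OF that, of y] by (simp_all add: V_def)
  have V: "V > 0" by (simp add: V_def)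
  have disj: "disjoint_family_on (\<lambda>K. ball (x K) r) F"
    unfolding disjoint_family_on_def
  proof (intro ballI impI)
    fix K K' assume K: "K \<in> F" "K' \<in> F" "K \<noteq> K'"
    have "ball (x K) r \<subseteq> interior K" using x[OF K(1)] by (simp add: interior_maximal)
    then show "ball (x K) r \<inter> ball (x K') r = {}"
      using interior_Int_tri[of K K'] K F x[OF K(2)] by blast
  qed
  have fb: "emeasure lborel (ball y r) \<noteq> top" for y :: point
    using emeasure_lborel_ball_finite[of y r] by auto
  have "real (card F) * (V * r\<^sup>2) = (\<Sum>K\<in>F. measure lborel (ball (x K) r))" using r(1) by (simp add: mb)
  also have "\<dots> = measure lborel (\<Union>K\<in>F. ball (x K) r)"
    by (rule measure_finite_Union[symmetric, OF fin _ disj]) (auto simp: fb)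
  also have "\<dots> \<le> measure lborel (cball c R)"
  proof (rule measure_mono_fmeasurable)
    show "(\<Union>K\<in>F. ball (x K) r) \<subseteq> cball c R" using x R by blast
    show "(\<Union>K\<in>F. ball (x K) r) \<in> sets lborel" using fin by auto
    show "cball c R \<in> fmeasurable lborel" using emeasure_lborel_cball_finite[of c R] by (simp add: fmeasurable_def)
  qed
  also have "\<dots> = V * R\<^sup>2" using R0 by (simp add: mb)
  finally show ?thesis using V by (simp add: mult.left_commute)
qed auto

text \<open>The curve is cut into \<open>J\<close> pieces of length at most \<open>d\<close>; a
  triangle that meets a piece lies in the ball of radius \<open>2 * d\<close> around its node, where
  the packing bound applies.\<close>

lemma card_triangles_on_curve:
  assumes F: "F \<subseteq> \<T>" and r: "r > 0" "\<And>K. K \<in> F \<Longrightarrow> \<exists>x. ball x r \<subseteq> K"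
    and d: "d > 0" "\<And>K. K \<in> F \<Longrightarrow> diameter K \<le> d"
    and f: "L-lipschitz_on {0..1::real} f" and meet: "\<And>K. K \<in> F \<Longrightarrow> K \<inter> f ` {0..1} \<noteq> {}"
  shows "real (card F) \<le> (L / d + 2) * (4 * (d / r)\<^sup>2)"
proof -
  have L: "L \<ge> 0" using f lipschitz_on_nonneg by blast
  \<comment> \<open>The summand 1 keeps \<open>J\<close> positive for a constant curve, where
    \<open>L\<close> may be 0.\<close>
  define J where "J = nat \<lceil>L / d\<rceil> + 1"
  have J: "real J \<ge> L / d" "real J \<le> L / d + 2" "J > 0"
    using L d(1) by (simp_all add: J_def) linarith+
  define G where "G j = {K \<in> F. K \<subseteq> cball (f (real j / real J)) (2 * d)}" for j
  have "F \<subseteq> (\<Union>j<J. G j)"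
  proof
    fix K assume K: "K \<in> F"
    then obtain t where t: "t \<in> {0..1}" "f t \<in> K" using meet by blast
    \<comment> \<open>For t = 1 the rounded index would be \<open>J\<close>, which is out of range;
      the previous node is still within 1/J.\<close>
    define j where "j = (if t = 1 then J - 1 else nat \<lfloor>t * real J\<rfloor>)"
    have j: "j < J" "\<bar>t - real j / real J\<bar> \<le> 1 / real J"
    proof -
      have "j < J \<and> \<bar>t * real J - real j\<bar> \<le> 1"
      proof (cases "t = 1")
        case True
        then show ?thesis using J(3) by (simp add: j_def of_nat_diff)
      next
        case False
        then have "t * real J < real J" "0 \<le> t * real J" using t(1) J(3) by auto
        then show ?thesis using False by (simp add: j_def nat_less_iff floor_less_iff) linarith
      qed
      then show "j < J" "\<bar>t - real j / real J\<bar> \<le> 1 / real J"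
        using J(3) by (simp_all add: abs_le_iff field_simps)
    qed
    have "dist (f t) (f (real j / real J)) \<le> L * dist t (real j / real J)"
      using lipschitz_onD[OF f t(1)] j(1) J(3) by simp
    also have "\<dots> \<le> L * (1 / real J)" using j(2) L by (intro mult_left_mono) (simp_all add: dist_real_def)
    also have "\<dots> \<le> d" using J(1,3) d(1) by (simp add: field_simps)
    finally have ft: "dist (f t) (f (real j / real J)) \<le> d" .
    have "K \<subseteq> cball (f (real j / real J)) (2 * d)"
    proof
      fix y assume y: "y \<in> K"
      have "bounded K" using compact_tri K F compact_imp_bounded by blast
      then have "dist y (f t) \<le> d" using diameter_bounded_bound[OF _ y t(2)] d(2)[OF K] by fastforce
      then show "y \<in> cball (f (real j / real J)) (2 * d)"
        using ft dist_triangle[of y "f (real j / real J)" "f t"] by (simp add: dist_commute)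
    qed
    then show "K \<in> (\<Union>j<J. G j)" using K j(1) by (auto simp: G_def)
  qed
  moreover have "finite (\<Union>j<J. G j)" using F finite_mesh finite_subset by (fastforce simp: G_def)
  ultimately have "card F \<le> card (\<Union>j<J. G j)" by (simp add: card_mono)
  also have "\<dots> \<le> (\<Sum>j<J. card (G j))" by (rule card_UN_le) simp
  finally have "real (card F) \<le> (\<Sum>j<J. real (card (G j)))" by (metis of_nat_le_iff of_nat_sum)
  also have "\<dots> \<le> (\<Sum>j<J. 4 * (d / r)\<^sup>2)"
  proof (rule sum_mono)
    fix j
    have "real (card (G j)) * r\<^sup>2 \<le> (2 * d)\<^sup>2"
      by (rule card_triangles_in_ball) (use F r in \<open>auto simp: G_def\<close>)
    then show "real (card (G j)) \<le> 4 * (d / r)\<^sup>2" using r(1) by (simp add: power_divide field_simps)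
  qed
  also have "\<dots> = real J * (4 * (d / r)\<^sup>2)" by simp
  also have "\<dots> \<le> (L / d + 2) * (4 * (d / r)\<^sup>2)" using J(2) by (intro mult_right_mono) auto
  finally show ?thesis .
qed

end


section \<open>Interpolation on one subdomain\<close>

definition unit_circle :: "real \<Rightarrow> point" where
  "unit_circle t = vector [cos (2 * pi * t), sin (2 * pi * t)]"

lemma norm_unit_circle [simp]: "norm (unit_circle t) = 1"
  by (simp add: unit_circle_def norm_eq_sqrt_inner inner_2 power2_eq_square[symmetric])

lemma unit_circle_image: "unit_circle ` {0..1} = sphere 0 1"
proof
  show "unit_circle ` {0..1} \<subseteq> sphere 0 1"
    by auto
  show "sphere 0 1 \<subseteq> unit_circle ` {0..1}"
  proof
    fix x :: point assume "x \<in> sphere 0 1"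
    then have "(x $ 1)\<^sup>2 + (x $ 2)\<^sup>2 = 1" by (simp add: norm_eq_1 inner_2 power2_eq_square)
    then obtain t where t: "0 \<le> t" "t < 2 * pi" "x $ 1 = cos t" "x $ 2 = sin t" using sincos_total_2pi by metis
    have "x = unit_circle (t / (2 * pi))" using t by (simp add: unit_circle_def point_eq_iff)
    moreover have "t / (2 * pi) \<in> {0..1}" using t by simp
    ultimately show "x \<in> unit_circle ` {0..1}" by blast
  qed
qed

lemma lipschitz_unit_circle: "(4 * pi)-lipschitz_on A unit_circle"
proof (rule lipschitz_onI)
  fix s t
  have c: "\<bar>cos x - cos y\<bar> \<le> \<bar>x - y\<bar>" for x y :: real
    using field_differentiable_bound[of UNIV cos "\<lambda>x. - sin x" 1 x y] by (simp add: abs_le_iff DERIV_cos)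
  have s: "\<bar>sin x - sin y\<bar> \<le> \<bar>x - y\<bar>" for x y :: real
    using field_differentiable_bound[of UNIV sin cos 1 x y] by (simp add: abs_le_iff DERIV_sin)
  have "norm (unit_circle s - unit_circle t) \<le> (\<Sum>i\<in>UNIV. \<bar>(unit_circle s - unit_circle t) $ i\<bar>)"
    by (rule norm_le_l1_cart)
  also have "\<dots> \<le> \<bar>2 * pi * s - 2 * pi * t\<bar> + \<bar>2 * pi * s - 2 * pi * t\<bar>"
    using c[of "2 * pi * s" "2 * pi * t"] s[of "2 * pi * s" "2 * pi * t"] by (simp add: UNIV_2 unit_circle_def)
  also have "\<dots> = 4 * pi * \<bar>s - t\<bar>" by (simp add: abs_mult flip: right_diff_distrib)
  finally show "dist (unit_circle s) (unit_circle t) \<le> 4 * pi * dist s t" by (simp add: dist_norm)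
qed simp

text \<open>Cramer's rule in vector form: two directional derivatives determine the gradient, with
  the determinant as denominator.\<close>

lemma inner_grad_bound:
  fixes g x y :: point
  shows "norm g * \<bar>cross2 x y\<bar> \<le> \<bar>g \<bullet> x\<bar> * norm y + \<bar>g \<bullet> y\<bar> * norm x"
proof -
  have "cross2 x y *\<^sub>R g = (g \<bullet> y) *\<^sub>R rot x - (g \<bullet> x) *\<^sub>R rot y"
    by (simp add: point_eq_iff inner_2 cross2_def algebra_simps)
  then have "\<bar>cross2 x y\<bar> * norm g = norm ((g \<bullet> y) *\<^sub>R rot x - (g \<bullet> x) *\<^sub>R rot y)"
    by (metis norm_scaleR)
  also have "\<dots> \<le> norm ((g \<bullet> y) *\<^sub>R rot x) + norm ((g \<bullet> x) *\<^sub>R rot y)" by (rule norm_triangle_ineq4)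
  finally show ?thesis by (simp add: mult.commute add.commute)
qed

lemma measure_ge_ball:
  assumes "r \<ge> 0" "ball x r \<subseteq> (K :: point set)" "K \<in> lmeasurable"
  shows "3 * r\<^sup>2 \<le> measure lebesgue K"
proof -
  have "measure lebesgue (ball x r) = pi * r\<^sup>2"
    using content_ball[OF assms(1), of x] by (simp add: unit_ball_vol_2)
  moreover have "measure lebesgue (ball x r) \<le> measure lebesgue K"
    by (rule measure_mono_fmeasurable) (use assms in auto)
  moreover have "3 * r\<^sup>2 \<le> pi * r\<^sup>2" using pi_gt3 by (intro mult_right_mono) auto
  ultimately show ?thesis by linarith
qed

lemma measure_le_diameter:
  assumes "bounded K" "K \<in> lmeasurable" "diameter K \<le> d"
  shows "measure lebesgue (K :: point set) \<le> 4 * d\<^sup>2"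
proof (cases "K = {}")
  case False
  then obtain x where x: "x \<in> K" by blast
  have "K \<subseteq> cball x d"
    using diameter_bounded_bound[OF assms(1) x] assms(3) by fastforce
  moreover have d: "d \<ge> 0" using diameter_ge_0[OF assms(1)] assms(3) by simp
  ultimately have "measure lebesgue K \<le> measure lebesgue (cball x d)"
    using assms by (intro measure_mono_fmeasurable) auto
  also have "\<dots> = pi * d\<^sup>2" using content_cball[OF d, of x] by (simp add: unit_ball_vol_2)
  also have "\<dots> \<le> 4 * d\<^sup>2" using pi_less_4 by (intro mult_right_mono) auto
  finally show ?thesis .
qed auto

lemma open_not_singleton:
  assumes "open (A :: point set)" "x \<in> A" shows "\<exists>y\<in>A. y \<noteq> x"
proof (rule ccontr)
  assume "\<not> ?thesis"
  then have "A = {x}" using assms(2) by blast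
  then show False using assms(1) not_open_singleton by metis
qed

section \<open>Oscillation along curves in one subdomain\<close>

locale subdomain_mesh = triangle_mesh +
  fixes S :: "point set" and \<sigma> :: real and \<Phi> :: "point \<Rightarrow> point"
  assumes polytope: "lipschitz_polytope S"
    and aligned: "aligned \<T> S"
    and covered: "S \<subseteq> \<Union>\<T>"
    and bounded_S: "bounded S"
    and \<sigma>: "\<sigma> > 0"
    and \<Phi>_image: "\<Phi> ` cball 0 1 = closure S"
    and \<Phi>_lower: "\<And>x y. x \<in> cball 0 1 \<Longrightarrow> y \<in> cball 0 1 \<Longrightarrow> diameter S / \<sigma> * dist x y \<le> dist (\<Phi> x) (\<Phi> y)"
    and \<Phi>_upper: "\<And>x y. x \<in> cball 0 1 \<Longrightarrow> y \<in> cball 0 1 \<Longrightarrow> dist (\<Phi> x) (\<Phi> y) \<le> \<sigma> * diameter S * dist x y"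
    and quasi: "\<And>K. K \<in> mesh_on \<T> S \<Longrightarrow> \<exists>x. ball x (mesh_size (mesh_on \<T> S) / \<sigma>) \<subseteq> K"
begin

abbreviation "F \<equiv> mesh_on \<T> S"
abbreviation "H \<equiv> diameter S"
abbreviation "h \<equiv> mesh_size (mesh_on \<T> S)"

lemma open_S: "open S" and S_nonempty: "S \<noteq> {}"
  using polytope by (simp_all add: lipschitz_polytope_def)

lemma Union_F: "\<Union>F = closure S"
  by (rule Union_mesh_on[OF open_S aligned covered])

lemma F_nonempty: "F \<noteq> {}"
  using Union_F S_nonempty by (metis Union_empty closure_eq_empty)

lemma H_pos: "H > 0"
proof -
  obtain x where x: "x \<in> S" using S_nonempty by blast
  then obtain y where "y \<in> S" "y \<noteq> x" using open_not_singleton[OF open_S] by blast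
  then have "dist x y \<le> H" "dist x y > 0" using diameter_bounded_bound[OF bounded_S x] by auto
  then show ?thesis by linarith
qed

lemma diameter_le_h: "K \<in> F \<Longrightarrow> diameter K \<le> h"
  using finite_mesh_on by (simp add: mesh_size_def)

lemma h_pos: "h > 0"
proof -
  obtain K where K: "K \<in> F" using F_nonempty by blast
  then have KT: "K \<in> \<T>" using mesh_on_subset by blast
  obtain x where x: "x \<in> interior K" using interior_tri[OF KT] by blast
  obtain y where y: "y \<in> interior K" "y \<noteq> x" using open_not_singleton[OF open_interior x] by blast
  have "dist x y \<le> diameter K"
    using diameter_bounded_bound[OF compact_imp_bounded[OF compact_tri[OF KT]]] x y interior_subset by blast
  then show ?thesis using diameter_le_h[OF K] y(2) by (smt (verit) zero_less_dist_iff)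
qed

lemma h_le_H: "h \<le> H"
proof -
  have "diameter K \<le> H" if "K \<in> F" for K
  proof -
    have "diameter K \<le> diameter (closure S)"
      using that bounded_S by (intro diameter_subset) (auto simp: mesh_on_def)
    then show ?thesis by (simp add: diameter_closure[OF bounded_S])
  qed
  then show ?thesis using F_nonempty finite_mesh_on by (simp add: mesh_size_def)
qed

lemma \<Phi>_lipschitz: "(\<sigma> * H)-lipschitz_on (cball 0 1) \<Phi>"
  using \<Phi>_upper \<sigma> H_pos by (intro lipschitz_onI) auto

lemma \<Phi>_inj: "inj_on \<Phi> (cball 0 1)"
proof (rule inj_onI)
  fix x y assume xy: "x \<in> cball 0 1" "y \<in> cball 0 1" "\<Phi> x = \<Phi> y"
  then have le: "H / \<sigma> * dist x y \<le> 0" using \<Phi>_lower[OF xy(1,2)] by simp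
  have "H / \<sigma> > 0" using H_pos \<sigma> by simp
  then have "\<not> 0 < dist x y" using le mult_pos_pos[of "H / \<sigma>" "dist x y"] by linarith
  then show "x = y" by simp
qed

text \<open>Invariance of domain in both directions: \<open>\<Phi>\<close> sends the open disc to an
  open subset of the closure, hence into \<open>S\<close>, and its inverse sends \<open>S\<close>
  into the open disc. What remains is the circle.\<close>

lemma frontier_eq: "frontier S = \<Phi> ` sphere 0 1"
proof -
  have c: "continuous_on (cball 0 1) \<Phi>" using \<Phi>_lipschitz lipschitz_on_continuous_on by blast
  have "open (\<Phi> ` ball 0 1)"
    by (rule invariance_of_domain) (use c \<Phi>_inj in \<open>auto intro: continuous_on_subset inj_on_subset\<close>)
  then have 1: "\<Phi> ` ball 0 1 \<subseteq> S"
    using \<Phi>_image polytope_interior_closure[OF polytope]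
    by (metis ball_subset_cball image_mono interior_maximal)
  obtain g where g: "homeomorphism (cball 0 1) (closure S) \<Phi> g"
    using homeomorphism_compact[OF compact_cball c \<Phi>_image \<Phi>_inj] by blast
  have gi: "inj_on g (closure S)" using homeomorphism_apply2[OF g] by (rule inj_on_inverseI)
  have "open (g ` S)"
    using homeomorphism_cont2[OF g] gi closure_subset open_S
    by (intro invariance_of_domain) (auto intro: continuous_on_subset inj_on_subset)
  moreover have "g ` S \<subseteq> cball 0 1" using homeomorphism_image2[OF g] closure_subset by blast
  ultimately have "g ` S \<subseteq> ball 0 1" by (metis interior_cball interior_maximal)
  have 2: "S \<subseteq> \<Phi> ` ball 0 1"
  proof
    fix x assume x: "x \<in> S"
    then have "\<Phi> (g x) = x" using homeomorphism_apply2[OF g] closure_subset by blast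
    then show "x \<in> \<Phi> ` ball 0 1" using x \<open>g ` S \<subseteq> ball 0 1\<close> by (metis image_eqI image_subset_iff)
  qed
  have "frontier S = \<Phi> ` cball 0 1 - \<Phi> ` ball 0 1"
    using 1 2 \<Phi>_image open_S by (auto simp: frontier_def interior_open)
  also have "\<dots> = \<Phi> ` (cball 0 1 - ball 0 1)" using \<Phi>_inj by (simp add: inj_on_image_set_diff)
  also have "cball 0 1 - ball 0 1 = sphere (0::point) 1" by auto
  finally show ?thesis .
qed

lemma oscillation_on_curve:
  assumes u: "u \<in> CR \<Omega> \<T>" and \<gamma>: "connected \<gamma>" "\<gamma> \<subseteq> closure S"
    and K: "K \<in> F" "K \<inter> \<gamma> \<noteq> {}" "m \<in> mids {K}" and K': "K' \<in> F" "K' \<inter> \<gamma> \<noteq> {}" "m' \<in> mids {K'}"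
  shows "\<bar>u m - u m'\<bar> \<le> (\<Sum>K\<in>{K \<in> F. K \<inter> \<gamma> \<noteq> {}}. norm (cr_grad u K) * h)"
proof (rule mid_connected_oscillation)
  show "finite {K \<in> F. K \<inter> \<gamma> \<noteq> {}}" using finite_mesh_on by auto
  show "mid_connected {K \<in> F. K \<inter> \<gamma> \<noteq> {}}"
    by (rule connected_mid_connected[OF open_S aligned covered punctured_connected_polytope[OF polytope] \<gamma>])
  fix L l l' assume L: "L \<in> {K \<in> F. K \<inter> \<gamma> \<noteq> {}}" "l \<in> mids {L}" "l' \<in> mids {L}"
  then have LT: "L \<in> \<T>" "L \<in> F" using mesh_on_subset by blast+
  have "dist l l' \<le> diameter L"
    using diameter_bounded_bound[OF compact_imp_bounded[OF compact_tri[OF LT(1)]]] mids_subset_tri[OF LT(1)] L by blast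
  then have "norm (l - l') \<le> h" using diameter_le_h[OF LT(2)] by (simp add: dist_norm)
  moreover have "\<bar>u l - u l'\<bar> \<le> norm (cr_grad u L) * norm (l - l')"
    using cr_grad_diff[OF u LT(1) L(2,3)] Cauchy_Schwarz_ineq2 by metis
  ultimately show "\<bar>u l - u l'\<bar> \<le> norm (cr_grad u L) * h"
    by (meson mult_left_mono norm_ge_zero order_trans)
qed (use K K' in auto)

lemma card_on_curve:
  assumes "L-lipschitz_on {0..1::real} f"
  shows "real (card {K \<in> F. K \<inter> f ` {0..1} \<noteq> {}}) \<le> 4 * \<sigma>\<^sup>2 * (L / h + 2)"
proof -
  have "real (card {K \<in> F. K \<inter> f ` {0..1} \<noteq> {}}) \<le> (L / h + 2) * (4 * (h / (h / \<sigma>))\<^sup>2)"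
    by (rule card_triangles_on_curve[OF _ _ _ h_pos _ assms])
      (use mesh_on_subset h_pos \<sigma> quasi diameter_le_h in auto)
  then show ?thesis using h_pos by (simp add: mult_ac)
qed

text \<open>Cauchy-Schwarz against the number of triangles on the curve, which grows only like L/h.
  This count is the price for comparing point values of discontinuous functions.\<close>

lemma oscillation_on_curve_sq:
  assumes u: "u \<in> CR \<Omega> \<T>" and f: "L-lipschitz_on {0..1::real} f" and \<gamma>: "f ` {0..1} \<subseteq> closure S"
    and K: "K \<in> F" "K \<inter> f ` {0..1} \<noteq> {}" "m \<in> mids {K}" and K': "K' \<in> F" "K' \<inter> f ` {0..1} \<noteq> {}" "m' \<in> mids {K'}"
  shows "(u m - u m')\<^sup>2 \<le> 4 * \<sigma>\<^sup>2 * (L / h + 2) * (\<Sum>K\<in>{K \<in> F. K \<inter> f ` {0..1} \<noteq> {}}. (norm (cr_grad u K))\<^sup>2 * h\<^sup>2)"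
proof -
  let ?G = "{K \<in> F. K \<inter> f ` {0..1} \<noteq> {}}"
  have "connected (f ` {0..1})"
    using lipschitz_on_continuous_on[OF f] by (intro connected_continuous_image) auto
  from power_mono[OF oscillation_on_curve[OF u this \<gamma> K K'] abs_ge_zero, of 2]
  have "(u m - u m')\<^sup>2 \<le> (\<Sum>K\<in>?G. norm (cr_grad u K) * h)\<^sup>2"
    by (simp only: power2_abs)
  also have "\<dots> \<le> (\<Sum>K\<in>?G. 1\<^sup>2) * (\<Sum>K\<in>?G. (norm (cr_grad u K) * h)\<^sup>2)"
    using Cauchy_Schwarz_ineq_sum[of "\<lambda>_. 1" "\<lambda>K. norm (cr_grad u K) * h" ?G] by (simp only: mult_1)
  also have "\<dots> = real (card ?G) * (\<Sum>K\<in>?G. (norm (cr_grad u K))\<^sup>2 * h\<^sup>2)"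
    by (simp only: power_one sum_constant power_mult_distrib mult_1_right)
  also have "\<dots> \<le> 4 * \<sigma>\<^sup>2 * (L / h + 2) * (\<Sum>K\<in>?G. (norm (cr_grad u K))\<^sup>2 * h\<^sup>2)"
    by (rule mult_right_mono[OF card_on_curve[OF f] sum_nonneg]) simp
  finally show ?thesis .
qed

end

text \<open>The counting factor for a closed ring of length at most 4 pi \<sigma> H, with the
  summand 2 absorbed by H/h. Like the next two constants it is defined for all \<sigma>, since the
  final constants must be named before any mesh is given.\<close>

definition ring_const :: "real \<Rightarrow> real" where
  "ring_const \<sigma> = 4 * \<sigma>\<^sup>2 * (4 * pi * \<sigma> + 2)"

text \<open>The counting factor for a radial curve across \<open>q\<close> rings, whose length is at
  most 3 \<sigma>^2 q h, so that h cancels.\<close>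

definition radial_const :: "real \<Rightarrow> nat \<Rightarrow> real" where
  "radial_const \<sigma> q = 4 * \<sigma>\<^sup>2 * (3 * \<sigma>\<^sup>2 * real q + 2)"

text \<open>One ring constant counts the triangles of the layer, the other bounds the oscillation.
  The fraction 4/3 compares the upper and lower area bounds, and \<sigma>^6 combines the squared
  inverse estimate with shape regularity.\<close>

definition layer_const :: "real \<Rightarrow> real" where
  "layer_const \<sigma> = 4 / 3 * (ring_const \<sigma>)\<^sup>2 * \<sigma> ^ 6"

lemma ring_const_pos: "\<sigma> > 0 \<Longrightarrow> ring_const \<sigma> > 0"
  by (simp add: ring_const_def add_pos_pos)

lemma radial_const_nonneg: "radial_const \<sigma> q \<ge> 0"
  by (simp add: radial_const_def)

lemma layer_const_pos: "\<sigma> > 0 \<Longrightarrow> layer_const \<sigma> > 0"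
  using ring_const_pos[of \<sigma>] by (simp add: layer_const_def)

context subdomain_mesh
begin

abbreviation "layer \<equiv> {K \<in> F. K \<inter> frontier S \<noteq> {}}"

text \<open>Unweighted energy, with \<open>h\<^sup>2\<close> standing for the area of a
  triangle.\<close>

abbreviation "energy u G \<equiv> (\<Sum>K\<in>G. (norm (cr_grad u K))\<^sup>2 * h\<^sup>2)"

lemma frontier_subset_closure: "frontier S \<subseteq> closure S"
  by (simp add: frontier_def)

lemma ring_curve:
  assumes "0 \<le> \<rho>" "\<rho> \<le> 1"
  shows "(4 * pi * \<sigma> * H)-lipschitz_on {0..1} (\<lambda>t. \<Phi> (\<rho> *\<^sub>R unit_circle t))"
    "(\<lambda>t. \<Phi> (\<rho> *\<^sub>R unit_circle t)) ` {0..1} \<subseteq> closure S"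
proof -
  have c: "\<rho> *\<^sub>R unit_circle t \<in> cball 0 1" for t using assms by simp
  show "(\<lambda>t. \<Phi> (\<rho> *\<^sub>R unit_circle t)) ` {0..1} \<subseteq> closure S" using c \<Phi>_image by blast
  show "(4 * pi * \<sigma> * H)-lipschitz_on {0..1} (\<lambda>t. \<Phi> (\<rho> *\<^sub>R unit_circle t))"
  proof (rule lipschitz_onI)
    fix s t :: real
    have "dist (\<Phi> (\<rho> *\<^sub>R unit_circle s)) (\<Phi> (\<rho> *\<^sub>R unit_circle t)) \<le> \<sigma> * H * dist (\<rho> *\<^sub>R unit_circle s) (\<rho> *\<^sub>R unit_circle t)"
      by (rule \<Phi>_upper[OF c c])
    also have "dist (\<rho> *\<^sub>R unit_circle s) (\<rho> *\<^sub>R unit_circle t) = \<rho> * dist (unit_circle s) (unit_circle t)"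
      using assms by (simp add: dist_norm flip: scaleR_diff_right)
    also have "\<sigma> * H * (\<rho> * dist (unit_circle s) (unit_circle t)) \<le> \<sigma> * H * (1 * (4 * pi * dist s t))"
      using assms \<sigma> H_pos lipschitz_onD[OF lipschitz_unit_circle[of UNIV], of s t] by (intro mult_left_mono mult_mono) auto
    finally show "dist (\<Phi> (\<rho> *\<^sub>R unit_circle s)) (\<Phi> (\<rho> *\<^sub>R unit_circle t)) \<le> 4 * pi * \<sigma> * H * dist s t"
      by (simp add: mult_ac)
  qed (use \<sigma> H_pos in auto)
qed

lemma frontier_curve: "frontier S = (\<lambda>t. \<Phi> (1 *\<^sub>R unit_circle t)) ` {0..1}"
  unfolding frontier_eq unit_circle_image[symmetric] by (simp add: image_image)

abbreviation "C_ring \<equiv> ring_const \<sigma>"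

lemma C_ring_pos: "C_ring > 0"
  using \<sigma> by (rule ring_const_pos)

lemma C_ring_bound: "4 * \<sigma>\<^sup>2 * (4 * pi * \<sigma> * H / h + 2) \<le> C_ring * (H / h)"
proof -
  have "1 \<le> H / h" using h_le_H h_pos by (simp add: le_divide_eq_1)
  moreover have "4 * pi * \<sigma> * H / h = 4 * pi * \<sigma> * (H / h)" by simp
  ultimately have "4 * pi * \<sigma> * H / h + 2 \<le> (4 * pi * \<sigma> + 2) * (H / h)"
    unfolding distrib_right by linarith
  then have "4 * \<sigma>\<^sup>2 * (4 * pi * \<sigma> * H / h + 2) \<le> 4 * \<sigma>\<^sup>2 * ((4 * pi * \<sigma> + 2) * (H / h))"
    by (rule mult_left_mono) simp
  then show ?thesis by (simp add: ring_const_def mult.assoc)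
qed

lemma card_layer: "real (card layer) \<le> C_ring * (H / h)"
  using card_on_curve[OF ring_curve(1)[of 1]] C_ring_bound frontier_curve by force

lemma frontier_mid_layer:
  assumes "m \<in> cr_boundary \<T> S"
  shows "\<exists>K\<in>layer. m \<in> mids {K}"
proof -
  have m: "m \<in> mids \<T>" "m \<in> frontier S" using assms by (auto simp: cr_boundary_def)
  then obtain K where K: "K \<in> F" "m \<in> K" using Union_F frontier_subset_closure by blast
  then have "m \<in> mids {K}" using mids_iff[of K m] m(1) mesh_on_subset by blast
  then show ?thesis using K m(2) by blast
qed

text \<open>The image of the unit circle is one closed curve that runs through the whole frontier,
  so the triangles it meets are exactly those of the layer.\<close>

lemma boundary_oscillation:
  assumes u: "u \<in> CR \<Omega> \<T>" and m: "m \<in> cr_boundary \<T> S" "m' \<in> cr_boundary \<T> S"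
  shows "(u m - u m')\<^sup>2 \<le> C_ring * (H / h) * energy u layer"
proof -
  obtain K K' where K: "K \<in> layer" "m \<in> mids {K}" "K' \<in> layer" "m' \<in> mids {K'}"
    using frontier_mid_layer m by meson
  let ?f = "\<lambda>t. \<Phi> (1 *\<^sub>R unit_circle t)"
  have "(u m - u m')\<^sup>2 \<le> 4 * \<sigma>\<^sup>2 * (4 * pi * \<sigma> * H / h + 2) * energy u {K \<in> F. K \<inter> ?f ` {0..1} \<noteq> {}}"
    by (rule oscillation_on_curve_sq[OF u ring_curve[of 1], of K m K' m'])
      (use K frontier_curve in auto)
  also have "{K \<in> F. K \<inter> ?f ` {0..1} \<noteq> {}} = layer" by (simp only: frontier_curve)
  also have "4 * \<sigma>\<^sup>2 * (4 * pi * \<sigma> * H / h + 2) * energy u layer \<le> C_ring * (H / h) * energy u layer"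
    by (rule mult_right_mono[OF C_ring_bound]) (simp add: sum_nonneg)
  finally show ?thesis .
qed

text \<open>Concentric rings at mutual distance at least \<open>3 h\<close> meet disjoint sets of triangles, so one of
  \<open>q\<close> rings carries at most the fraction \<open>1/q\<close> of the energy.\<close>

lemma cheap_ring:
  assumes q: "q \<ge> 1" and qh: "real q * (3 * \<sigma> * h) \<le> H"
  obtains \<rho> where "0 \<le> \<rho>" "\<rho> \<le> 1" "1 - \<rho> \<le> real q * (3 * \<sigma> * h / H)"
    "energy u {K \<in> F. K \<inter> (\<lambda>t. \<Phi> (\<rho> *\<^sub>R unit_circle t)) ` {0..1} \<noteq> {}} \<le> energy u F / real q"
proof -
  \<comment> \<open>By the lower Lipschitz bound, circles whose radii differ by
    \<open>\<tau>\<close> have images at distance at least 3h, more than the diameter of a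
    triangle.\<close>
  define \<tau> where "\<tau> = 3 * \<sigma> * h / H"
  have \<tau>: "\<tau> > 0" using \<sigma> h_pos H_pos by (simp add: \<tau>_def)
  have q\<tau>: "real q * \<tau> \<le> 1" using qh H_pos by (simp add: \<tau>_def field_simps)
  define r where "r k = 1 - real k * \<tau>" for k
  define R where "R k = {K \<in> F. K \<inter> (\<lambda>t. \<Phi> (r k *\<^sub>R unit_circle t)) ` {0..1} \<noteq> {}}" for k
  have r: "0 \<le> r k" "r k \<le> 1" "1 - r k \<le> real q * \<tau>" if "k < q" for k
  proof -
    have "real k * \<tau> \<le> real q * \<tau>" using that \<tau> by simp
    moreover have "0 \<le> real k * \<tau>" using \<tau> by simp
    ultimately show "0 \<le> r k" "r k \<le> 1" "1 - r k \<le> real q * \<tau>" using q\<tau> unfolding r_def by linarith+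
  qed
  have disj: "R k \<inter> R l = {}" if kl: "k < q" "l < q" "k \<noteq> l" for k l
  proof (rule ccontr)
    assume "R k \<inter> R l \<noteq> {}"
    then obtain K s t where K: "K \<in> F" "\<Phi> (r k *\<^sub>R unit_circle s) \<in> K" "\<Phi> (r l *\<^sub>R unit_circle t) \<in> K"
      by (auto simp: R_def)
    have KT: "K \<in> \<T>" using K(1) mesh_on_subset by blast
    have c: "r k *\<^sub>R unit_circle s \<in> cball 0 1" "r l *\<^sub>R unit_circle t \<in> cball 0 1" using r kl by auto
    have "1 \<le> \<bar>real l - real k\<bar>" using kl(3) by linarith
    then have "1 * \<tau> \<le> \<bar>real l - real k\<bar> * \<tau>" using \<tau> by (intro mult_right_mono) auto
    then have "\<tau> \<le> \<bar>real l - real k\<bar> * \<tau>" by simp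
    also have "\<dots> = \<bar>r k - r l\<bar>"
    proof -
      have "r k - r l = (real l - real k) * \<tau>" by (simp add: r_def left_diff_distrib)
      then show ?thesis using \<tau> by (simp add: abs_mult)
    qed
    also have "\<dots> = \<bar>norm (r k *\<^sub>R unit_circle s) - norm (r l *\<^sub>R unit_circle t)\<bar>" using r kl by simp
    also have "\<dots> \<le> dist (r k *\<^sub>R unit_circle s) (r l *\<^sub>R unit_circle t)"
      unfolding dist_norm by (rule norm_triangle_ineq3)
    finally have "H / \<sigma> * \<tau> \<le> H / \<sigma> * dist (r k *\<^sub>R unit_circle s) (r l *\<^sub>R unit_circle t)"
      using H_pos \<sigma> by (intro mult_left_mono) auto
    also have "\<dots> \<le> dist (\<Phi> (r k *\<^sub>R unit_circle s)) (\<Phi> (r l *\<^sub>R unit_circle t))" by (rule \<Phi>_lower[OF c])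
    also have "\<dots> \<le> diameter K"
      by (rule diameter_bounded_bound[OF compact_imp_bounded[OF compact_tri[OF KT]] K(2,3)])
    also have "\<dots> \<le> h" by (rule diameter_le_h[OF K(1)])
    finally have "3 * h \<le> h" using H_pos \<sigma> by (simp add: \<tau>_def)
    then show False using h_pos by simp
  qed
  have "\<exists>k<q. energy u (R k) \<le> energy u F / real q"
  proof (rule ccontr)
    assume "\<not> ?thesis"
    then have big: "energy u F / real q < energy u (R k)" if "k < q" for k using that by force
    have "energy u F = (\<Sum>k<q. energy u F / real q)" using q by simp
    also have "\<dots> < (\<Sum>k<q. energy u (R k))" using big q by (intro sum_strict_mono) (auto simp: lessThan_empty_iff)
    also have "\<dots> = energy u (\<Union>k<q. R k)"
      by (rule sum.UNION_disjoint[symmetric]) (use disj finite_mesh_on in \<open>auto simp: R_def\<close>)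
    also have "\<dots> \<le> energy u F"
      by (rule sum_mono2[OF finite_mesh_on]) (auto simp: R_def)
    finally show False by simp
  qed
  then obtain k where "k < q" "energy u (R k) \<le> energy u F / real q" by blast
  then show ?thesis using that[of "r k"] r[of k] by (simp add: R_def \<tau>_def)
qed

abbreviation "C_radial \<equiv> radial_const \<sigma>"

text \<open>The route goes radially inwards from one midpoint, along the cheap ring, and radially
  outwards to the other. The radial legs meet O(q) triangles each; the square of the three-term sum
  brings the factor 3.\<close>

lemma boundary_oscillation_rings:
  assumes u: "u \<in> CR \<Omega> \<T>" and m: "m \<in> cr_boundary \<T> S" "m' \<in> cr_boundary \<T> S"
    and q: "q \<ge> 1" and qh: "real q * (3 * \<sigma> * h) \<le> H"
  shows "(u m - u m')\<^sup>2 \<le> (6 * C_radial q + 3 * C_ring * (H / h) / real q) * energy u F"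
proof -
  obtain \<rho> where \<rho>: "0 \<le> \<rho>" "\<rho> \<le> 1" "1 - \<rho> \<le> real q * (3 * \<sigma> * h / H)"
    "energy u {K \<in> F. K \<inter> (\<lambda>t. \<Phi> (\<rho> *\<^sub>R unit_circle t)) ` {0..1} \<noteq> {}} \<le> energy u F / real q"
    using cheap_ring[OF q qh] .
  let ?ring = "\<lambda>t. \<Phi> (\<rho> *\<^sub>R unit_circle t)"
  have en: "energy u G \<le> energy u F" if "G \<subseteq> F" for G
    by (rule sum_mono2[OF finite_mesh_on that]) simp
  have radial: "\<exists>K\<in>F. \<exists>l\<in>mids {K}. K \<inter> ?ring ` {0..1} \<noteq> {} \<and> (u m - u l)\<^sup>2 \<le> C_radial q * energy u F"
    if m: "m \<in> cr_boundary \<T> S" for m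
  proof -
    obtain K where K: "K \<in> F" "m \<in> mids {K}" "m \<in> K"
      using frontier_mid_layer[OF m] mids_subset_tri mesh_on_subset by blast
    have "m \<in> frontier S" using m by (simp add: cr_boundary_def)
    then obtain s where s: "s \<in> {0..1}" "m = \<Phi> (unit_circle s)"
      unfolding frontier_curve by auto
    \<comment> \<open>The radial leg, from \<open>m\<close> at parameter 0 to the cheap ring at
      parameter 1.\<close>
    define f where "f t = \<Phi> ((1 - t * (1 - \<rho>)) *\<^sub>R unit_circle s)" for t
    have c: "(1 - t * (1 - \<rho>)) *\<^sub>R unit_circle s \<in> cball 0 1" if "t \<in> {0..1}" for t
    proof -
      have "t * (1 - \<rho>) \<le> 1 * 1" using that \<rho>(1,2) by (intro mult_mono) auto
      moreover have "t * (1 - \<rho>) \<ge> 0" using that \<rho> by simp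
      ultimately show ?thesis by simp
    qed
    have f: "(3 * \<sigma>\<^sup>2 * real q * h)-lipschitz_on {0..1} f"
    proof (rule lipschitz_onI)
      fix t t' :: real assume t: "t \<in> {0..1}" "t' \<in> {0..1}"
      have "dist (f t) (f t') \<le> \<sigma> * H * dist ((1 - t * (1 - \<rho>)) *\<^sub>R unit_circle s) ((1 - t' * (1 - \<rho>)) *\<^sub>R unit_circle s)"
        unfolding f_def by (rule \<Phi>_upper[OF c c]) (use t in auto)
      also have "dist ((1 - t * (1 - \<rho>)) *\<^sub>R unit_circle s) ((1 - t' * (1 - \<rho>)) *\<^sub>R unit_circle s) = (1 - \<rho>) * dist t t'"
      proof -
        have "(1 - t * (1 - \<rho>)) *\<^sub>R unit_circle s - (1 - t' * (1 - \<rho>)) *\<^sub>R unit_circle s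
          = ((1 - \<rho>) * (t' - t)) *\<^sub>R unit_circle s" by (simp add: algebra_simps)
        then show ?thesis using \<rho>(2) by (simp add: dist_norm abs_mult abs_minus_commute)
      qed
      also have "\<sigma> * H * ((1 - \<rho>) * dist t t') \<le> \<sigma> * H * ((real q * (3 * \<sigma> * h / H)) * dist t t')"
        using \<sigma> H_pos \<rho>(3) by (intro mult_left_mono mult_right_mono) auto
      also have "\<dots> = 3 * \<sigma>\<^sup>2 * real q * h * dist t t'" using H_pos by (simp add: power2_eq_square)
      finally show "dist (f t) (f t') \<le> 3 * \<sigma>\<^sup>2 * real q * h * dist t t'" .
    qed (use h_pos in auto)
    have fc: "f ` {0..1} \<subseteq> closure S" using c \<Phi>_image by (force simp: f_def)
    have f0: "f 0 = m" by (simp add: f_def s)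
    have f1: "f 1 = ?ring s" by (simp add: f_def)
    have "f 1 \<in> closure S" using fc by auto
    then obtain K' where K': "K' \<in> F" "f 1 \<in> K'" using Union_F by blast
    obtain l where l: "l \<in> mids {K'}" using tri_obtain[of K'] K'(1) mesh_on_subset by (metis insertI1 subsetD)
    have "(u m - u l)\<^sup>2 \<le> 4 * \<sigma>\<^sup>2 * (3 * \<sigma>\<^sup>2 * real q * h / h + 2) * energy u {K \<in> F. K \<inter> f ` {0..1} \<noteq> {}}"
      by (rule oscillation_on_curve_sq[OF u f fc K(1) _ K(2) K'(1) _ l])
        (use K(3) K'(2) f0 in \<open>force+\<close>)
    also have "\<dots> \<le> C_radial q * energy u F"
      using h_pos by (simp add: radial_const_def) (intro mult_left_mono en, auto)
    finally have "(u m - u l)\<^sup>2 \<le> C_radial q * energy u F" .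
    moreover have "K' \<inter> ?ring ` {0..1} \<noteq> {}" using K'(2) f1 s(1) by auto
    ultimately show ?thesis using K'(1) l by blast
  qed
  obtain K l where K: "K \<in> F" "l \<in> mids {K}" "K \<inter> ?ring ` {0..1} \<noteq> {}" "(u m - u l)\<^sup>2 \<le> C_radial q * energy u F"
    using radial[OF m(1)] by blast
  obtain K' l' where K': "K' \<in> F" "l' \<in> mids {K'}" "K' \<inter> ?ring ` {0..1} \<noteq> {}" "(u m' - u l')\<^sup>2 \<le> C_radial q * energy u F"
    using radial[OF m(2)] by blast
  have "(u l - u l')\<^sup>2 \<le> 4 * \<sigma>\<^sup>2 * (4 * pi * \<sigma> * H / h + 2) * energy u {K \<in> F. K \<inter> ?ring ` {0..1} \<noteq> {}}"
    by (rule oscillation_on_curve_sq[OF u ring_curve[OF \<rho>(1,2)] K(1,3,2) K'(1,3,2)])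
  also have "\<dots> \<le> C_ring * (H / h) * (energy u F / real q)"
    by (rule mult_mono[OF C_ring_bound \<rho>(4)]) (use C_ring_pos H_pos h_pos in \<open>auto simp: sum_nonneg\<close>)
  finally have ll: "(u l - u l')\<^sup>2 \<le> C_ring * (H / h) / real q * energy u F" by simp
  have sq3: "(x + y + w)\<^sup>2 \<le> 3 * (x\<^sup>2 + y\<^sup>2 + w\<^sup>2)" for x y w :: real
    using sum_squares_bound[of x y] sum_squares_bound[of y w] sum_squares_bound[of x w]
    by (simp add: power2_eq_square algebra_simps)
  have "(u m - u m')\<^sup>2 = ((u m - u l) + (u l - u l') + (u l' - u m'))\<^sup>2" by simp
  also have "\<dots> \<le> 3 * ((u m - u l)\<^sup>2 + (u l - u l')\<^sup>2 + (u l' - u m')\<^sup>2)" by (rule sq3)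
  also have "(u l' - u m')\<^sup>2 = (u m' - u l')\<^sup>2" by (simp add: power2_commute)
  also have "3 * ((u m - u l)\<^sup>2 + (u l - u l')\<^sup>2 + (u m' - u l')\<^sup>2)
    \<le> 3 * (C_radial q * energy u F + C_ring * (H / h) / real q * energy u F + C_radial q * energy u F)"
    by (intro mult_left_mono add_mono K(4) K'(4) ll) simp
  finally show ?thesis by (simp add: algebra_simps)
qed

end

section \<open>Energy of the interpolant on one subdomain\<close>

context subdomain_mesh
begin

lemma measure_tri_bounds:
  assumes K: "K \<in> F"
  shows "3 * (h / \<sigma>)\<^sup>2 \<le> measure lebesgue K" "measure lebesgue K \<le> 4 * h\<^sup>2"
proof -
  have KT: "K \<in> \<T>" using K mesh_on_subset by blast
  have lm: "K \<in> lmeasurable" using compact_tri[OF KT] by (rule lmeasurable_compact)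
  obtain x where "ball x (h / \<sigma>) \<subseteq> K" using quasi[OF K] by blast
  then show "3 * (h / \<sigma>)\<^sup>2 \<le> measure lebesgue K"
    using measure_ge_ball[OF _ _ lm] h_pos \<sigma> by simp
  show "measure lebesgue K \<le> 4 * h\<^sup>2"
    by (rule measure_le_diameter[OF compact_imp_bounded[OF compact_tri[OF KT]] lm diameter_le_h[OF K]])
qed

text \<open>Increments along two edges are at most 2 \<delta>, and the determinant is at least 6
  (h/\<sigma>)^2, so Cramer's rule gives the factor 2/3 \<sigma>^2, rounded up here.\<close>

lemma gradient_inverse_estimate:
  assumes v: "v \<in> CR \<Omega> \<T>" and K: "K \<in> F" and \<delta>: "\<And>m m'. m \<in> mids {K} \<Longrightarrow> m' \<in> mids {K} \<Longrightarrow> \<bar>v m - v m'\<bar> \<le> \<delta>"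
  shows "norm (cr_grad v K) * h \<le> \<sigma>\<^sup>2 * \<delta>"
proof -
  have KT: "K \<in> \<T>" using K mesh_on_subset by blast
  obtain a b c where abc: "K = convex hull {a, b, c}" "mids {K} = {midpoint a b, midpoint b c, midpoint c a}"
    using tri_obtain[OF KT] by metis
  define g where "g = cr_grad v K"
  define X where "X = \<bar>cross2 (b - a) (c - a)\<bar>"
  have vK: "a \<in> K" "b \<in> K" "c \<in> K" unfolding abc(1) by (auto intro: hull_inc)
  have d: "norm (x - y) \<le> h" if "x \<in> K" "y \<in> K" for x y
    using diameter_bounded_bound[OF compact_imp_bounded[OF compact_tri[OF KT]] that] diameter_le_h[OF K]
    by (simp add: dist_norm)
  have \<delta>0: "\<delta> \<ge> 0" using \<delta>[of "midpoint a b" "midpoint a b"] abc(2) by simp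
  have "g \<bullet> (b - a) = 2 * (v (midpoint b c) - v (midpoint c a))"
    using cr_grad_diff[OF v KT, of "midpoint b c" "midpoint c a"] abc(2)
    by (simp add: g_def midpoint_def inner_diff_right inner_add_right field_simps)
  then have 1: "\<bar>g \<bullet> (b - a)\<bar> \<le> 2 * \<delta>"
    using \<delta>[of "midpoint b c" "midpoint c a"] abc(2) by (simp add: abs_mult)
  have "g \<bullet> (c - a) = 2 * (v (midpoint b c) - v (midpoint a b))"
    using cr_grad_diff[OF v KT, of "midpoint b c" "midpoint a b"] abc(2)
    by (simp add: g_def midpoint_def inner_diff_right inner_add_right field_simps)
  then have 2: "\<bar>g \<bullet> (c - a)\<bar> \<le> 2 * \<delta>"
    using \<delta>[of "midpoint b c" "midpoint a b"] abc(2) by (simp add: abs_mult)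
  have "norm g * X \<le> \<bar>g \<bullet> (b - a)\<bar> * norm (c - a) + \<bar>g \<bullet> (c - a)\<bar> * norm (b - a)"
    unfolding X_def by (rule inner_grad_bound)
  also have "\<dots> \<le> 2 * \<delta> * h + 2 * \<delta> * h"
    using 1 2 d[OF vK(3,1)] d[OF vK(2,1)] \<delta>0 by (intro add_mono mult_mono) auto
  finally have le: "norm g * X \<le> 4 * \<delta> * h" by simp
  have "6 * (h / \<sigma>)\<^sup>2 \<le> X"
    using measure_tri_bounds(1)[OF K] content_triangle_cross[of a b c] by (simp add: X_def abc(1))
  then have "norm g * (6 * (h / \<sigma>)\<^sup>2) \<le> 4 * \<delta> * h"
    using le by (meson mult_left_mono norm_ge_zero order_trans)
  then have "norm g * h * 6 * h \<le> 4 * \<delta> * \<sigma>\<^sup>2 * h"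
    using \<sigma> by (simp add: power_divide power2_eq_square field_simps)
  then have "norm g * h * 6 \<le> 4 * \<delta> * \<sigma>\<^sup>2" using h_pos by simp
  moreover have "0 \<le> \<delta> * \<sigma>\<^sup>2" using \<delta>0 by simp
  ultimately show ?thesis unfolding g_def by (simp add: mult.commute)
qed

lemma average_deviation:
  assumes m: "m \<in> cr_boundary \<T> S" and \<delta>: "\<And>m'. m' \<in> cr_boundary \<T> S \<Longrightarrow> \<bar>u m - u m'\<bar> \<le> \<delta>"
  shows "\<bar>u m - boundary_average \<T> S u\<bar> \<le> \<delta>"
proof -
  let ?B = "cr_boundary \<T> S"
  have fin: "finite ?B" using finite_mids by (simp add: cr_boundary_def)
  then have n: "real (card ?B) > 0" using m by (auto simp: card_gt_0_iff)
  have "u m - boundary_average \<T> S u = (\<Sum>y\<in>?B. u m - u y) / real (card ?B)"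
    using n by (simp add: boundary_average_def sum_subtractf diff_divide_distrib)
  also have "\<bar>\<dots>\<bar> \<le> (\<Sum>y\<in>?B. \<bar>u m - u y\<bar>) / real (card ?B)"
    using n by (simp add: abs_divide divide_right_mono sum_abs)
  also have "\<dots> \<le> (\<Sum>y\<in>?B. \<delta>) / real (card ?B)" using n \<delta> by (intro divide_right_mono sum_mono) auto
  also have "\<dots> = \<delta>" using n by simp
  finally show ?thesis .
qed

text \<open>Off the layer all midpoint values of a triangle equal the average, so the gradient
  vanishes; each of the O(H/h) layer triangles is controlled by the boundary oscillation. The bound
  \<open>D\<close> for that oscillation is left open because two different ones are
  inserted.\<close>

lemma interpolant_energy:
  assumes w: "w \<in> CR \<Omega> \<T>" "\<And>x. x \<in> cr_boundary \<T> S \<Longrightarrow> w x = u x"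
      "\<And>x. x \<in> cr_interior \<T> S \<Longrightarrow> w x = boundary_average \<T> S u"
    and D: "D \<ge> 0" "\<And>m m'. m \<in> cr_boundary \<T> S \<Longrightarrow> m' \<in> cr_boundary \<T> S \<Longrightarrow> (u m - u m')\<^sup>2 \<le> D"
    and a: "\<And>K. K \<in> layer \<Longrightarrow> 0 \<le> a K \<and> a K \<le> b * measure lebesgue K" "b \<ge> 0"
  shows "(\<Sum>K\<in>F. a K * (norm (cr_grad w K))\<^sup>2) \<le> C_ring * (H / h) * (4 * b * \<sigma> ^ 4 * D)"
proof -
  have mid_cases: "m \<in> cr_boundary \<T> S \<or> m \<in> cr_interior \<T> S" if "K \<in> F" "m \<in> mids {K}" for K m
  proof -
    have "K \<in> \<T>" using that(1) mesh_on_subset by blast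
    then have "m \<in> mids \<T>" "m \<in> closure S" using that mids_iff by (auto simp: mesh_on_def)
    then show ?thesis using open_S by (auto simp: cr_boundary_def cr_interior_def frontier_def interior_open)
  qed
  have zero: "cr_grad w K = 0" if K: "K \<in> F" "K \<notin> layer" for K
  proof -
    have KT: "K \<in> \<T>" using K mesh_on_subset by blast
    have "w m = boundary_average \<T> S u" if "m \<in> mids {K}" for m
    proof -
      have "m \<notin> frontier S" using K that mids_subset_tri[OF KT] by blast
      then show ?thesis using mid_cases[OF K(1) that] w(3) by (auto simp: cr_boundary_def)
    qed
    then show ?thesis by (intro cr_grad_unique[OF w(1) KT]) simp
  qed
  define \<delta> where "\<delta> = sqrt D"
  have \<delta>: "\<delta> \<ge> 0" "\<delta>\<^sup>2 = D" using D(1) by (simp_all add: \<delta>_def)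
  have ud: "\<bar>u m - u m'\<bar> \<le> \<delta>" if "m \<in> cr_boundary \<T> S" "m' \<in> cr_boundary \<T> S" for m m'
    using D(2)[OF that] real_sqrt_le_mono[of "(u m - u m')\<^sup>2" D] by (simp add: \<delta>_def)
  have ua: "\<bar>u m - boundary_average \<T> S u\<bar> \<le> \<delta>" if "m \<in> cr_boundary \<T> S" for m
    by (rule average_deviation[where u = u, OF that ud[OF that]])
  have wd: "\<bar>w m - w m'\<bar> \<le> \<delta>" if K: "K \<in> F" "m \<in> mids {K}" "m' \<in> mids {K}" for K m m'
    using mid_cases[OF K(1,2)] mid_cases[OF K(1,3)]
  proof (elim disjE)
    assume "m \<in> cr_boundary \<T> S" "m' \<in> cr_boundary \<T> S" then show ?thesis using w(2) ud by simp
  next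
    assume "m \<in> cr_boundary \<T> S" "m' \<in> cr_interior \<T> S" then show ?thesis using w(2,3) ua by simp
  next
    assume "m \<in> cr_interior \<T> S" "m' \<in> cr_boundary \<T> S"
    then show ?thesis using w(2,3) ua[of m'] by (simp add: abs_minus_commute)
  next
    assume "m \<in> cr_interior \<T> S" "m' \<in> cr_interior \<T> S" then show ?thesis using w(3) \<delta> by simp
  qed
  have one: "a K * (norm (cr_grad w K))\<^sup>2 \<le> 4 * b * \<sigma> ^ 4 * D" if K: "K \<in> layer" for K
  proof -
    have KF: "K \<in> F" using K by simp
    have "norm (cr_grad w K) * h \<le> \<sigma>\<^sup>2 * \<delta>" by (rule gradient_inverse_estimate[OF w(1) KF wd[OF KF]])
    then have "(norm (cr_grad w K) * h)\<^sup>2 \<le> (\<sigma>\<^sup>2 * \<delta>)\<^sup>2" using h_pos by (intro power_mono) auto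
    then have g: "(norm (cr_grad w K))\<^sup>2 * h\<^sup>2 \<le> \<sigma> ^ 4 * D"
      using \<delta>(2) by (simp add: power_mult_distrib flip: power_mult)
    have "a K \<le> b * (4 * h\<^sup>2)"
      using a(1)[OF K] mult_left_mono[OF measure_tri_bounds(2)[OF KF] a(2)] by linarith
    then have "a K * (norm (cr_grad w K))\<^sup>2 \<le> b * (4 * h\<^sup>2) * (norm (cr_grad w K))\<^sup>2"
      by (rule mult_right_mono) simp
    also have "\<dots> = 4 * b * ((norm (cr_grad w K))\<^sup>2 * h\<^sup>2)" by simp
    also have "\<dots> \<le> 4 * b * (\<sigma> ^ 4 * D)" using g a(2) by (intro mult_left_mono) auto
    finally show ?thesis by simp
  qed
  have "(\<Sum>K\<in>F. a K * (norm (cr_grad w K))\<^sup>2) = (\<Sum>K\<in>layer. a K * (norm (cr_grad w K))\<^sup>2)"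
    using zero by (intro sum.mono_neutral_right finite_mesh_on) auto
  also have "\<dots> \<le> (\<Sum>K\<in>layer. 4 * b * \<sigma> ^ 4 * D)" by (rule sum_mono) (rule one)
  also have "\<dots> = real (card layer) * (4 * b * \<sigma> ^ 4 * D)" by simp
  also have "\<dots> \<le> C_ring * (H / h) * (4 * b * \<sigma> ^ 4 * D)"
    using a(2) D(1) by (intro mult_right_mono card_layer) auto
  finally show ?thesis .
qed

lemma energy_le_weighted:
  assumes G: "G \<subseteq> F" and l: "l > 0" and a: "\<And>K. K \<in> G \<Longrightarrow> l * measure lebesgue K \<le> a K"
  shows "energy u G \<le> \<sigma>\<^sup>2 / (3 * l) * (\<Sum>K\<in>G. a K * (norm (cr_grad u K))\<^sup>2)"
  unfolding sum_distrib_left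
proof (rule sum_mono)
  fix K assume K: "K \<in> G"
  have "l * (3 * (h / \<sigma>)\<^sup>2) \<le> a K"
    using a[OF K] mult_left_mono[OF measure_tri_bounds(1)[OF subsetD[OF G K]] less_imp_le[OF l]] by linarith
  then have "h\<^sup>2 \<le> \<sigma>\<^sup>2 / (3 * l) * a K" using l \<sigma> by (simp add: power_divide field_simps)
  from mult_right_mono[OF this, of "(norm (cr_grad u K))\<^sup>2"]
  show "(norm (cr_grad u K))\<^sup>2 * h\<^sup>2 \<le> \<sigma>\<^sup>2 / (3 * l) * (a K * (norm (cr_grad u K))\<^sup>2)"
    by (simp add: mult_ac)
qed

abbreviation "C_layer \<equiv> layer_const \<sigma>"

lemma C_layer_pos: "C_layer > 0"
  using \<sigma> by (rule layer_const_pos)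

text \<open>The weight is bounded from above for the energy of \<open>w\<close> and from below for
  that of \<open>u\<close>. Both happen inside the layer, and so only the contrast there
  appears.\<close>

lemma interpolant_layer_bound:
  assumes u: "u \<in> CR \<Omega> \<T>"
    and w: "w \<in> CR \<Omega> \<T>" "\<And>x. x \<in> cr_boundary \<T> S \<Longrightarrow> w x = u x"
      "\<And>x. x \<in> cr_interior \<T> S \<Longrightarrow> w x = boundary_average \<T> S u"
    and a: "\<And>K. K \<in> layer \<Longrightarrow> l * measure lebesgue K \<le> a K \<and> a K \<le> b * measure lebesgue K"
    and l: "l > 0" "l \<le> b" and a0: "\<And>K. K \<in> F \<Longrightarrow> 0 \<le> a K"
  shows "(\<Sum>K\<in>F. a K * (norm (cr_grad w K))\<^sup>2) \<le> C_layer * (b / l * (H\<^sup>2 / h\<^sup>2)) * (\<Sum>K\<in>F. a K * (norm (cr_grad u K))\<^sup>2)"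
proof -
  let ?E = "\<Sum>K\<in>F. a K * (norm (cr_grad u K))\<^sup>2"
  have "energy u layer \<le> \<sigma>\<^sup>2 / (3 * l) * (\<Sum>K\<in>layer. a K * (norm (cr_grad u K))\<^sup>2)"
    by (rule energy_le_weighted) (use a l in auto)
  also have "\<dots> \<le> \<sigma>\<^sup>2 / (3 * l) * ?E"
    using a0 l by (intro mult_left_mono sum_mono2 finite_mesh_on) auto
  finally have e: "energy u layer \<le> \<sigma>\<^sup>2 / (3 * l) * ?E" .
  have cr: "C_ring * (H / h) \<ge> 0" using C_ring_pos H_pos h_pos by simp
  have e0: "energy u layer \<ge> 0" by (simp add: sum_nonneg)
  have "(\<Sum>K\<in>F. a K * (norm (cr_grad w K))\<^sup>2) \<le> C_ring * (H / h) * (4 * b * \<sigma> ^ 4 * (C_ring * (H / h) * energy u layer))"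
    by (rule interpolant_energy[OF w mult_nonneg_nonneg[OF cr e0] boundary_oscillation[OF u]])
      (use a a0 l in auto)
  also have "\<dots> \<le> C_ring * (H / h) * (4 * b * \<sigma> ^ 4 * (C_ring * (H / h) * (\<sigma>\<^sup>2 / (3 * l) * ?E)))"
    using e cr l by (intro mult_left_mono) auto
  also have "\<dots> = C_layer * (b / l * (H\<^sup>2 / h\<^sup>2)) * ?E"
    by (simp add: layer_const_def power2_eq_square eval_nat_numeral mult_ac)
  finally show ?thesis .
qed

text \<open>Unlike the bound by \<open>(H/h)\<^sup>2\<close>, this one is \<open>o(h\<^sup>-\<^sup>2)\<close>: the quadratic term carries the
  factor \<open>1/q\<close>, and \<open>q\<close> is arbitrary.\<close>

lemma interpolant_ring_bound:
  assumes u: "u \<in> CR \<Omega> \<T>"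
    and w: "w \<in> CR \<Omega> \<T>" "\<And>x. x \<in> cr_boundary \<T> S \<Longrightarrow> w x = u x"
      "\<And>x. x \<in> cr_interior \<T> S \<Longrightarrow> w x = boundary_average \<T> S u"
    and a: "\<And>K. K \<in> F \<Longrightarrow> measure lebesgue K \<le> a K \<and> a K \<le> b * measure lebesgue K"
    and b: "1 \<le> b" and q: "q \<ge> 1"
  shows "(\<Sum>K\<in>F. a K * (norm (cr_grad w K))\<^sup>2) \<le>
    b * (8 * C_ring * \<sigma> ^ 6 * C_radial q * (H / h) + 4 * C_ring\<^sup>2 * \<sigma> ^ 6 * (H / h)\<^sup>2 / real q + C_layer * (3 * \<sigma> * real q)\<^sup>2)
     * (\<Sum>K\<in>F. a K * (norm (cr_grad u K))\<^sup>2)"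
proof -
  let ?E = "\<Sum>K\<in>F. a K * (norm (cr_grad u K))\<^sup>2"
  define X where "X = 8 * C_ring * \<sigma> ^ 6 * C_radial q * (H / h) + 4 * C_ring\<^sup>2 * \<sigma> ^ 6 * (H / h)\<^sup>2 / real q"
  define Y where "Y = C_layer * (3 * \<sigma> * real q)\<^sup>2"
  have a0: "0 \<le> a K" if "K \<in> F" for K using a[OF that] measure_nonneg order_trans by blast
  have E0: "?E \<ge> 0" using a0 by (intro sum_nonneg) auto
  have Cr: "C_radial q \<ge> 0" by (rule radial_const_nonneg)
  have Hh: "H / h > 0" using H_pos h_pos by simp
  have X0: "X \<ge> 0" using Cr Hh C_ring_pos \<sigma> H_pos h_pos by (simp add: X_def)
  have Y0: "Y \<ge> 0" using C_layer_pos by (simp add: Y_def)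
  have "(\<Sum>K\<in>F. a K * (norm (cr_grad w K))\<^sup>2) \<le> b * (X + Y) * ?E"
  proof (cases "real q * (3 * \<sigma> * h) \<le> H")
    case True
    define D where "D = 6 * C_radial q + 3 * C_ring * (H / h) / real q"
    have D0: "D \<ge> 0" using Cr C_ring_pos H_pos h_pos by (simp add: D_def)
    have e: "energy u F \<le> \<sigma>\<^sup>2 / (3 * 1) * ?E"
      by (rule energy_le_weighted) (use a in auto)
    have e0: "energy u F \<ge> 0" by (simp add: sum_nonneg)
    have cr: "C_ring * (H / h) \<ge> 0" using C_ring_pos H_pos h_pos by simp
    have "(\<Sum>K\<in>F. a K * (norm (cr_grad w K))\<^sup>2) \<le> C_ring * (H / h) * (4 * b * \<sigma> ^ 4 * (D * energy u F))"
      unfolding D_def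
      by (rule interpolant_energy[OF w _ boundary_oscillation_rings[OF u _ _ q True]])
        (use a a0 b mult_nonneg_nonneg[OF D0 e0] in \<open>auto simp: D_def\<close>)
    also have "\<dots> \<le> C_ring * (H / h) * (4 * b * \<sigma> ^ 4 * (D * (\<sigma>\<^sup>2 / (3 * 1) * ?E)))"
      using e cr b D0 by (intro mult_left_mono) auto
    also have "\<dots> = b * X * ?E"
    proof -
      have "C_ring * (H / h) * (4 * b * \<sigma> ^ 4 * (D * (\<sigma>\<^sup>2 / (3 * 1)))) = b * X"
        by (simp add: D_def X_def power2_eq_square eval_nat_numeral algebra_simps add_divide_distrib)
      then show ?thesis by (simp only: mult.assoc[symmetric])
    qed
    also have "\<dots> \<le> b * (X + Y) * ?E" using Y0 b E0 by (intro mult_right_mono mult_left_mono) auto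
    finally show ?thesis .
  next
    case False
    \<comment> \<open>The \<open>q\<close> rings do not fit, so H/h is below 3 \<sigma> q and the
      layer bound, taken with lower weight 1, costs only the term in q^2.\<close>
    have "(H / h)\<^sup>2 \<le> (3 * \<sigma> * real q)\<^sup>2"
      using False Hh h_pos by (intro power_mono) (auto simp: field_simps)
    then have "(C_layer * b) * (H / h)\<^sup>2 \<le> (C_layer * b) * (3 * \<sigma> * real q)\<^sup>2"
      using C_layer_pos b by (intro mult_left_mono) auto
    then have HY: "C_layer * (b / 1 * (H\<^sup>2 / h\<^sup>2)) \<le> b * Y"
      by (simp add: Y_def power_divide mult_ac)
    have "(\<Sum>K\<in>F. a K * (norm (cr_grad w K))\<^sup>2) \<le> C_layer * (b / 1 * (H\<^sup>2 / h\<^sup>2)) * ?E"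
      by (rule interpolant_layer_bound[OF u w]) (use a a0 b in auto)
    also have "\<dots> \<le> b * Y * ?E" by (rule mult_right_mono[OF HY E0])
    also have "\<dots> \<le> b * (X + Y) * ?E" using X0 b E0 by (intro mult_right_mono mult_left_mono) auto
    finally show ?thesis .
  qed
  then show ?thesis by (simp add: X_def Y_def)
qed

end


section \<open>Variational problems and the two-subspace Schwarz estimate\<close>

definition lincomb :: "real \<Rightarrow> ('a \<Rightarrow> real) \<Rightarrow> real \<Rightarrow> ('a \<Rightarrow> real) \<Rightarrow> 'a \<Rightarrow> real" where
  "lincomb s u t w = (\<lambda>x. s * u x + t * w x)"

definition function_subspace :: "('a \<Rightarrow> real) set \<Rightarrow> bool" where
  "function_subspace V \<longleftrightarrow> (\<lambda>x. 0) \<in> V \<and> (\<forall>u\<in>V. \<forall>w\<in>V. \<forall>s t. lincomb s u t w \<in> V)"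

definition linear_form_on :: "('a \<Rightarrow> real) set \<Rightarrow> (('a \<Rightarrow> real) \<Rightarrow> real) \<Rightarrow> bool" where
  "linear_form_on V \<phi> \<longleftrightarrow> (\<forall>u\<in>V. \<forall>w\<in>V. \<forall>s t. \<phi> (lincomb s u t w) = s * \<phi> u + t * \<phi> w)"

definition bilinear_form_on :: "('a \<Rightarrow> real) set \<Rightarrow> (('a \<Rightarrow> real) \<Rightarrow> ('a \<Rightarrow> real) \<Rightarrow> real) \<Rightarrow> bool" where
  "bilinear_form_on V B \<longleftrightarrow> (\<forall>v\<in>V. linear_form_on V (B v) \<and> linear_form_on V (\<lambda>u. B u v))"

lemma bilinear_form_onD:
  assumes "bilinear_form_on V B" "u \<in> V" "w \<in> V" "v \<in> V"
  shows "B (lincomb s u t w) v = s * B u v + t * B w v" "B v (lincomb s u t w) = s * B v u + t * B v w"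
  using assms unfolding bilinear_form_on_def linear_form_on_def by blast+

lemma linear_form_on_subset: "linear_form_on V \<phi> \<Longrightarrow> U \<subseteq> V \<Longrightarrow> linear_form_on U \<phi>"
  unfolding linear_form_on_def by blast

lemma bilinear_form_on_subset: "bilinear_form_on V B \<Longrightarrow> U \<subseteq> V \<Longrightarrow> bilinear_form_on U B"
  unfolding bilinear_form_on_def linear_form_on_def by blast

lemma function_subspaceD: "function_subspace V \<Longrightarrow> u \<in> V \<Longrightarrow> w \<in> V \<Longrightarrow> lincomb s u t w \<in> V"
  unfolding function_subspace_def by blast

text \<open>Induction on the finite set of points that determines the elements of \<open>V\<close>: the elements
  vanishing at one of the points form a subspace of codimension at most one.\<close>

lemma lax_milgram_ex:
  assumes "finite P" "function_subspace V" "\<And>v. v \<in> V \<Longrightarrow> (\<And>x. x \<in> P \<Longrightarrow> v x = 0) \<Longrightarrow> v = (\<lambda>x. 0)"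
    and "bilinear_form_on V B" "\<And>v. v \<in> V \<Longrightarrow> v \<noteq> (\<lambda>x. 0) \<Longrightarrow> B v v > 0" "linear_form_on V \<phi>"
  shows "\<exists>w\<in>V. \<forall>v\<in>V. B w v = \<phi> v"
  using assms
proof (induction P arbitrary: V \<phi>)
  case empty
  have 0: "v = (\<lambda>x. 0)" if "v \<in> V" for v using empty that by simp
  have z: "(\<lambda>x. 0) \<in> V" using empty by (simp add: function_subspace_def)
  have lz: "lincomb 0 (\<lambda>x. 0) 0 (\<lambda>x. 0) = (\<lambda>x. 0 :: real)" by (simp add: lincomb_def)
  have "B (lincomb 0 (\<lambda>x. 0) 0 (\<lambda>x. 0)) (\<lambda>x. 0) = 0 * B (\<lambda>x. 0) (\<lambda>x. 0) + 0 * B (\<lambda>x. 0) (\<lambda>x. 0)"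
    by (rule bilinear_form_onD(1)[OF empty(3) z z z])
  moreover have "\<phi> (lincomb 0 (\<lambda>x. 0) 0 (\<lambda>x. 0)) = 0 * \<phi> (\<lambda>x. 0) + 0 * \<phi> (\<lambda>x. 0)"
    using empty(5) z unfolding linear_form_on_def by blast
  ultimately have "B (\<lambda>x. 0) (\<lambda>x. 0) = \<phi> (\<lambda>x. 0)" unfolding lz by simp
  then show ?case using 0 z by metis
next
  case (insert f P)
  define U where "U = {v \<in> V. v f = 0}"
  have UV: "U \<subseteq> V" by (auto simp: U_def)
  have U: "function_subspace U"
    using insert.prems(1) by (auto simp: function_subspace_def U_def lincomb_def)
  have det: "v = (\<lambda>x. 0)" if "v \<in> U" "\<And>x. x \<in> P \<Longrightarrow> v x = 0" for v
    using insert.prems(2)[of v] that by (auto simp: U_def)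
  have pos: "B v v > 0" if "v \<in> U" "v \<noteq> (\<lambda>x. 0)" for v using insert.prems(4) that UV by blast
  have solve: "\<exists>w\<in>U. \<forall>v\<in>U. B w v = \<psi> v" if "linear_form_on U \<psi>" for \<psi>
    by (rule insert.IH[OF U det bilinear_form_on_subset[OF insert.prems(3) UV] pos that])
  show ?case
  proof (cases "\<exists>b\<in>V. b f \<noteq> 0")
    case False
    then have "U = V" by (auto simp: U_def)
    then show ?thesis using solve insert.prems(5) by blast
  next
    case True
    then obtain b where b: "b \<in> V" "b f \<noteq> 0" by blast
    obtain w' where w': "w' \<in> U" "\<And>v. v \<in> U \<Longrightarrow> B w' v = \<phi> v"
      using solve linear_form_on_subset[OF insert.prems(5) UV] by blast
    have "linear_form_on U (B b)"
      using insert.prems(3) b(1) linear_form_on_subset UV unfolding bilinear_form_on_def by blast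
    then obtain p where p: "p \<in> U" "\<And>v. v \<in> U \<Longrightarrow> B p v = B b v" using solve by blast
    \<comment> \<open>\<open>b\<close> corrected by an element of \<open>U\<close> so that B(q, .)
      vanishes on \<open>U\<close>. Only this side is orthogonal, as \<open>B\<close> may be
      nonsymmetric.\<close>
    define q where "q = lincomb 1 b (-1) p"
    have in_V: "w' \<in> V" "p \<in> V" using w' p UV by auto
    have q: "q \<in> V" using insert.prems(1) b in_V by (auto simp: q_def intro: function_subspaceD)
    have "q f \<noteq> 0" using b p(1) by (simp add: q_def lincomb_def U_def)
    then have qq: "B q q > 0" using insert.prems(4)[OF q] by (metis (full_types))
    have qU: "B q v = 0" if "v \<in> U" for v
      using bilinear_form_onD(1)[OF insert.prems(3) b(1) in_V(2), of v 1 "-1"] that UV p(2)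
      by (auto simp: q_def)
    have "B q q = B q b"
      using bilinear_form_onD(2)[OF insert.prems(3) b(1) in_V(2) q, of 1 "-1"] qU[OF p(1)] by (simp add: q_def)
    then have qb: "B q b > 0" using qq by simp
    \<comment> \<open>Determined by the equation for the single remaining test function
      \<open>b\<close>; the equations on \<open>U\<close> hold for any \<open>t\<close>.\<close>
    define t where "t = (\<phi> b - B w' b) / B q b"
    define w where "w = lincomb 1 w' t q"
    have w: "w \<in> V" using insert.prems(1) in_V q by (auto simp: w_def intro: function_subspaceD)
    have "B w v = \<phi> v" if v: "v \<in> V" for v
    proof -
      define s where "s = v f / b f"
      define v0 where "v0 = lincomb 1 v (- s) b"
      have v0V: "v0 \<in> V" using insert.prems(1) v b by (auto simp: v0_def intro: function_subspaceD)
      then have v0: "v0 \<in> U" using b by (simp add: U_def v0_def lincomb_def s_def)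
      have veq: "v = lincomb 1 v0 s b" by (simp add: v0_def lincomb_def)
      have "B w v = B w' v + t * B q v"
        using bilinear_form_onD(1)[OF insert.prems(3) in_V(1) q v, of 1 t] by (simp add: w_def)
      also have "B w' v = B w' v0 + s * B w' b"
        using bilinear_form_onD(2)[OF insert.prems(3) v0V b(1) in_V(1), of 1 s] veq by simp
      also have "B q v = s * B q b"
        using bilinear_form_onD(2)[OF insert.prems(3) v0V b(1) q, of 1 s] veq qU[OF v0] by simp
      also have "B w' v0 + s * B w' b + t * (s * B q b) = \<phi> v0 + s * \<phi> b"
      proof -
        have tq: "t * B q b = \<phi> b - B w' b" using qb by (simp add: t_def)
        have "t * (s * B q b) = s * (\<phi> b - B w' b)" unfolding tq[symmetric] by simp
        then show ?thesis using w'(2)[OF v0] by (simp add: algebra_simps)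
      qed
      also have "\<dots> = \<phi> v"
        using insert.prems(5) v0V b(1) veq unfolding linear_form_on_def by (metis mult_1)
      finally show ?thesis .
    qed
    then show ?thesis using w by blast
  qed
qed

lemma lax_milgram:
  assumes "finite P" "function_subspace V" "\<And>v. v \<in> V \<Longrightarrow> (\<And>x. x \<in> P \<Longrightarrow> v x = 0) \<Longrightarrow> v = (\<lambda>x. 0)"
    and B: "bilinear_form_on V B" and pos: "\<And>v. v \<in> V \<Longrightarrow> v \<noteq> (\<lambda>x. 0) \<Longrightarrow> B v v > 0" and "linear_form_on V \<phi>"
  shows "\<exists>!w. w \<in> V \<and> (\<forall>v\<in>V. B w v = \<phi> v)"
proof (rule ex_ex1I)
  show "\<exists>w. w \<in> V \<and> (\<forall>v\<in>V. B w v = \<phi> v)" using lax_milgram_ex[OF assms] by blast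
  fix w w' assume w: "w \<in> V \<and> (\<forall>v\<in>V. B w v = \<phi> v)" "w' \<in> V \<and> (\<forall>v\<in>V. B w' v = \<phi> v)"
  define d where "d = lincomb 1 w (-1) w'"
  have d: "d \<in> V" unfolding d_def using assms(2) w by (auto intro: function_subspaceD)
  have "B d d = B w d - B w' d"
    using bilinear_form_onD(1)[OF B, of w w' d 1 "-1"] w d by (simp add: d_def)
  also have "\<dots> = 0" using w d by simp
  finally have "d = (\<lambda>x. 0)" using pos[OF d] by force
  then show "w = w'" by (auto simp: d_def lincomb_def fun_eq_iff)
qed

section \<open>The abstract estimate for two subspaces\<close>

locale form_space =
  fixes V :: "('a \<Rightarrow> real) set" and a :: "('a \<Rightarrow> real) \<Rightarrow> ('a \<Rightarrow> real) \<Rightarrow> real"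
  assumes V: "function_subspace V" and bil: "bilinear_form_on V a"
    and sym: "\<And>u v. u \<in> V \<Longrightarrow> v \<in> V \<Longrightarrow> a u v = a v u"
    and nonneg: "\<And>u. u \<in> V \<Longrightarrow> a u u \<ge> 0"
begin

definition nrm :: "('a \<Rightarrow> real) \<Rightarrow> real" where "nrm u = sqrt (a u u)"

lemma nrm_nonneg: "u \<in> V \<Longrightarrow> nrm u \<ge> 0"
  by (simp add: nrm_def nonneg)

lemma nrm_sq: "u \<in> V \<Longrightarrow> (nrm u)\<^sup>2 = a u u"
  by (simp add: nrm_def nonneg)

lemma quadratic: "u \<in> V \<Longrightarrow> v \<in> V \<Longrightarrow>
    a (lincomb s u t v) (lincomb s u t v) = s\<^sup>2 * a u u + 2 * s * t * a u v + t\<^sup>2 * a v v"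
  using bilinear_form_onD[OF bil] function_subspaceD[OF V] sym[of v u]
  by (simp add: power2_eq_square algebra_simps)

lemma cauchy_schwarz:
  assumes "u \<in> V" "v \<in> V" shows "\<bar>a u v\<bar> \<le> nrm u * nrm v"
proof -
  have q: "0 \<le> s\<^sup>2 * a u u + 2 * s * t * a u v + t\<^sup>2 * a v v" for s t
    using quadratic[OF assms] nonneg[OF function_subspaceD[OF V assms]] by metis
  have "(a u v)\<^sup>2 \<le> a u u * a v v"
  proof (cases "a v v = 0")
    case True
    have "a u v = 0"
    proof (rule ccontr)
      assume nz: "a u v \<noteq> 0"
      \<comment> \<open>If \<open>a v v\<close> vanishes, the quadratic is affine in
        \<open>t\<close>, and this choice would make its value -1.\<close>
      have "2 * (- (a u u + 1) / (2 * a u v)) * a u v = - (a u u + 1)" using nz by (simp add: field_simps)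
      then show False using q[of 1 "- (a u u + 1) / (2 * a u v)"] True by simp
    qed
    then show ?thesis using True by simp
  next
    case False
    then have pos: "a v v > 0" using nonneg[OF assms(2)] by simp
    have "0 \<le> a v v * (a u u * a v v - (a u v)\<^sup>2)"
      using q[of "a v v" "- a u v"] by (simp add: power2_eq_square algebra_simps)
    then show ?thesis using pos by (simp add: zero_le_mult_iff)
  qed
  then have "sqrt ((a u v)\<^sup>2) \<le> sqrt (a u u * a v v)" by (rule real_sqrt_le_mono)
  then show ?thesis by (simp add: nrm_def real_sqrt_mult)
qed

lemma nrm_sum:
  assumes "u \<in> V" "v \<in> V" shows "nrm (lincomb 1 u t v) \<le> nrm u + \<bar>t\<bar> * nrm v"
proof -
  have "(nrm (lincomb 1 u t v))\<^sup>2 = (nrm u)\<^sup>2 + 2 * t * a u v + t\<^sup>2 * (nrm v)\<^sup>2"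
    using quadratic[OF assms, of 1 t] function_subspaceD[OF V assms] by (simp add: nrm_sq assms)
  also have "2 * t * a u v \<le> 2 * \<bar>t\<bar> * (nrm u * nrm v)"
  proof -
    have "t * a u v \<le> \<bar>t\<bar> * \<bar>a u v\<bar>" by (metis abs_ge_self abs_mult)
    also have "\<dots> \<le> \<bar>t\<bar> * (nrm u * nrm v)" using cauchy_schwarz[OF assms] by (intro mult_left_mono) auto
    finally show ?thesis by simp
  qed
  finally have "(nrm (lincomb 1 u t v))\<^sup>2 \<le> (nrm u + \<bar>t\<bar> * nrm v)\<^sup>2"
    by (simp add: power2_eq_square algebra_simps)
  then show ?thesis
    by (rule power2_le_imp_le) (use nrm_nonneg[OF assms(1)] nrm_nonneg[OF assms(2)] in simp)
qed

text \<open>\<open>B\<close> is the perturbed form, and \<open>X\<close> the form defining the operators, either \<open>a\<close> or \<open>B\<close>.  The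
  hypothesis on \<open>Q'\<close> absorbs the cross term, which is only linear in \<open>S\<close> and which the possibly
  much larger constant \<open>Q\<close> could not control.\<close>

theorem schwarz_two_subspaces:
  assumes sub: "u \<in> V" "u0 \<in> V0" "w \<in> W" "V0 \<subseteq> V" "W \<subseteq> V" and u: "u = lincomb 1 u0 1 w"
    and t: "t0 \<in> V0" "tW \<in> W" "\<And>v. v \<in> V0 \<Longrightarrow> X t0 v = B u v" "\<And>v. v \<in> W \<Longrightarrow> X tW v = B u v"
    and B: "bilinear_form_on V B"
    and Ba: "\<And>u v. u \<in> V \<Longrightarrow> v \<in> V \<Longrightarrow> \<bar>B u v - a u v\<bar> \<le> \<theta> * nrm u * nrm v"
    and Xa: "\<And>u v. u \<in> V \<Longrightarrow> v \<in> V \<Longrightarrow> \<bar>X u v - a u v\<bar> \<le> \<theta> * nrm u * nrm v"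
    and \<theta>: "0 \<le> \<theta>" "\<theta> \<le> 1/8"
    and Q: "Q \<ge> 0" "(nrm u0)\<^sup>2 \<le> Q * (nrm u)\<^sup>2"
    and Q': "(nrm u0)\<^sup>2 \<le> Q' * (nrm u)\<^sup>2" "32 * \<theta>\<^sup>2 * (3 * Q' + 2) \<le> 1"
  defines "T \<equiv> lincomb 1 t0 1 tW"
  shows "nrm T \<le> 4 * nrm u" "a T u \<ge> (nrm u)\<^sup>2 / (4 * (3 * Q + 2))"
proof -
  have in_V: "u0 \<in> V" "w \<in> V" "t0 \<in> V" "tW \<in> V" using sub t by auto
  note nn = nrm_nonneg[OF sub(1)] nrm_nonneg[OF in_V(1)] nrm_nonneg[OF in_V(2)] nrm_nonneg[OF in_V(3)] nrm_nonneg[OF in_V(4)]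
  have Bup: "\<bar>B v v'\<bar> \<le> (1 + \<theta>) * (nrm v * nrm v')" if "v \<in> V" "v' \<in> V" for v v'
    using Ba[OF that] cauchy_schwarz[OF that] by (simp add: algebra_simps)
  have Xup: "\<bar>X v v'\<bar> \<le> (1 + \<theta>) * (nrm v * nrm v')" if "v \<in> V" "v' \<in> V" for v v'
    using Xa[OF that] cauchy_schwarz[OF that] by (simp add: algebra_simps)
  have Xlo: "X v v \<ge> (1 - \<theta>) * (nrm v)\<^sup>2" if "v \<in> V" for v
    using Xa[OF that that] nrm_sq[OF that] by (simp add: power2_eq_square algebra_simps)
  \<comment> \<open>Coercivity 7/8 against continuity 9/8 leaves a ratio below 2; adding the two
    components gives the 4 in the upper bound.\<close>
  have bound: "nrm v \<le> 2 * nrm u" if v: "v \<in> V" "X v v = B u v" for v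
  proof -
    have nv: "nrm v \<ge> 0" by (rule nrm_nonneg[OF v(1)])
    have "(7/8) * (nrm v)\<^sup>2 \<le> (1 - \<theta>) * (nrm v)\<^sup>2" using \<theta> by (intro mult_right_mono) auto
    also have "\<dots> \<le> (1 + \<theta>) * (nrm u * nrm v)" using Xlo[OF v(1)] Bup[OF sub(1) v(1)] v(2) by linarith
    also have "\<dots> \<le> (9/8) * (nrm u * nrm v)" using \<theta> nn nv by (intro mult_right_mono) auto
    finally have "(7/8) * (nrm v)\<^sup>2 \<le> (9/8) * (nrm u * nrm v)" .
    moreover have "0 \<le> nrm u * nrm v" using nn nv by simp
    ultimately have "(nrm v)\<^sup>2 \<le> 2 * (nrm u * nrm v)" by linarith
    then have le: "nrm v * nrm v \<le> (2 * nrm u) * nrm v" by (simp add: power2_eq_square)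
    show ?thesis
    proof (cases "nrm v = 0")
      case False
      then show ?thesis using le nv mult_right_le_imp_le[of "nrm v" "nrm v" "2 * nrm u"] by simp
    qed (use nn in simp)
  qed
  have "nrm t0 \<le> 2 * nrm u" "nrm tW \<le> 2 * nrm u" using bound in_V t by auto
  then show "nrm T \<le> 4 * nrm u" using nrm_sum[OF in_V(3,4), of 1] by (simp add: T_def)
  define S where "S = sqrt ((nrm t0)\<^sup>2 + (nrm tW)\<^sup>2)"
  have S: "S \<ge> 0" "S\<^sup>2 = (nrm t0)\<^sup>2 + (nrm tW)\<^sup>2" by (simp_all add: S_def)
  \<comment> \<open>Proved for arbitrary \<open>R\<close>, since it is used twice: with
    \<open>Q'\<close> to absorb the cross term, and with \<open>Q\<close> for the final
    bound.\<close>
  have lower: "(nrm u)\<^sup>2 \<le> 2 * (3 * R + 2) * S\<^sup>2" if R: "(nrm u0)\<^sup>2 \<le> R * (nrm u)\<^sup>2" for R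
  proof (cases "nrm u = 0")
    case False
    then have nu: "nrm u > 0" using nn by simp
    have "w = lincomb 1 u (-1) u0" by (simp add: u lincomb_def)
    then have "nrm w \<le> nrm u + nrm u0" using nrm_sum[OF sub(1) in_V(1), of "-1"] by simp
    then have "(nrm w)\<^sup>2 \<le> (nrm u + nrm u0)\<^sup>2" using nn by (intro power_mono) auto
    also have "\<dots> \<le> 2 * (nrm u)\<^sup>2 + 2 * (nrm u0)\<^sup>2"
      using sum_squares_bound[of "nrm u" "nrm u0"] by (simp add: power2_eq_square algebra_simps)
    \<comment> \<open>The source of 3R + 2: the norm of w = u - u0 contributes 2 + 2R, and that of
      \<open>u0\<close> another R.\<close>
    finally have uw: "(nrm u0)\<^sup>2 + (nrm w)\<^sup>2 \<le> (3 * R + 2) * (nrm u)\<^sup>2" using R by (simp add: algebra_simps)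
    have "B u u = B u u0 + B u w"
      using bilinear_form_onD(2)[OF B in_V(1,2) sub(1), of 1 1] u by simp
    then have "B u u = X t0 u0 + X tW w" using t(3)[OF sub(2)] t(4)[OF sub(3)] by simp
    also have "\<dots> \<le> (1 + \<theta>) * (nrm t0 * nrm u0) + (1 + \<theta>) * (nrm tW * nrm w)"
      using Xup[OF in_V(3,1)] Xup[OF in_V(4,2)] by linarith
    finally have Buu: "B u u \<le> (1 + \<theta>) * (nrm t0 * nrm u0 + nrm tW * nrm w)" by (simp add: algebra_simps)
    have "(7/8) * (nrm u)\<^sup>2 \<le> (1 - \<theta>) * (nrm u)\<^sup>2" using \<theta> by (intro mult_right_mono) auto
    also have "\<dots> \<le> B u u" using Ba[OF sub(1,1)] nrm_sq[OF sub(1)] by (simp add: power2_eq_square algebra_simps)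
    also have "\<dots> \<le> (1 + \<theta>) * (nrm t0 * nrm u0 + nrm tW * nrm w)" by (rule Buu)
    also have "\<dots> \<le> (9/8) * (nrm t0 * nrm u0 + nrm tW * nrm w)" using \<theta> nn by (intro mult_right_mono) auto
    finally have "(7/8) * (nrm u)\<^sup>2 \<le> (9/8) * (nrm t0 * nrm u0 + nrm tW * nrm w)" .
    moreover have "7/9 * x \<le> p" if "7/8 * x \<le> 9/8 * p" for x p :: real using that by linarith
    ultimately have main: "(7/9) * (nrm u)\<^sup>2 \<le> nrm t0 * nrm u0 + nrm tW * nrm w" by blast
    have "((7/9) * (nrm u)\<^sup>2)\<^sup>2 \<le> (nrm t0 * nrm u0 + nrm tW * nrm w)\<^sup>2"
      using main by (intro power_mono) auto
    also have "\<dots> \<le> ((nrm t0)\<^sup>2 + (nrm tW)\<^sup>2) * ((nrm u0)\<^sup>2 + (nrm w)\<^sup>2)"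
      using zero_le_power2[of "nrm t0 * nrm w - nrm tW * nrm u0"] by (simp add: power2_eq_square algebra_simps)
    also have "\<dots> \<le> S\<^sup>2 * ((3 * R + 2) * (nrm u)\<^sup>2)" unfolding S(2) using uw by (intro mult_left_mono) auto
    finally have "(49/81) * (nrm u)\<^sup>2 * (nrm u)\<^sup>2 \<le> (3 * R + 2) * S\<^sup>2 * (nrm u)\<^sup>2"
      by (simp add: power2_eq_square mult_ac)
    \<comment> \<open>As 49/81 exceeds 1/2, dividing by it costs less than the factor 2 in the
      claim.\<close>
    then have "(49/81) * (nrm u)\<^sup>2 \<le> (3 * R + 2) * S\<^sup>2" using nu by (simp add: mult_le_cancel_right)
    moreover have "(nrm u)\<^sup>2 \<ge> 0" by simp
    ultimately show ?thesis by linarith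
  next
    case True
    moreover have "0 \<le> (nrm u0)\<^sup>2 + (nrm w)\<^sup>2" by simp
    ultimately show ?thesis
    proof (cases "R \<ge> 0")
      \<comment> \<open>A negative \<open>R\<close> could make the right-hand side negative, unless
        S = 0; this holds because both components are bounded by the vanishing norm of
        \<open>u\<close>.\<close>
      case neg: False
      then show ?thesis
      proof -
        have "S = 0"
        proof -
          have "nrm t0 \<le> 0" "nrm tW \<le> 0" using \<open>nrm t0 \<le> 2 * nrm u\<close> \<open>nrm tW \<le> 2 * nrm u\<close> True by auto
          then have "nrm t0 = 0" "nrm tW = 0" using nn by auto
          then show ?thesis by (simp add: S_def)
        qed
        then show ?thesis using True by simp
      qed
    qed simp
  qed
  \<comment> \<open>Here the hypothesis on \<open>Q'\<close> turns the perturbation into a quarter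
    of \<open>S\<close>.\<close>
  have "32 * \<theta>\<^sup>2 * (nrm u)\<^sup>2 \<le> 32 * \<theta>\<^sup>2 * (2 * (3 * Q' + 2) * S\<^sup>2)"
    using lower[OF Q'(1)] by (intro mult_left_mono) auto
  also have "\<dots> = (32 * \<theta>\<^sup>2 * (3 * Q' + 2)) * (2 * S\<^sup>2)" by simp
  also have "\<dots> \<le> 1 * (2 * S\<^sup>2)" by (rule mult_right_mono[OF Q'(2)]) simp
  finally have "(4 * (\<theta> * nrm u))\<^sup>2 \<le> S\<^sup>2" by (simp add: power_mult_distrib)
  then have \<theta>S: "4 * (\<theta> * nrm u) \<le> S" using S(1) by (rule power2_le_imp_le)
  have sumS: "nrm t0 + nrm tW \<le> 3/2 * S"
  proof (rule power2_le_imp_le)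
    have "(nrm t0 + nrm tW)\<^sup>2 \<le> 2 * S\<^sup>2"
      unfolding S(2) using sum_squares_bound[of "nrm t0" "nrm tW"] by (simp add: power2_eq_square algebra_simps)
    also have "\<dots> \<le> (3/2 * S)\<^sup>2" by (simp add: power2_eq_square)
    finally show "(nrm t0 + nrm tW)\<^sup>2 \<le> (3/2 * S)\<^sup>2" .
  qed (use S in simp)
  have part: "a v u \<ge> (1 - \<theta>) * (nrm v)\<^sup>2 - \<theta> * nrm u * nrm v" if v: "v \<in> V" "X v v = B u v" for v
    using Ba[OF sub(1) v(1)] Xlo[OF v(1)] v(2) sym[OF v(1) sub(1)] by linarith
  have "a T u = a t0 u + a tW u"
    using bilinear_form_onD(1)[OF bil in_V(3,4) sub(1), of 1 1] by (simp add: T_def)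
  also have "\<dots> \<ge> (1 - \<theta>) * S\<^sup>2 - \<theta> * nrm u * (nrm t0 + nrm tW)"
    unfolding S(2) using part[OF in_V(3)] part[OF in_V(4)] t by (simp add: algebra_simps)
  finally have aT: "a T u \<ge> (1 - \<theta>) * S\<^sup>2 - \<theta> * nrm u * (nrm t0 + nrm tW)" .
  \<comment> \<open>The cross term takes 3/8 of S^2 out of the available 7/8, so half of S^2 is
    left.\<close>
  have "\<theta> * nrm u * (nrm t0 + nrm tW) \<le> (S / 4) * (3/2 * S)"
    using \<theta>S sumS \<theta> nn S by (intro mult_mono) auto
  then have "\<theta> * nrm u * (nrm t0 + nrm tW) \<le> 3/8 * S\<^sup>2" by (simp add: power2_eq_square)
  moreover have "(7/8) * S\<^sup>2 \<le> (1 - \<theta>) * S\<^sup>2" using \<theta> by (intro mult_right_mono) auto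
  ultimately have "a T u \<ge> S\<^sup>2 / 2" using aT by linarith
  moreover have "(nrm u)\<^sup>2 / (4 * (3 * Q + 2)) \<le> S\<^sup>2 / 2"
  proof -
    have *: "x / (4 * y) \<le> s / 2" if "x \<le> 2 * y * s" "y > 0" for x y s :: real
      using that by (simp add: field_simps)
    show ?thesis by (rule *[OF lower[OF Q(2)]]) (use Q(1) in simp)
  qed
  ultimately show "a T u \<ge> (nrm u)\<^sup>2 / (4 * (3 * Q + 2))" by linarith
qed

end


section \<open>The decomposition of the Crouzeix-Raviart space\<close>

lemma linear_form_on_sum:
  fixes V :: "('a \<Rightarrow> real) set"
  assumes V: "function_subspace V" and \<phi>: "linear_form_on V \<phi>" and I: "finite I" and f: "\<And>i. i \<in> I \<Longrightarrow> f i \<in> V"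
  shows "(\<lambda>x. \<Sum>i\<in>I. f i x) \<in> V \<and> \<phi> (\<lambda>x. \<Sum>i\<in>I. f i x) = (\<Sum>i\<in>I. \<phi> (f i))"
  using I f
proof (induction I)
  case empty
  have z: "(\<lambda>x. 0) \<in> V" using V by (simp add: function_subspace_def)
  have "lincomb 0 (\<lambda>x. 0) 0 (\<lambda>x. 0) = (\<lambda>x::'a. 0)" by (simp add: lincomb_def)
  moreover have "\<phi> (lincomb 0 (\<lambda>x. 0) 0 (\<lambda>x. 0)) = 0 * \<phi> (\<lambda>x. 0) + 0 * \<phi> (\<lambda>x. 0)"
    using \<phi> z unfolding linear_form_on_def by blast
  ultimately have "\<phi> (\<lambda>x. 0) = 0" by (simp only: mult_zero_left add_0)
  then show ?case using z by simp
next
  case (insert i I)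
  have eq: "(\<lambda>x. \<Sum>i\<in>insert i I. f i x) = lincomb 1 (f i) 1 (\<lambda>x. \<Sum>i\<in>I. f i x)"
    using insert.hyps by (simp add: lincomb_def fun_eq_iff)
  have IH: "(\<lambda>x. \<Sum>i\<in>I. f i x) \<in> V" "\<phi> (\<lambda>x. \<Sum>i\<in>I. f i x) = (\<Sum>i\<in>I. \<phi> (f i))" "f i \<in> V"
    using insert by auto
  have "\<phi> (lincomb 1 (f i) 1 (\<lambda>x. \<Sum>i\<in>I. f i x)) = 1 * \<phi> (f i) + 1 * \<phi> (\<lambda>x. \<Sum>i\<in>I. f i x)"
    using \<phi> IH unfolding linear_form_on_def by blast
  then show ?case unfolding eq using function_subspaceD[OF V IH(3,1)] IH(2) insert.hyps by simp
qed

section \<open>Linearity of the flux form\<close>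

context triangle_mesh
begin

lemma CR_subspace: "function_subspace (CR \<Omega> \<T>)"
  unfolding function_subspace_def lincomb_def using zero_CR CR_lincomb by blast

lemma cr_grad_lincomb':
  assumes "u \<in> CR \<Omega> \<T>" "w \<in> CR \<Omega> \<T>" "K \<in> \<T>"
  shows "cr_grad (lincomb s u t w) K = s *\<^sub>R cr_grad u K + t *\<^sub>R cr_grad w K"
  unfolding lincomb_def by (rule cr_grad_lincomb[OF assms])

lemma segment_cross_nonzero:
  assumes K: "K \<in> \<T>" and e: "closed_segment x y edge_of K" and z: "z \<in> interior K"
  shows "cross2 (x - z) (y - z) \<noteq> 0"
proof -
  obtain a b c where abc: "K = convex hull {a, b, c}" "triangle a b c"
    "a \<noteq> b" "b \<noteq> c" "a \<noteq> c" "\<not> affine_dependent {a, b, c}"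
    using tri_obtain[OF K] by metis
  obtain w1 w2 w3 :: real where w: "w1 > 0" "w2 > 0" "w3 > 0" "cross2 (a - z) (b - z) = w3 * cross2 (b - a) (c - a)"
      "cross2 (b - z) (c - z) = w1 * cross2 (b - a) (c - a)" "cross2 (c - z) (a - z) = w2 * cross2 (b - a) (c - a)"
    using interior_tri_obtain[OF K abc(1,6,3,4,5) z] .
  have anti: "cross2 p q = - cross2 q p" for p q by (simp add: cross2_def)
  have nz: "cross2 (a - z) (b - z) \<noteq> 0" "cross2 (b - z) (c - z) \<noteq> 0" "cross2 (c - z) (a - z) \<noteq> 0"
    using w abc(2) by (simp_all add: triangle_def)
  have "closed_segment x y = closed_segment a b \<or> closed_segment x y = closed_segment b c \<or> closed_segment x y = closed_segment c a"
    using edge_of_triangle[OF abc(6,3,4,5)] e abc(1) by auto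
  then show ?thesis
    using nz anti[of "b - z" "a - z"] anti[of "c - z" "b - z"] anti[of "a - z" "c - z"]
    unfolding closed_segment_eq by (auto simp: doubleton_eq_iff)
qed

text \<open>On one triangle the flux sees \<open>u\<close> only through its constant gradient, and
  linearly, whatever values the integrals of \<alpha> along the segments have.\<close>

lemma tri_flux_vector:
  assumes K: "K \<in> \<T>" and z: "\<And>K. K \<in> \<T> \<Longrightarrow> z K \<in> interior K"
  shows "\<exists>r. \<forall>u\<in>CR \<Omega> \<T>. tri_flux \<alpha> \<T> z u v K = cr_grad u K \<bullet> r"
proof -
  have "\<exists>r. \<forall>u\<in>CR \<Omega> \<T>. segment_flux (\<lambda>x. \<alpha> x *\<^sub>R grad u x) (control_volume \<T> z e) (z K) a = cr_grad u K \<bullet> r"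
    if e: "e edge_of K" and a: "a extreme_point_of e" for e a
  proof -
    obtain p q where pq: "e = closed_segment p q" using edge_of_obtain[OF simplex2[OF K] e] by metis
    then have "a = p \<or> a = q" using a extreme_point_of_segment by blast
    then obtain b where b: "e = closed_segment a b" using pq closed_segment_commute by metis
    have D: "cross2 (a - z K) (b - z K) \<noteq> 0" using segment_cross_nonzero[OF K _ z[OF K]] e b by blast
    let ?I = "integral {0..1} (\<lambda>t. \<alpha> (linepath (z K) a t))"
    show ?thesis
      using segment_flux_eq[OF K _ z D, where \<beta> = \<alpha> and \<alpha> = \<alpha>] e unfolding b
      by (intro exI[of _ "(- sgn (cross2 (a - z K) (b - z K)) * ?I) *\<^sub>R rot (a - z K)"]) (auto simp: mult_ac)
  qed
  then obtain r where r: "\<And>e a u. e edge_of K \<Longrightarrow> a extreme_point_of e \<Longrightarrow> u \<in> CR \<Omega> \<T> \<Longrightarrow>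
    segment_flux (\<lambda>x. \<alpha> x *\<^sub>R grad u x) (control_volume \<T> z e) (z K) a = cr_grad u K \<bullet> r e a" by metis
  show ?thesis
  proof (intro exI[of _ "- (\<Sum>e\<in>{e\<in>edges \<T>. e edge_of K}. v (edge_mid e) *\<^sub>R (\<Sum>a\<in>{a. a extreme_point_of e}. r e a))"] ballI)
    fix u assume u: "u \<in> CR \<Omega> \<T>"
    show "tri_flux \<alpha> \<T> z u v K = cr_grad u K \<bullet> - (\<Sum>e\<in>{e\<in>edges \<T>. e edge_of K}. v (edge_mid e) *\<^sub>R (\<Sum>a\<in>{a. a extreme_point_of e}. r e a))"
    proof -
      have "(\<Sum>a\<in>{a. a extreme_point_of e}. segment_flux (\<lambda>x. \<alpha> x *\<^sub>R grad u x) (control_volume \<T> z e) (z K) a)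
          = cr_grad u K \<bullet> (\<Sum>a\<in>{a. a extreme_point_of e}. r e a)" if "e edge_of K" for e
        unfolding inner_sum_right by (rule sum.cong[OF refl]) (simp add: r that u)
      then show ?thesis
        unfolding tri_flux_def inner_minus_right inner_sum_right inner_scaleR_right by simp
    qed
  qed
qed

lemma tri_flux_left:
  assumes "K \<in> \<T>" "\<And>K. K \<in> \<T> \<Longrightarrow> z K \<in> interior K" "u \<in> CR \<Omega> \<T>" "w \<in> CR \<Omega> \<T>"
  shows "tri_flux \<alpha> \<T> z (lincomb s u t w) v K = s * tri_flux \<alpha> \<T> z u v K + t * tri_flux \<alpha> \<T> z w v K"
proof -
  obtain r where r: "\<And>u. u \<in> CR \<Omega> \<T> \<Longrightarrow> tri_flux \<alpha> \<T> z u v K = cr_grad u K \<bullet> r"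
    using tri_flux_vector[where z = z and \<alpha> = \<alpha> and v = v and \<Omega> = \<Omega>] assms(1,2) by blast
  show ?thesis
    using assms by (simp add: r function_subspaceD[OF CR_subspace] cr_grad_lincomb' inner_add_left)
qed

lemma tri_flux_right:
  "tri_flux \<alpha> \<T> z u (lincomb s v t w) K = s * tri_flux \<alpha> \<T> z u v K + t * tri_flux \<alpha> \<T> z u w K"
  by (simp add: tri_flux_def lincomb_def distrib_right sum.distrib sum_distrib_left mult.assoc)

lemma tri_flux_zero_right:
  assumes "\<And>m. m \<in> mids {K} \<Longrightarrow> v m = 0"
  shows "tri_flux \<alpha> \<T> z u v K = 0"
  unfolding tri_flux_def using assms by (auto simp: mids_def edges_def intro!: sum.neutral)

lemma tri_flux_zero_left:
  assumes "K \<in> \<T>" "\<And>K. K \<in> \<T> \<Longrightarrow> z K \<in> interior K" "u \<in> CR \<Omega> \<T>" "cr_grad u K = 0"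
  shows "tri_flux \<alpha> \<T> z u v K = 0"
  using tri_flux_vector[where z = z and \<alpha> = \<alpha> and v = v and \<Omega> = \<Omega>] assms by fastforce

end

section \<open>Definiteness of the broken energy on a convex domain\<close>

locale domain_mesh = triangle_mesh +
  fixes \<Omega> :: "point set"
  assumes open_\<Omega>: "open \<Omega>" and convex_\<Omega>: "convex \<Omega>" and bounded_\<Omega>: "bounded \<Omega>" and \<Omega>_ne: "\<Omega> \<noteq> {}"
    and Union_mesh: "\<Union>\<T> = closure \<Omega>"
begin

lemma interior_closure_\<Omega>: "interior (closure \<Omega>) = \<Omega>"
  using convex_interior_closure[OF convex_\<Omega>] open_\<Omega> by (simp add: interior_open)

text \<open>A finite set does not separate the plane, so the frontier has a point that is no vertex.
  It lies on an edge of some triangle; were another point of that edge inside the domain, convexity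
  would draw this one inside as well.\<close>

lemma boundary_edge_exists: "\<exists>e\<in>edges \<T> - interior_edges \<Omega> \<T>. True"
proof -
  have "\<not> frontier \<Omega> \<subseteq> vertices"
  proof
    assume "frontier \<Omega> \<subseteq> vertices"
    then have "finite (frontier \<Omega>)" using finite_vertices finite_subset by blast
    then have "connected (UNIV - frontier \<Omega>)" by (intro connected_open_delete_finite) auto
    moreover have "(UNIV - frontier \<Omega>) \<inter> \<Omega> \<noteq> {}" using \<Omega>_ne open_\<Omega> by (auto simp: frontier_def interior_open)
    moreover have "(UNIV - frontier \<Omega>) - \<Omega> \<noteq> {}"
    proof -
      have "closure \<Omega> \<noteq> UNIV" using bounded_\<Omega> bounded_closure not_bounded_UNIV by metis
      then show ?thesis using closure_subset by (auto simp: frontier_def)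
    qed
    ultimately have "(UNIV - frontier \<Omega>) \<inter> frontier \<Omega> \<noteq> {}" by (rule connected_Int_frontier)
    then show False by blast
  qed
  then obtain x where x: "x \<in> frontier \<Omega>" "x \<notin> vertices" by blast
  have xc: "x \<in> closure \<Omega>" "x \<notin> \<Omega>" using x(1) open_\<Omega> by (auto simp: frontier_def interior_open)
  then obtain K where K: "K \<in> \<T>" "x \<in> K" using Union_mesh by blast
  have "interior K \<subseteq> \<Omega>" using K(1) Union_mesh interior_closure_\<Omega> by (metis Union_upper interior_mono)
  then have fr: "x \<in> frontier K" using xc K closure_subset by (auto simp: frontier_def)
  obtain a b c where abc: "K = convex hull {a, b, c}"
    "a \<noteq> b" "b \<noteq> c" "a \<noteq> c" "\<not> affine_dependent {a, b, c}" using tri_obtain[OF K(1)] by metis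
  have v: "{a, b, c} \<subseteq> vertices"
    using extreme_point_of_convex_hull_affine_independent[OF abc(5)] K(1) abc(1) by (auto simp: vertices_def)
  have "x \<in> closed_segment a b \<or> x \<in> closed_segment b c \<or> x \<in> closed_segment c a"
    using fr frontier_of_triangle[of a b c] abc(1) by auto
  then obtain p q where pq: "x \<in> closed_segment p q" "closed_segment p q edge_of K" "{p, q} \<subseteq> vertices"
    using edge_of_triangle[OF abc(5,2,3,4)] abc(1) v by (elim disjE) auto
  have seg: "closed_segment p q \<subseteq> closure \<Omega>" using edge_of_imp_subset[OF pq(2)] K(1) Union_mesh by blast
  have "closed_segment p q \<subseteq> frontier \<Omega>"
  proof (rule ccontr)
    assume "\<not> ?thesis"
    then obtain y where y: "y \<in> closed_segment p q" "y \<in> \<Omega>"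
      using seg open_\<Omega> by (auto simp: frontier_def interior_open)
    have "x \<in> closed_segment p y \<union> closed_segment y q" using Un_closed_segment[OF y(1)] pq(1) by simp
    moreover have "x \<noteq> p" "x \<noteq> q" "x \<noteq> y" using x(2) pq(3) xc(2) y(2) by auto
    ultimately have "x \<in> open_segment y p \<or> x \<in> open_segment y q"
      by (auto simp: open_segment_def closed_segment_commute)
    moreover have "open_segment y s \<subseteq> interior \<Omega>" if "s \<in> closure \<Omega>" for s
      using in_interior_closure_convex_segment[OF convex_\<Omega> _ that] y(2) open_\<Omega> by (simp add: interior_open)
    moreover have "p \<in> closure \<Omega>" "q \<in> closure \<Omega>" using seg by auto
    ultimately have "x \<in> interior \<Omega>" by blast
    then show False using xc(2) interior_subset by blast
  qed
  then show ?thesis using pq(2) K(1) by (intro bexI[of _ "closed_segment p q"]) (auto simp: interior_edges_def edges_def)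
qed

text \<open>A piecewise constant function keeps its value across shared midpoints. The chain
  argument, applied to the whole closure, carries that value to a boundary edge, where it is
  0.\<close>

lemma CR_zero_if_gradients_zero:
  assumes v: "v \<in> CR \<Omega> \<T>" and g: "\<And>K. K \<in> \<T> \<Longrightarrow> cr_grad v K = 0"
  shows "v = (\<lambda>x. 0)"
proof (rule CR_ext[OF v zero_CR])
  have al: "aligned \<T> \<Omega>"
    unfolding aligned_def
  proof
    fix x assume x: "x \<in> frontier \<Omega>"
    then have xc: "x \<in> closure \<Omega>" "x \<notin> \<Omega>" using open_\<Omega> by (auto simp: frontier_def interior_open)
    then obtain K where K: "K \<in> \<T>" "x \<in> K" using Union_mesh by blast
    have "interior K \<subseteq> \<Omega>" using K(1) Union_mesh interior_closure_\<Omega> by (metis Union_upper interior_mono)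
    then show "x \<in> (\<Union>K\<in>\<T>. frontier K)" using xc K closure_subset by (auto simp: frontier_def)
  qed
  have cov: "\<Omega> \<subseteq> \<Union>\<T>" using Union_mesh closure_subset by blast
  have "mid_connected {K \<in> mesh_on \<T> \<Omega>. K \<inter> closure \<Omega> \<noteq> {}}"
    by (rule connected_mid_connected[OF open_\<Omega> al cov punctured_connected_convex[OF open_\<Omega> convex_\<Omega>]])
      (use convex_\<Omega> in \<open>auto intro: convex_connected convex_closure\<close>)
  moreover have "{K \<in> mesh_on \<T> \<Omega>. K \<inter> closure \<Omega> \<noteq> {}} = \<T>"
  proof -
    have "K \<subseteq> closure \<Omega> \<and> K \<noteq> {}" if "K \<in> \<T>" for K
      using that Union_mesh interior_tri[OF that] interior_subset by blast
    then show ?thesis by (auto simp: mesh_on_def)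
  qed
  ultimately have mc: "mid_connected \<T>" by simp
  obtain e where e: "e \<in> edges \<T>" "e \<notin> interior_edges \<Omega> \<T>" using boundary_edge_exists by blast
  then obtain K0 where K0: "K0 \<in> \<T>" "e edge_of K0" by (auto simp: edges_def)
  have e0: "v (edge_mid e) = 0" using v e by (auto simp: CR_def)
  have m0: "edge_mid e \<in> mids {K0}" using K0 by (auto simp: mids_def edges_def)
  fix m assume "m \<in> mids \<T>"
  then obtain K where K: "K \<in> \<T>" "m \<in> mids {K}" using mids_eq_UN by blast
  have "\<bar>v (edge_mid e) - v m\<bar> \<le> (\<Sum>K\<in>\<T>. 0)"
    by (rule mid_connected_oscillation[OF finite_mesh mc _ K0(1) m0 K]) (simp add: cr_grad_diff[OF v] g)
  then show "v m = 0" using e0 by simp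
qed

end

section \<open>Subdomains, the interpolation operator and the local spaces\<close>

locale domain_decomposition = domain_mesh +
  fixes N :: nat and Om :: "nat \<Rightarrow> point set"
  assumes poly: "\<And>i. i \<in> {1..N} \<Longrightarrow> lipschitz_polytope (Om i)"
    and sub_\<Omega>: "\<And>i. i \<in> {1..N} \<Longrightarrow> Om i \<subseteq> \<Omega>"
    and disjoint: "disjoint_family_on Om {1..N}"
    and closure_\<Omega>: "closure \<Omega> = (\<Union>i\<in>{1..N}. closure (Om i))"
    and aligned_Om: "\<And>i. i \<in> {1..N} \<Longrightarrow> aligned \<T> (Om i)"
begin

lemma open_Om: "i \<in> {1..N} \<Longrightarrow> open (Om i)"
  using poly by (simp add: lipschitz_polytope_def)

lemma mesh_on_unique:
  assumes "K \<in> mesh_on \<T> (Om i)" "K \<in> mesh_on \<T> (Om j)" "i \<in> {1..N}" "j \<in> {1..N}"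
  shows "i = j"
proof (rule ccontr)
  assume "i \<noteq> j"
  have K: "K \<in> \<T>" using assms mesh_on_subset by blast
  then have "interior K \<subseteq> Om i" "interior K \<subseteq> Om j"
    using mesh_on_iff_interior[OF open_Om aligned_Om] assms by blast+
  then show False
    using interior_tri[OF K] disjoint \<open>i \<noteq> j\<close> assms(3,4) unfolding disjoint_family_on_def by blast
qed

lemma mesh_eq_UN: "\<T> = (\<Union>i\<in>{1..N}. mesh_on \<T> (Om i))"
proof
  show "(\<Union>i\<in>{1..N}. mesh_on \<T> (Om i)) \<subseteq> \<T>" using mesh_on_subset by blast
  show "\<T> \<subseteq> (\<Union>i\<in>{1..N}. mesh_on \<T> (Om i))"
  proof
    fix K assume K: "K \<in> \<T>"
    obtain x where x: "x \<in> interior K" using interior_tri[OF K] by blast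
    then have "x \<in> closure \<Omega>" using K Union_mesh interior_subset by blast
    then obtain i where i: "i \<in> {1..N}" "x \<in> closure (Om i)" using closure_\<Omega> by blast
    then have "interior K \<inter> Om i \<noteq> {}"
      using x open_Int_closure_eq_empty[OF open_interior, of K "Om i"] by blast
    then have "interior K \<subseteq> Om i" using interior_subset_or_disjoint[OF open_Om aligned_Om K] i by blast
    then show "K \<in> (\<Union>i\<in>{1..N}. mesh_on \<T> (Om i))"
      using mesh_on_iff_interior[OF open_Om aligned_Om K] i by blast
  qed
qed

lemma sum_mesh: "(\<Sum>K\<in>\<T>. f K) = (\<Sum>i\<in>{1..N}. \<Sum>K\<in>mesh_on \<T> (Om i). f K)"
proof -
  have "(\<Sum>K\<in>(\<Union>i\<in>{1..N}. mesh_on \<T> (Om i)). f K) = (\<Sum>i\<in>{1..N}. \<Sum>K\<in>mesh_on \<T> (Om i). f K)"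
    by (rule sum.UNION_disjoint) (use finite_mesh_on mesh_on_unique in blast)+
  then show ?thesis using mesh_eq_UN by simp
qed

lemma frontier_Int_Om:
  assumes "i \<in> {1..N}" "j \<in> {1..N}" shows "Om i \<inter> frontier (Om j) = {}"
proof (cases "i = j")
  case True
  then show ?thesis using open_Om[OF assms(1)] by (auto simp: frontier_def interior_open)
next
  case False
  then have "Om i \<inter> Om j = {}" using disjoint assms unfolding disjoint_family_on_def by blast
  then have "Om i \<inter> closure (Om j) = {}" using open_Int_closure_eq_empty[OF open_Om[OF assms(1)]] by blast
  then show ?thesis by (auto simp: frontier_def)
qed

lemma mids_location:
  assumes "m \<in> mids \<T>"
  shows "\<exists>i\<in>{1..N}. m \<in> cr_interior \<T> (Om i) \<or> m \<in> cr_boundary \<T> (Om i)"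
proof -
  have "m \<in> closure \<Omega>" using assms mids_eq_UN mids_subset_tri Union_mesh by blast
  then obtain i where i: "i \<in> {1..N}" "m \<in> closure (Om i)" using closure_\<Omega> by blast
  then have "m \<in> Om i \<or> m \<in> frontier (Om i)" using open_Om[OF i(1)] by (auto simp: frontier_def interior_open)
  then show ?thesis using i assms by (auto simp: cr_interior_def cr_boundary_def)
qed

lemma mids_in_unique_Om: "m \<in> Om i \<Longrightarrow> m \<in> Om j \<Longrightarrow> i \<in> {1..N} \<Longrightarrow> j \<in> {1..N} \<Longrightarrow> i = j"
  using disjoint unfolding disjoint_family_on_def by blast

text \<open>Midpoints inside different subdomains are different, so the prescriptions do not
  conflict. Midpoints of boundary edges lie in no subdomain and keep the value 0 of
  \<open>u\<close>.\<close>

lemma CR_with_interior_values: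
  assumes u: "u \<in> CR \<Omega> \<T>"
  shows "\<exists>w\<in>CR \<Omega> \<T>. \<forall>i\<in>{1..N}. (\<forall>x\<in>cr_boundary \<T> (Om i). w x = u x) \<and> (\<forall>x\<in>cr_interior \<T> (Om i). w x = g i x)"
proof -
  define f where "f m = (if \<exists>i\<in>{1..N}. m \<in> Om i then g (THE i. i \<in> {1..N} \<and> m \<in> Om i) m else u m)" for m
  have fi: "f m = g i m" if "i \<in> {1..N}" "m \<in> Om i" for i m
  proof -
    have "(THE i. i \<in> {1..N} \<and> m \<in> Om i) = i" using that mids_in_unique_Om by (intro the_equality) blast+
    then show ?thesis using that by (auto simp: f_def)
  qed
  have fo: "f m = u m" if "\<And>i. i \<in> {1..N} \<Longrightarrow> m \<notin> Om i" for m using that by (auto simp: f_def)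
  have "\<exists>v\<in>CR \<Omega> \<T>. \<forall>m\<in>mids \<T>. v m = f m"
  proof (rule CR_interpolation)
    fix e assume e: "e \<in> edges \<T> - interior_edges \<Omega> \<T>"
    then have "e \<subseteq> frontier \<Omega>" by (auto simp: interior_edges_def)
    moreover have "edge_mid e \<in> e" using e edge_mid_in_edge simplex2 by (auto simp: edges_def)
    ultimately have "edge_mid e \<notin> \<Omega>" using open_\<Omega> by (auto simp: frontier_def interior_open)
    then have "f (edge_mid e) = u (edge_mid e)" using sub_\<Omega> by (intro fo) blast
    then show "f (edge_mid e) = 0" using e u by (auto simp: CR_def)
  qed
  then obtain w where w: "w \<in> CR \<Omega> \<T>" "\<And>m. m \<in> mids \<T> \<Longrightarrow> w m = f m" by blast
  show ?thesis
  proof (intro bexI[OF _ w(1)] ballI conjI)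
    fix i x assume i: "i \<in> {1..N}" and x: "x \<in> cr_boundary \<T> (Om i)"
    then have "x \<notin> Om j" if "j \<in> {1..N}" for j using frontier_Int_Om[OF that i] by (auto simp: cr_boundary_def)
    then have "f x = u x" by (rule fo)
    then show "w x = u x" using w(2) x by (auto simp: cr_boundary_def)
  next
    fix i x assume i: "i \<in> {1..N}" and x: "x \<in> cr_interior \<T> (Om i)"
    then show "w x = g i x" using w(2) fi by (auto simp: cr_interior_def)
  qed
qed

lemma CR_eqI:
  assumes "v \<in> CR \<Omega> \<T>" "w \<in> CR \<Omega> \<T>"
    and "\<And>i x. i \<in> {1..N} \<Longrightarrow> x \<in> cr_boundary \<T> (Om i) \<Longrightarrow> v x = w x"
    and "\<And>i x. i \<in> {1..N} \<Longrightarrow> x \<in> cr_interior \<T> (Om i) \<Longrightarrow> v x = w x"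
  shows "v = w"
  by (rule CR_ext[OF assms(1,2)]) (use mids_location assms(3,4) in blast)

abbreviation "IA \<equiv> I_A \<Omega> \<T> N Om"

lemma I_A_characterization:
  assumes u: "u \<in> CR \<Omega> \<T>"
  shows "IA u = w \<longleftrightarrow> w \<in> CR \<Omega> \<T> \<and> (\<forall>i\<in>{1..N}. (\<forall>x\<in>cr_boundary \<T> (Om i). w x = u x) \<and>
      (\<forall>x\<in>cr_interior \<T> (Om i). w x = boundary_average \<T> (Om i) u))"
proof -
  let ?P = "\<lambda>w. w \<in> CR \<Omega> \<T> \<and> (\<forall>i\<in>{1..N}. (\<forall>x\<in>cr_boundary \<T> (Om i). w x = u x) \<and>
      (\<forall>x\<in>cr_interior \<T> (Om i). w x = boundary_average \<T> (Om i) u))"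
  have ex1: "\<exists>!w. ?P w"
  proof (rule ex_ex1I)
    show "\<exists>w. ?P w" using CR_with_interior_values[OF u, of "\<lambda>i x. boundary_average \<T> (Om i) u"] by blast
    show "v = w" if "?P v" "?P w" for v w by (rule CR_eqI) (use that in auto)
  qed
  show ?thesis
    unfolding I_A_def using theI'[OF ex1] the1_equality[OF ex1] by blast
qed

lemma I_A_CR: "u \<in> CR \<Omega> \<T> \<Longrightarrow> IA u \<in> CR \<Omega> \<T>"
  and I_A_boundary: "u \<in> CR \<Omega> \<T> \<Longrightarrow> i \<in> {1..N} \<Longrightarrow> x \<in> cr_boundary \<T> (Om i) \<Longrightarrow> IA u x = u x"
  and I_A_interior: "u \<in> CR \<Omega> \<T> \<Longrightarrow> i \<in> {1..N} \<Longrightarrow> x \<in> cr_interior \<T> (Om i) \<Longrightarrow>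
    IA u x = boundary_average \<T> (Om i) u"
  using I_A_characterization by blast+

lemma I_A_lincomb:
  assumes u: "u \<in> CR \<Omega> \<T>" and w: "w \<in> CR \<Omega> \<T>"
  shows "IA (lincomb s u t w) = lincomb s (IA u) t (IA w)"
proof -
  have avg: "boundary_average \<T> S (lincomb s u t w) = s * boundary_average \<T> S u + t * boundary_average \<T> S w" for S
    by (simp add: boundary_average_def lincomb_def sum.distrib add_divide_distrib flip: sum_distrib_left)
  show ?thesis
    unfolding I_A_characterization[OF function_subspaceD[OF CR_subspace u w]] avg
    using function_subspaceD[OF CR_subspace I_A_CR[OF u] I_A_CR[OF w]] I_A_boundary u w I_A_interior
    by (auto simp: lincomb_def)
qed

abbreviation "VS \<equiv> V_space \<Omega> \<T> N Om"

lemma V_space_subset: "VS i \<subseteq> CR \<Omega> \<T>"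
  using I_A_CR by (auto simp: V_space_def)

lemma V_space_subspace: "function_subspace (VS i)"
proof (cases "i = 0")
  case True
  have "IA (\<lambda>x. 0) = (\<lambda>x. 0)"
    unfolding I_A_characterization[OF zero_CR] using zero_CR by (simp add: boundary_average_def)
  then have "(\<lambda>x. 0) \<in> IA ` CR \<Omega> \<T>" using zero_CR by (metis image_eqI)
  moreover have "lincomb s (IA u) t (IA w) \<in> IA ` CR \<Omega> \<T>" if "u \<in> CR \<Omega> \<T>" "w \<in> CR \<Omega> \<T>" for s u t w
    using I_A_lincomb[OF that] function_subspaceD[OF CR_subspace that] by (metis image_eqI)
  ultimately show ?thesis using True by (auto simp: V_space_def function_subspace_def)
next
  case False
  then show ?thesis
    using zero_CR CR_lincomb by (auto simp: V_space_def function_subspace_def lincomb_def)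
qed

lemma zero_on_triangle:
  assumes v: "v \<in> CR \<Omega> \<T>" and K: "K \<in> \<T>" and m: "\<And>m. m \<in> mids {K} \<Longrightarrow> v m = 0"
  shows "cr_grad v K = 0" "x \<in> interior K \<Longrightarrow> v x = 0"
proof -
  show g: "cr_grad v K = 0" by (rule cr_grad_unique[OF v K]) (simp add: m)
  obtain c where c: "\<And>x. x \<in> interior K \<union> mids {K} \<Longrightarrow> v x = c"
    using cr_affine[OF v K] g by auto
  obtain l where "l \<in> mids {K}" using tri_obtain[OF K] by (metis insertI1)
  then have "c = 0" using c m by fastforce
  then show "x \<in> interior K \<Longrightarrow> v x = 0" using c by blast
qed

text \<open>The definition prescribes zeros only inside the other subdomains. Vanishing on an open
  triangle forces its affine piece to vanish, which includes the midpoints on its sides.\<close>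

lemma V_space_zero_outside:
  assumes i: "i \<in> {1..N}" and v: "v \<in> VS i" and K: "K \<in> \<T>" "K \<notin> mesh_on \<T> (Om i)"
  shows "cr_grad v K = 0" "m \<in> mids {K} \<Longrightarrow> v m = 0"
proof -
  have vC: "v \<in> CR \<Omega> \<T>" using v V_space_subset by blast
  obtain j where j: "j \<in> {1..N}" "K \<in> mesh_on \<T> (Om j)" using K(1) mesh_eq_UN by blast
  then have "j \<noteq> i" using K(2) by blast
  then have vj: "v x = 0" if "x \<in> Om j" for x using v i j(1) that by (auto simp: V_space_def)
  have "interior K \<subseteq> Om j" using mesh_on_iff_interior[OF open_Om aligned_Om K(1)] j by blast
  then have vK: "v x = 0" if "x \<in> interior K" for x using vj that by blast
  obtain c where c: "\<And>x. x \<in> interior K \<union> mids {K} \<Longrightarrow> v x = cr_grad v K \<bullet> x + c"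
    using cr_affine[OF vC K(1)] by blast
  obtain x0 where x0: "x0 \<in> interior K" using interior_tri[OF K(1)] by blast
  have "grad v x0 = cr_grad v K" by (rule grad_eq_cr_grad[OF vC K(1) x0])
  moreover have "GDERIV v x0 :> 0"
    unfolding gderiv_def
    by (rule has_derivative_transform_within_open[of "\<lambda>_. 0" _ _ _ "interior K"]) (use vK x0 in auto)
  moreover have "G = 0" if "GDERIV v x0 :> G" for G
  proof -
    have "(\<lambda>h. h \<bullet> G) = (\<lambda>h. h \<bullet> 0)"
      using has_derivative_unique that \<open>GDERIV v x0 :> 0\<close> unfolding gderiv_def by blast
    then have "\<forall>h. h \<bullet> G = h \<bullet> 0" by (rule fun_cong[THEN allI])
    then show ?thesis by (simp only: vector_eq_ldot)
  qed
  ultimately show g: "cr_grad v K = 0" unfolding grad_def by (metis the_equality)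
  have "c = 0" using c[of x0] vK[OF x0] x0 g by simp
  then show "m \<in> mids {K} \<Longrightarrow> v m = 0" using c g by simp
qed

lemma V_space_mid_zero:
  assumes i: "i \<in> {1..N}" and v: "v \<in> VS i" and m: "m \<in> mids \<T>" "m \<notin> Om i"
  shows "v m = 0"
proof -
  obtain K where K: "K \<in> \<T>" "m \<in> mids {K}" using m mids_eq_UN by blast
  show ?thesis
  proof (cases "K \<in> mesh_on \<T> (Om i)")
    case True
    then have "m \<in> closure (Om i)" using K mids_subset_tri by (auto simp: mesh_on_def)
    then have "m \<in> cr_boundary \<T> (Om i)"
      using m open_Om[OF i] by (auto simp: cr_boundary_def frontier_def interior_open)
    then show ?thesis using v i by (auto simp: V_space_def)
  next
    case False
    then show ?thesis using V_space_zero_outside[OF i v K(1)] K(2) by blast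
  qed
qed

text \<open>The sum of the local spaces, described by boundary values alone: membership of
  \<open>u\<close> minus its interpolant is then immediate.\<close>

definition W :: "(point \<Rightarrow> real) set" where
  "W = {v \<in> CR \<Omega> \<T>. \<forall>i\<in>{1..N}. \<forall>x\<in>cr_boundary \<T> (Om i). v x = 0}"

lemma W_subset: "W \<subseteq> CR \<Omega> \<T>" by (auto simp: W_def)

lemma sum_V_space_in_W:
  assumes "\<And>i. i \<in> {1..N} \<Longrightarrow> f i \<in> VS i"
  shows "(\<lambda>x. \<Sum>i\<in>{1..N}. f i x) \<in> W"
proof -
  have "linear_form_on (CR \<Omega> \<T>) (\<lambda>_. 0)" by (simp add: linear_form_on_def)
  then have "(\<lambda>x. \<Sum>i\<in>{1..N}. f i x) \<in> CR \<Omega> \<T>"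
    using linear_form_on_sum[OF CR_subspace] assms V_space_subset by blast
  moreover have "(\<Sum>i\<in>{1..N}. f i x) = 0" if j: "j \<in> {1..N}" "x \<in> cr_boundary \<T> (Om j)" for j x
  proof (rule sum.neutral, rule ballI)
    fix i assume i: "i \<in> {1..N}"
    have "x \<notin> Om i" using frontier_Int_Om[OF i j(1)] j(2) by (auto simp: cr_boundary_def)
    then show "f i x = 0" using V_space_mid_zero[OF i assms[OF i]] j(2) by (auto simp: cr_boundary_def)
  qed
  ultimately show ?thesis by (simp add: W_def)
qed

text \<open>Component \<open>i\<close> keeps the midpoint values inside subdomain \<open>i\<close>
  and is zero at all other midpoints. This is consistent because \<open>w\<close> vanishes at the
  interface midpoints.\<close>

lemma W_decomposition:
  assumes w: "w \<in> W"
  shows "\<exists>f. (\<forall>i\<in>{1..N}. f i \<in> VS i) \<and> w = (\<lambda>x. \<Sum>i\<in>{1..N}. f i x)"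
proof -
  have "\<exists>v\<in>CR \<Omega> \<T>. \<forall>j\<in>{1..N}. (\<forall>x\<in>cr_boundary \<T> (Om j). v x = 0) \<and>
      (\<forall>x\<in>cr_interior \<T> (Om j). v x = (if j = i then w x else 0))" for i
    using CR_with_interior_values[OF zero_CR, of "\<lambda>j x. if j = i then w x else 0"] by simp
  then obtain f where f: "\<And>i. f i \<in> CR \<Omega> \<T>"
      "\<And>i j x. j \<in> {1..N} \<Longrightarrow> x \<in> cr_boundary \<T> (Om j) \<Longrightarrow> f i x = 0"
      "\<And>i j x. j \<in> {1..N} \<Longrightarrow> x \<in> cr_interior \<T> (Om j) \<Longrightarrow> f i x = (if j = i then w x else 0)"
    by metis
  have V: "f i \<in> VS i" if i: "i \<in> {1..N}" for i
  proof -
    have "f i x = 0" if j: "j \<in> {1..N} - {i}" and x: "x \<in> Om j" for j x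
    proof -
      have j1: "j \<in> {1..N}" "j \<noteq> i" using j by auto
      \<comment> \<open>The local space demands zeros at every point of the other subdomains:
        midpoints, open triangles, and the remaining points, where representatives are 0 by
        convention.\<close>
      consider "x \<in> mids \<T>" | K where "K \<in> \<T>" "x \<in> interior K" | "x \<notin> (\<Union>K\<in>\<T>. interior K) \<union> mids \<T>" by blast
      then show ?thesis
      proof cases
        case 1
        then show ?thesis using f(3)[OF j1(1), of x i] x j1 by (simp add: cr_interior_def)
      next
        case 2
        have "interior K \<subseteq> Om j"
          using interior_subset_or_disjoint[OF open_Om aligned_Om 2(1)] j1 2(2) x by blast
        then have KF: "K \<in> mesh_on \<T> (Om j)" using mesh_on_iff_interior[OF open_Om aligned_Om 2(1)] j1 by blast
        have "f i m = 0" if "m \<in> mids {K}" for m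
        proof -
          have "m \<in> closure (Om j)" "m \<in> mids \<T>"
            using KF that mids_iff[OF 2(1)] by (auto simp: mesh_on_def)
          then have "m \<in> cr_boundary \<T> (Om j) \<or> m \<in> cr_interior \<T> (Om j)"
            using open_Om[OF j1(1)] by (auto simp: cr_boundary_def cr_interior_def frontier_def interior_open)
          then show ?thesis using f(2)[OF j1(1)] f(3)[OF j1(1)] j1(2) by auto
        qed
        then show ?thesis using zero_on_triangle(2)[OF f(1) 2(1) _ 2(2)] by blast
      next
        case 3
        then show ?thesis using f(1)[of i] by (simp add: CR_def)
      qed
    qed
    then show ?thesis using f(1,2) i by (auto simp: V_space_def)
  qed
  have "w = (\<lambda>x. \<Sum>i\<in>{1..N}. f i x)"
  proof (rule CR_eqI)
    show "w \<in> CR \<Omega> \<T>" using w W_subset by blast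
    show "(\<lambda>x. \<Sum>i\<in>{1..N}. f i x) \<in> CR \<Omega> \<T>" using sum_V_space_in_W[OF V] W_subset by blast
    show "w x = (\<Sum>i\<in>{1..N}. f i x)" if "i \<in> {1..N}" "x \<in> cr_boundary \<T> (Om i)" for i x
      using w that f(2)[OF that] by (simp add: W_def)
    show "w x = (\<Sum>i\<in>{1..N}. f i x)" if "j \<in> {1..N}" "x \<in> cr_interior \<T> (Om j)" for j x
      using that(1) by (simp add: f(3)[OF that])
  qed
  then show ?thesis using V by blast
qed

text \<open>The common structure of the two forms. The vanishing condition is asymmetric because the
  flux form sees the first argument through its gradient and the second through its midpoint
  values.\<close>

definition local_form :: "((point \<Rightarrow> real) \<Rightarrow> (point \<Rightarrow> real) \<Rightarrow> point set \<Rightarrow> real) \<Rightarrow> bool" where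
  "local_form x \<longleftrightarrow> bilinear_form_on (CR \<Omega> \<T>) (\<lambda>u v. \<Sum>K\<in>\<T>. x u v K) \<and>
     (\<forall>K\<in>\<T>. \<forall>u\<in>CR \<Omega> \<T>. \<forall>v\<in>CR \<Omega> \<T>. cr_grad u K = 0 \<or> (\<forall>m\<in>mids {K}. v m = 0) \<longrightarrow> x u v K = 0)"

text \<open>Every triangle lies outside at least one of the two subdomains.\<close>

lemma local_form_orthogonal:
  assumes x: "local_form x" and ij: "i \<in> {1..N}" "j \<in> {1..N}" "i \<noteq> j" and uv: "u \<in> VS i" "v \<in> VS j"
  shows "(\<Sum>K\<in>\<T>. x u v K) = 0"
proof (rule sum.neutral, rule ballI)
  fix K assume K: "K \<in> \<T>"
  have "K \<notin> mesh_on \<T> (Om i) \<or> K \<notin> mesh_on \<T> (Om j)" using mesh_on_unique ij by blast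
  then have "cr_grad u K = 0 \<or> (\<forall>m\<in>mids {K}. v m = 0)"
    using V_space_zero_outside[OF ij(1) uv(1) K] V_space_zero_outside[OF ij(2) uv(2) K] by blast
  then show "x u v K = 0" using x K uv V_space_subset unfolding local_form_def by blast
qed

text \<open>The system on \<open>W\<close> is block diagonal, so adding the local solutions solves
  it. The number of subdomains therefore never enters a constant.\<close>

lemma solves_on_W:
  assumes x: "local_form x" and \<phi>: "linear_form_on (CR \<Omega> \<T>) \<phi>"
    and f: "\<And>i. i \<in> {1..N} \<Longrightarrow> f i \<in> VS i"
      "\<And>i v. i \<in> {1..N} \<Longrightarrow> v \<in> VS i \<Longrightarrow> (\<Sum>K\<in>\<T>. x (f i) v K) = \<phi> v"
    and v: "v \<in> W"
  shows "(\<Sum>K\<in>\<T>. x (\<lambda>y. \<Sum>i\<in>{1..N}. f i y) v K) = \<phi> v"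
proof -
  define X where "X u v = (\<Sum>K\<in>\<T>. x u v K)" for u v
  have bil: "bilinear_form_on (CR \<Omega> \<T>) X" using x unfolding local_form_def X_def[abs_def] by blast
  obtain g where g: "\<And>i. i \<in> {1..N} \<Longrightarrow> g i \<in> VS i" "v = (\<lambda>x. \<Sum>i\<in>{1..N}. g i x)"
    using W_decomposition[OF v] by blast
  have C: "v \<in> CR \<Omega> \<T>" "\<And>i. i \<in> {1..N} \<Longrightarrow> f i \<in> CR \<Omega> \<T>" "\<And>i. i \<in> {1..N} \<Longrightarrow> g i \<in> CR \<Omega> \<T>"
    using v W_subset f(1) g(1) V_space_subset by blast+
  have "X (\<lambda>y. \<Sum>i\<in>{1..N}. f i y) v = (\<Sum>i\<in>{1..N}. X (f i) v)"
    using linear_form_on_sum[OF CR_subspace, where \<phi> = "\<lambda>u. X u v" and I = "{1..N}" and f = f] bil C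
    unfolding bilinear_form_on_def by blast
  also have "\<dots> = (\<Sum>i\<in>{1..N}. \<phi> (g i))"
  proof (rule sum.cong[OF refl])
    fix i assume i: "i \<in> {1..N}"
    have "X (f i) v = (\<Sum>j\<in>{1..N}. X (f i) (g j))"
      using linear_form_on_sum[OF CR_subspace, where \<phi> = "X (f i)" and I = "{1..N}" and f = g] bil C i g(2)
      unfolding bilinear_form_on_def by blast
    also have "\<dots> = (\<Sum>j\<in>{1..N}. if j = i then X (f i) (g i) else 0)"
      using local_form_orthogonal[OF x i] f(1)[OF i] g(1) by (intro sum.cong) (auto simp: X_def)
    also have "\<dots> = \<phi> (g i)" using i f(2)[OF i g(1)[OF i]] by (simp add: X_def)
    finally show "X (f i) v = \<phi> (g i)" .
  qed
  also have "\<dots> = \<phi> v"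
  proof -
    have "\<phi> (\<lambda>x. \<Sum>i\<in>{1..N}. g i x) = (\<Sum>i\<in>{1..N}. \<phi> (g i))"
      using linear_form_on_sum[OF CR_subspace \<phi>, where I = "{1..N}" and f = g] C(3) by blast
    then show ?thesis by (simp only: g(2))
  qed
  finally show ?thesis by (simp add: X_def)
qed

end


section \<open>Bounds for the additive Schwarz operators\<close>

locale weighted_decomposition = domain_decomposition +
  fixes \<alpha> :: "point \<Rightarrow> real" and z :: "point set \<Rightarrow> point" and \<sigma> \<Lambda> A :: real and lo hi :: "nat \<Rightarrow> real"
  assumes lip: "\<And>K. K \<in> \<T> \<Longrightarrow> \<Lambda>-lipschitz_on (interior K) \<alpha>"
    and \<alpha>_bounds: "\<And>K x. K \<in> \<T> \<Longrightarrow> x \<in> interior K \<Longrightarrow> 1 \<le> \<alpha> x \<and> \<alpha> x \<le> A"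
    and z_interior: "\<And>K. K \<in> \<T> \<Longrightarrow> z K \<in> interior K"
    and \<sigma>: "\<sigma> > 0"
    and quasi: "\<And>K. K \<in> \<T> \<Longrightarrow> \<exists>x. ball x (mesh_size \<T> / \<sigma>) \<subseteq> K"
    and subdom: "\<And>i. i \<in> {1..N} \<Longrightarrow> \<exists>\<Phi>. subdomain_mesh \<T> (Om i) \<sigma> \<Phi>"
    and lo_hi: "\<And>i K x. i \<in> {1..N} \<Longrightarrow> K \<in> mesh_on \<T> (Om i) \<Longrightarrow> K \<inter> frontier (Om i) \<noteq> {} \<Longrightarrow>
      x \<in> interior K \<Longrightarrow> lo i \<le> \<alpha> x \<and> \<alpha> x \<le> hi i"
    and lo_le_hi: "\<And>i. i \<in> {1..N} \<Longrightarrow> 1 \<le> lo i \<and> lo i \<le> hi i"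
begin

definition energy_form :: "(point \<Rightarrow> real) \<Rightarrow> (point \<Rightarrow> real) \<Rightarrow> point set \<Rightarrow> real" where
  "energy_form u v K = coef_mass \<alpha> K * (cr_grad u K \<bullet> cr_grad v K)"

definition FE :: "(point \<Rightarrow> real) \<Rightarrow> (point \<Rightarrow> real) \<Rightarrow> real" where
  "FE u v = (\<Sum>K\<in>\<T>. energy_form u v K)"

definition FV :: "(point \<Rightarrow> real) \<Rightarrow> (point \<Rightarrow> real) \<Rightarrow> real" where
  "FV u v = (\<Sum>K\<in>\<T>. tri_flux \<alpha> \<T> z u v K)"

lemma mesh_nonempty: "\<T> \<noteq> {}"
  using Union_mesh \<Omega>_ne by (metis Union_empty closure_eq_empty)

lemma mesh_size_pos: "mesh_size \<T> > 0"
proof -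
  obtain K where K: "K \<in> \<T>" using mesh_nonempty by blast
  obtain x where x: "x \<in> interior K" using interior_tri[OF K] by blast
  obtain y where y: "y \<in> interior K" "y \<noteq> x" using open_not_singleton[OF open_interior x] by blast
  have "dist x y \<le> diameter K"
    using diameter_bounded_bound[OF compact_imp_bounded[OF compact_tri[OF K]]] x y interior_subset by blast
  also have "\<dots> \<le> mesh_size \<T>" using K finite_mesh by (simp add: mesh_size_def)
  finally have "dist x y \<le> mesh_size \<T>" .
  moreover have "dist x y > 0" using y(2) by simp
  ultimately show ?thesis by linarith
qed

lemma measure_tri_ge: "K \<in> \<T> \<Longrightarrow> 3 * (mesh_size \<T> / \<sigma>)\<^sup>2 \<le> measure lebesgue K"
  using quasi[of K] measure_ge_ball lmeasurable_compact[OF compact_tri] mesh_size_pos \<sigma>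
  by (meson divide_nonneg_pos less_imp_le)

lemma coef_mass_ge: "K \<in> \<T> \<Longrightarrow> measure lebesgue K \<le> coef_mass \<alpha> K"
  using coef_mass_bounds[OF _ lip, of K 1 A] \<alpha>_bounds by simp

lemma coef_mass_le: "K \<in> \<T> \<Longrightarrow> coef_mass \<alpha> K \<le> A * measure lebesgue K"
  using coef_mass_bounds[OF _ lip, of K 1 A] \<alpha>_bounds by simp

lemma coef_mass_pos: "K \<in> \<T> \<Longrightarrow> coef_mass \<alpha> K > 0"
proof -
  assume K: "K \<in> \<T>"
  have "0 < 3 * (mesh_size \<T> / \<sigma>)\<^sup>2" using mesh_size_pos \<sigma> by simp
  then show "coef_mass \<alpha> K > 0" using measure_tri_ge[OF K] coef_mass_ge[OF K] by linarith
qed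

lemma local_energy_form: "local_form energy_form"
proof -
  have "linear_form_on (CR \<Omega> \<T>) (\<lambda>v. \<Sum>K\<in>\<T>. energy_form u v K) \<and> linear_form_on (CR \<Omega> \<T>) (\<lambda>v. \<Sum>K\<in>\<T>. energy_form v u K)"
    if "u \<in> CR \<Omega> \<T>" for u
    unfolding linear_form_on_def energy_form_def sum_distrib_left sum.distrib[symmetric]
    by (intro conjI ballI allI sum.cong refl)
      (simp_all add: cr_grad_lincomb' inner_add_left inner_add_right algebra_simps)
  moreover have "energy_form u v K = 0"
    if "K \<in> \<T>" "u \<in> CR \<Omega> \<T>" "v \<in> CR \<Omega> \<T>" "cr_grad u K = 0 \<or> (\<forall>m\<in>mids {K}. v m = 0)" for u v K
    using that zero_on_triangle(1)[OF that(3,1)] by (auto simp: energy_form_def)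
  ultimately show ?thesis unfolding local_form_def bilinear_form_on_def by blast
qed

lemma local_flux_form: "local_form (tri_flux \<alpha> \<T> z)"
proof -
  have "linear_form_on (CR \<Omega> \<T>) (\<lambda>v. \<Sum>K\<in>\<T>. tri_flux \<alpha> \<T> z u v K) \<and> linear_form_on (CR \<Omega> \<T>) (\<lambda>v. \<Sum>K\<in>\<T>. tri_flux \<alpha> \<T> z v u K)"
    if "u \<in> CR \<Omega> \<T>" for u
    unfolding linear_form_on_def sum_distrib_left sum.distrib[symmetric]
    by (intro conjI ballI allI sum.cong refl) (simp_all add: tri_flux_left[OF _ z_interior] tri_flux_right)
  moreover have "tri_flux \<alpha> \<T> z u v K = 0"
    if "K \<in> \<T>" "u \<in> CR \<Omega> \<T>" "v \<in> CR \<Omega> \<T>" "cr_grad u K = 0 \<or> (\<forall>m\<in>mids {K}. v m = 0)" for u v K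
    using that tri_flux_zero_left[OF that(1) z_interior that(2)] tri_flux_zero_right[of K v] by blast
  ultimately show ?thesis unfolding local_form_def bilinear_form_on_def by blast
qed

lemma FE_bilinear: "bilinear_form_on (CR \<Omega> \<T>) FE"
  using local_energy_form unfolding local_form_def FE_def[abs_def] by blast

lemma FV_bilinear: "bilinear_form_on (CR \<Omega> \<T>) FV"
  using local_flux_form unfolding local_form_def FV_def[abs_def] by blast

sublocale form_space "CR \<Omega> \<T>" FE
proof
  show "function_subspace (CR \<Omega> \<T>)" by (rule CR_subspace)
  show "bilinear_form_on (CR \<Omega> \<T>) FE" by (rule FE_bilinear)
  show "FE u v = FE v u" for u v by (simp add: FE_def energy_form_def inner_commute)
  show "0 \<le> FE u u" for u
    unfolding FE_def energy_form_def
    using coef_mass_pos by (intro sum_nonneg mult_nonneg_nonneg) (auto intro: less_imp_le)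
qed

lemma FE_pos:
  assumes v: "v \<in> CR \<Omega> \<T>" "v \<noteq> (\<lambda>x. 0)" shows "FE v v > 0"
proof -
  obtain K where K: "K \<in> \<T>" "cr_grad v K \<noteq> 0" using CR_zero_if_gradients_zero[OF v(1)] v(2) by blast
  have "0 < energy_form v v K" using K coef_mass_pos by (simp add: energy_form_def)
  also have "\<dots> \<le> FE v v"
    unfolding FE_def using coef_mass_pos
    by (intro member_le_sum[OF K(1)]) (auto simp: energy_form_def finite_mesh less_imp_le)
  finally show ?thesis .
qed

text \<open>The relative size of the perturbation. Quasiuniformity bounds 3/2 h^2 by \<sigma>^2/2
  times the area of a triangle, and the area is at most its coefficient mass since \<alpha> is at
  least 1.\<close>

definition \<theta> :: real where "\<theta> = \<Lambda> * (1 + \<sigma>\<^sup>2 / 2) * mesh_size \<T>"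

lemma \<Lambda>_nonneg: "\<Lambda> \<ge> 0"
  using mesh_nonempty lip lipschitz_on_nonneg by blast

text \<open>The local errors are products of weighted gradient norms, which Cauchy-Schwarz over the
  triangles combines. Only the lower bound of \<alpha> is used, so the factor does not see its
  size.\<close>

lemma FV_FE_error:
  assumes u: "u \<in> CR \<Omega> \<T>" and v: "v \<in> CR \<Omega> \<T>"
  shows "\<bar>FV u v - FE u v\<bar> \<le> \<theta> * nrm u * nrm v"
proof -
  let ?h = "mesh_size \<T>"
  let ?c = "coef_mass \<alpha>"
  have loc: "\<bar>tri_flux \<alpha> \<T> z u v K - energy_form u v K\<bar> \<le> \<theta> * (sqrt (?c K) * norm (cr_grad u K) * (sqrt (?c K) * norm (cr_grad v K)))"
    if K: "K \<in> \<T>" for K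
  proof -
    let ?n = "norm (cr_grad u K) * norm (cr_grad v K)"
    have d: "diameter K \<le> ?h" using K finite_mesh by (simp add: mesh_size_def)
    have d0: "diameter K \<ge> 0" using diameter_ge_0 compact_imp_bounded compact_tri[OF K] by blast
    have "3 / 2 * ?h\<^sup>2 = \<sigma>\<^sup>2 / 2 * (3 * (?h / \<sigma>)\<^sup>2)" using \<sigma> by (simp add: power_divide)
    also have "\<dots> \<le> \<sigma>\<^sup>2 / 2 * measure lebesgue K" by (rule mult_left_mono[OF measure_tri_ge[OF K]]) simp
    finally have h2: "3 / 2 * ?h\<^sup>2 \<le> \<sigma>\<^sup>2 / 2 * measure lebesgue K" .
    have "(diameter K)\<^sup>2 \<le> ?h\<^sup>2" using d d0 by (intro power_mono) auto
    then have br: "measure lebesgue K + 3/2 * (diameter K)\<^sup>2 \<le> (1 + \<sigma>\<^sup>2 / 2) * ?c K"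
    proof -
      have "measure lebesgue K + 3/2 * (diameter K)\<^sup>2 \<le> (1 + \<sigma>\<^sup>2 / 2) * measure lebesgue K"
        using \<open>(diameter K)\<^sup>2 \<le> ?h\<^sup>2\<close> h2 by (simp add: distrib_right)
      also have "\<dots> \<le> (1 + \<sigma>\<^sup>2 / 2) * ?c K" by (intro mult_left_mono coef_mass_ge K) (simp add: add_nonneg_nonneg)
      finally show ?thesis .
    qed
    have "\<bar>tri_flux \<alpha> \<T> z u v K - energy_form u v K\<bar>
      \<le> \<Lambda> * diameter K * (measure lebesgue K + 3/2 * (diameter K)\<^sup>2) * norm (cr_grad u K) * norm (cr_grad v K)"
      unfolding energy_form_def by (rule tri_flux_estimate[OF K z_interior u v lip[OF K]])
    also have "\<dots> = \<Lambda> * diameter K * (measure lebesgue K + 3/2 * (diameter K)\<^sup>2) * ?n" by simp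
    also have "\<dots> \<le> \<Lambda> * ?h * ((1 + \<sigma>\<^sup>2 / 2) * ?c K) * ?n"
      using d d0 \<Lambda>_nonneg br by (intro mult_right_mono mult_mono mult_left_mono) (auto intro: add_nonneg_nonneg)
    also have "\<dots> = \<theta> * (?c K * ?n)" by (simp add: \<theta>_def)
    also have "?c K = sqrt (?c K) * sqrt (?c K)" using coef_mass_pos[OF K] by simp
    finally show ?thesis by (simp only: mult_ac)
  qed
  have \<theta>0: "\<theta> \<ge> 0" using \<Lambda>_nonneg mesh_size_pos by (simp add: \<theta>_def add_nonneg_nonneg)
  have nL: "L2_set (\<lambda>K. sqrt (?c K) * norm (cr_grad w K)) \<T> = nrm w" for w
    unfolding L2_set_def nrm_def FE_def energy_form_def
    using coef_mass_pos by (intro arg_cong[of _ _ sqrt] sum.cong) (auto simp: power_mult_distrib dot_square_norm less_imp_le)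
  have "\<bar>FV u v - FE u v\<bar> = \<bar>\<Sum>K\<in>\<T>. tri_flux \<alpha> \<T> z u v K - energy_form u v K\<bar>"
    by (simp add: FV_def FE_def sum_subtractf)
  also have "\<dots> \<le> (\<Sum>K\<in>\<T>. \<bar>tri_flux \<alpha> \<T> z u v K - energy_form u v K\<bar>)" by (rule sum_abs)
  also have "\<dots> \<le> (\<Sum>K\<in>\<T>. \<theta> * (sqrt (?c K) * norm (cr_grad u K) * (sqrt (?c K) * norm (cr_grad v K))))"
    by (rule sum_mono) (rule loc)
  also have "\<dots> = \<theta> * (\<Sum>K\<in>\<T>. \<bar>sqrt (?c K) * norm (cr_grad u K)\<bar> * \<bar>sqrt (?c K) * norm (cr_grad v K)\<bar>)"
    unfolding sum_distrib_left using coef_mass_pos by (intro sum.cong) (auto simp: less_imp_le)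
  also have "\<dots> \<le> \<theta> * (nrm u * nrm v)"
    unfolding nL[symmetric] by (rule mult_left_mono[OF L2_set_mult_ineq \<theta>0])
  finally show ?thesis by (simp add: mult.assoc)
qed

lemma a_FE_FE: "u \<in> CR \<Omega> \<T> \<Longrightarrow> v \<in> CR \<Omega> \<T> \<Longrightarrow> a_FE \<alpha> \<T> u v = FE u v"
  unfolding FE_def energy_form_def by (rule a_FE_eq[OF _ _ lip])

lemma a_FV_FV: "v \<in> CR \<Omega> \<T> \<Longrightarrow> a_FV \<alpha> \<Omega> \<T> z u (Ih_star \<Omega> \<T> z v) = FV u v"
  using a_FV_eq z_interior by (simp add: FV_def)

lemma norm_a_nrm: "u \<in> CR \<Omega> \<T> \<Longrightarrow> norm_a \<alpha> \<T> u = nrm u"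
  by (simp add: norm_a_def nrm_def a_FE_FE)

lemma CR_zero_if_mids_zero: "v \<in> CR \<Omega> \<T> \<Longrightarrow> (\<And>x. x \<in> mids \<T> \<Longrightarrow> v x = 0) \<Longrightarrow> v = (\<lambda>x. 0)"
  using CR_ext[OF _ zero_CR] by blast

lemma solution_ex1:
  assumes X: "bilinear_form_on (CR \<Omega> \<T>) X" "\<And>v. v \<in> CR \<Omega> \<T> \<Longrightarrow> v \<noteq> (\<lambda>x. 0) \<Longrightarrow> X v v > 0"
    and \<phi>: "linear_form_on (CR \<Omega> \<T>) \<phi>"
  shows "\<exists>!w. w \<in> VS i \<and> (\<forall>v\<in>VS i. X w v = \<phi> v)"
  by (rule lax_milgram[OF finite_mids V_space_subspace])
    (use CR_zero_if_mids_zero V_space_subset[of i] X \<phi> in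
      \<open>auto intro: bilinear_form_on_subset linear_form_on_subset\<close>)

lemma FV_pos: assumes "\<theta> < 1" "v \<in> CR \<Omega> \<T>" "v \<noteq> (\<lambda>x. 0)" shows "FV v v > 0"
proof -
  have "FV v v \<ge> FE v v - \<theta> * (nrm v)\<^sup>2"
    using FV_FE_error[OF assms(2,2)] by (simp add: power2_eq_square)
  moreover have "FE v v - \<theta> * (nrm v)\<^sup>2 = (1 - \<theta>) * FE v v"
    using nrm_sq[OF assms(2)] by (simp add: algebra_simps)
  moreover have "(1 - \<theta>) * FE v v > 0" using assms FE_pos by simp
  ultimately show ?thesis by linarith
qed

text \<open>Makes the definite descriptions \<open>T2\<close> and \<open>T3\<close> meaningful, by
  unique solvability on each space; \<open>X\<close> treats both operators at once.\<close>

lemma T_solves: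
  assumes \<theta>: "\<theta> < 1" and u: "u \<in> CR \<Omega> \<T>" and k: "k \<in> {2, 3}"
  defines "X \<equiv> if k = (2::nat) then FE else FV"
    and "T \<equiv> (\<lambda>i. (if k = 2 then T2 else T3) \<alpha> \<Omega> \<T> z N Om i u)"
  shows "T i \<in> VS i" "v \<in> VS i \<Longrightarrow> X (T i) v = FV u v"
proof -
  have \<phi>: "linear_form_on (CR \<Omega> \<T>) (FV u)" using FV_bilinear u unfolding bilinear_form_on_def by blast
  have "bilinear_form_on (CR \<Omega> \<T>) X" using FE_bilinear FV_bilinear by (simp add: X_def)
  moreover have "X v v > 0" if "v \<in> CR \<Omega> \<T>" "v \<noteq> (\<lambda>x. 0)" for v
    using FE_pos FV_pos[OF \<theta>] that by (simp add: X_def)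
  ultimately have ex1: "\<exists>!w. w \<in> VS i \<and> (\<forall>v\<in>VS i. X w v = FV u v)" for i
    by (rule solution_ex1[OF _ _ \<phi>])
  have C: "v \<in> CR \<Omega> \<T>" if "v \<in> VS i" for v i using that V_space_subset by blast
  have "T i = (THE w. w \<in> VS i \<and> (\<forall>v\<in>VS i. X w v = FV u v))" for i
  proof (cases "k = 2")
    case True
    have "(w \<in> VS i \<and> (\<forall>v\<in>VS i. a_FE \<alpha> \<T> w v = a_FV \<alpha> \<Omega> \<T> z u (Ih_star \<Omega> \<T> z v)))
       \<longleftrightarrow> (w \<in> VS i \<and> (\<forall>v\<in>VS i. X w v = FV u v))" for w
      using True C by (auto simp: X_def a_FE_FE a_FV_FV)
    then show ?thesis using True by (simp add: T_def T2_def)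
  next
    case False
    have "(w \<in> VS i \<and> (\<forall>v\<in>VS i. a_FV \<alpha> \<Omega> \<T> z w (Ih_star \<Omega> \<T> z v) = a_FV \<alpha> \<Omega> \<T> z u (Ih_star \<Omega> \<T> z v)))
       \<longleftrightarrow> (w \<in> VS i \<and> (\<forall>v\<in>VS i. X w v = FV u v))" for w
      using False C by (auto simp: X_def a_FV_FV)
    then show ?thesis using False by (simp add: T_def T3_def)
  qed
  then have "T i \<in> VS i \<and> (\<forall>v\<in>VS i. X (T i) v = FV u v)" using theI'[OF ex1] by simp
  then show "T i \<in> VS i" "v \<in> VS i \<Longrightarrow> X (T i) v = FV u v" by blast+
qed

lemma FE_by_subdomains:
  "FE u u = (\<Sum>i\<in>{1..N}. \<Sum>K\<in>mesh_on \<T> (Om i). coef_mass \<alpha> K * (norm (cr_grad u K))\<^sup>2)"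
  unfolding FE_def energy_form_def sum_mesh by (simp add: dot_square_norm)

lemma interpolant_stability:
  assumes u: "u \<in> CR \<Omega> \<T>"
    and Q: "\<And>i. i \<in> {1..N} \<Longrightarrow> (\<Sum>K\<in>mesh_on \<T> (Om i). coef_mass \<alpha> K * (norm (cr_grad (IA u) K))\<^sup>2)
      \<le> Q * (\<Sum>K\<in>mesh_on \<T> (Om i). coef_mass \<alpha> K * (norm (cr_grad u K))\<^sup>2)"
  shows "(nrm (IA u))\<^sup>2 \<le> Q * (nrm u)\<^sup>2"
  unfolding nrm_sq[OF u] nrm_sq[OF I_A_CR[OF u]] FE_by_subdomains sum_distrib_left
  by (rule sum_mono) (rule Q[unfolded sum_distrib_left])

definition \<beta> :: real where
  "\<beta> = (MAX i\<in>{1..N}. hi i / lo i * ((diameter (Om i))\<^sup>2 / (mesh_size (mesh_on \<T> (Om i)))\<^sup>2))"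

lemma N_pos: "{1..N} \<noteq> {}"
  using closure_\<Omega> \<Omega>_ne by (metis SUP_empty closure_eq_empty)

lemma \<beta>_upper: "i \<in> {1..N} \<Longrightarrow> hi i / lo i * ((diameter (Om i))\<^sup>2 / (mesh_size (mesh_on \<T> (Om i)))\<^sup>2) \<le> \<beta>"
  unfolding \<beta>_def by (intro Max_ge) auto

text \<open>Lets the additive constant of the abstract bound be absorbed into a multiple of
  \<open>\<beta>\<close>.\<close>

lemma \<beta>_ge_1: "\<beta> \<ge> 1"
proof -
  obtain i where i: "i \<in> {1..N}" using N_pos by blast
  then obtain \<Phi> where "subdomain_mesh \<T> (Om i) \<sigma> \<Phi>" using subdom by blast
  then interpret S: subdomain_mesh \<T> "Om i" \<sigma> \<Phi> .
  have "1 \<le> hi i / lo i" using lo_le_hi[OF i] by (simp add: le_divide_eq_1)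
  moreover have "1 \<le> (diameter (Om i))\<^sup>2 / (mesh_size (mesh_on \<T> (Om i)))\<^sup>2"
    using S.h_le_H S.h_pos by (simp add: le_divide_eq_1 power_mono)
  ultimately have "1 * 1 \<le> hi i / lo i * ((diameter (Om i))\<^sup>2 / (mesh_size (mesh_on \<T> (Om i)))\<^sup>2)"
    by (intro mult_mono) auto
  then show ?thesis using \<beta>_upper[OF i] by linarith
qed

lemma layer_stability:
  assumes u: "u \<in> CR \<Omega> \<T>"
  shows "(nrm (IA u))\<^sup>2 \<le> layer_const \<sigma> * \<beta> * (nrm u)\<^sup>2"
proof (rule interpolant_stability[OF u])
  fix i assume i: "i \<in> {1..N}"
  then obtain \<Phi> where "subdomain_mesh \<T> (Om i) \<sigma> \<Phi>" using subdom by blast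
  then interpret S: subdomain_mesh \<T> "Om i" \<sigma> \<Phi> .
  let ?E = "\<lambda>u. \<Sum>K\<in>mesh_on \<T> (Om i). coef_mass \<alpha> K * (norm (cr_grad u K))\<^sup>2"
  have KT: "K \<in> \<T>" if "K \<in> mesh_on \<T> (Om i)" for K using that mesh_on_subset by blast
  have "?E (IA u) \<le> S.C_layer * (hi i / lo i * ((diameter (Om i))\<^sup>2 / (mesh_size (mesh_on \<T> (Om i)))\<^sup>2)) * ?E u"
  proof (rule S.interpolant_layer_bound[OF u I_A_CR[OF u]])
    show "IA u x = u x" if "x \<in> cr_boundary \<T> (Om i)" for x using I_A_boundary[OF u i that] .
    show "IA u x = boundary_average \<T> (Om i) u" if "x \<in> cr_interior \<T> (Om i)" for x using I_A_interior[OF u i that] .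
    show "lo i * measure lebesgue K \<le> coef_mass \<alpha> K \<and> coef_mass \<alpha> K \<le> hi i * measure lebesgue K"
      if "K \<in> {K \<in> mesh_on \<T> (Om i). K \<inter> frontier (Om i) \<noteq> {}}" for K
      by (rule coef_mass_bounds[OF KT lip[OF KT]]) (use that lo_hi[OF i] in auto)
    show "0 < lo i" "lo i \<le> hi i" using lo_le_hi[OF i] by auto
    show "0 \<le> coef_mass \<alpha> K" if "K \<in> mesh_on \<T> (Om i)" for K using coef_mass_pos[OF KT[OF that]] by simp
  qed
  also have "\<dots> \<le> S.C_layer * \<beta> * ?E u"
  proof (rule mult_right_mono[OF mult_left_mono[OF \<beta>_upper[OF i]]])
    show "0 \<le> ?E u" using coef_mass_pos KT by (intro sum_nonneg mult_nonneg_nonneg) (auto intro: less_imp_le)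
  qed (use S.C_layer_pos in simp)
  finally show "?E (IA u) \<le> S.C_layer * \<beta> * ?E u" .
qed

text \<open>The local ratios H/h are replaced by a ratio in the global mesh size, with which
  \<open>\<theta>\<close> scales: a subdomain is no larger than the domain, and each of its
  triangles contains a ball of radius h/\<sigma>.\<close>

lemma ring_stability:
  assumes u: "u \<in> CR \<Omega> \<T>" and q: "q \<ge> 1" and A: "A \<ge> 1"
    and R: "R = diameter \<Omega> * \<sigma> / mesh_size \<T>"
  shows "(nrm (IA u))\<^sup>2 \<le> A * (8 * ring_const \<sigma> * \<sigma> ^ 6 * radial_const \<sigma> q * R
    + 4 * (ring_const \<sigma>)\<^sup>2 * \<sigma> ^ 6 * R\<^sup>2 / real q
    + layer_const \<sigma> * (3 * \<sigma> * real q)\<^sup>2) * (nrm u)\<^sup>2"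
proof (rule interpolant_stability[OF u])
  fix i assume i: "i \<in> {1..N}"
  then obtain \<Phi> where "subdomain_mesh \<T> (Om i) \<sigma> \<Phi>" using subdom by blast
  then interpret S: subdomain_mesh \<T> "Om i" \<sigma> \<Phi> .
  let ?E = "\<lambda>u. \<Sum>K\<in>mesh_on \<T> (Om i). coef_mass \<alpha> K * (norm (cr_grad u K))\<^sup>2"
  let ?H = "diameter (Om i)" and ?h = "mesh_size (mesh_on \<T> (Om i))"
  have KT: "K \<in> \<T>" if "K \<in> mesh_on \<T> (Om i)" for K using that mesh_on_subset by blast
  have HR: "?H / ?h \<le> R"
  proof -
    have "?H \<le> diameter \<Omega>" by (rule diameter_subset[OF sub_\<Omega>[OF i] bounded_\<Omega>])
    moreover have "mesh_size \<T> / \<sigma> \<le> ?h"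
    proof -
      obtain K where K: "K \<in> mesh_on \<T> (Om i)" using S.F_nonempty by blast
      then obtain x where x: "ball x (mesh_size \<T> / \<sigma>) \<subseteq> K" using quasi KT by blast
      have "diameter (ball x (mesh_size \<T> / \<sigma>)) \<le> diameter K"
        using x compact_imp_bounded[OF compact_tri[OF KT[OF K]]] by (rule diameter_subset)
      moreover have pos: "mesh_size \<T> / \<sigma> > 0" using mesh_size_pos \<sigma> by simp
      moreover have "diameter (ball x (mesh_size \<T> / \<sigma>)) = 2 * (mesh_size \<T> / \<sigma>)"
        by (simp only: diameter_ball order_less_not_sym[OF pos] if_False)
      ultimately show ?thesis using S.diameter_le_h[OF K] by linarith
    qed
    moreover have "mesh_size \<T> / \<sigma> > 0" using mesh_size_pos \<sigma> by simp
    ultimately have "?H / ?h \<le> diameter \<Omega> / (mesh_size \<T> / \<sigma>)"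
      using S.H_pos by (intro frac_le) auto
    then show ?thesis by (simp add: R)
  qed
  have H0: "?H / ?h \<ge> 0" using S.H_pos S.h_pos by simp
  have E0: "?E u \<ge> 0" using coef_mass_pos KT by (intro sum_nonneg mult_nonneg_nonneg) (auto intro: less_imp_le)
  have Cr: "S.C_radial q \<ge> 0" by (rule radial_const_nonneg)
  have "?E (IA u) \<le> A * (8 * S.C_ring * \<sigma> ^ 6 * S.C_radial q * (?H / ?h) + 4 * S.C_ring\<^sup>2 * \<sigma> ^ 6 * (?H / ?h)\<^sup>2 / real q
     + S.C_layer * (3 * \<sigma> * real q)\<^sup>2) * ?E u"
  proof (rule S.interpolant_ring_bound[OF u I_A_CR[OF u] _ _ _ A q])
    show "IA u x = u x" if "x \<in> cr_boundary \<T> (Om i)" for x using I_A_boundary[OF u i that] .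
    show "IA u x = boundary_average \<T> (Om i) u" if "x \<in> cr_interior \<T> (Om i)" for x using I_A_interior[OF u i that] .
    show "measure lebesgue K \<le> coef_mass \<alpha> K \<and> coef_mass \<alpha> K \<le> A * measure lebesgue K"
      if "K \<in> mesh_on \<T> (Om i)" for K using coef_mass_ge coef_mass_le KT[OF that] by blast
  qed
  also have "\<dots> \<le> A * (8 * S.C_ring * \<sigma> ^ 6 * S.C_radial q * R + 4 * S.C_ring\<^sup>2 * \<sigma> ^ 6 * R\<^sup>2 / real q
     + S.C_layer * (3 * \<sigma> * real q)\<^sup>2) * ?E u"
    using HR H0 E0 A Cr S.C_ring_pos \<sigma> power_mono[OF HR H0, of 2]
    by (intro mult_right_mono mult_left_mono add_mono divide_right_mono) auto
  finally show "?E (IA u) \<le> A * (8 * S.C_ring * \<sigma> ^ 6 * S.C_radial q * R + 4 * S.C_ring\<^sup>2 * \<sigma> ^ 6 * R\<^sup>2 / real q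
     + S.C_layer * (3 * \<sigma> * real q)\<^sup>2) * ?E u" .
qed

theorem additive_schwarz_bounds:
  assumes u: "u \<in> CR \<Omega> \<T>" and k: "k \<in> {2, 3}" and q: "q \<ge> 1" and A: "A \<ge> 1"
    and \<theta>: "\<theta> \<le> 1/8"
    and small: "32 * \<theta>\<^sup>2 * (3 * (A * (8 * ring_const \<sigma> * \<sigma> ^ 6 * radial_const \<sigma> q * (diameter \<Omega> * \<sigma> / mesh_size \<T>)
      + 4 * (ring_const \<sigma>)\<^sup>2 * \<sigma> ^ 6 * (diameter \<Omega> * \<sigma> / mesh_size \<T>)\<^sup>2 / real q
      + layer_const \<sigma> * (3 * \<sigma> * real q)\<^sup>2)) + 2) \<le> 1"
  shows "norm_a \<alpha> \<T> (T_A k \<alpha> \<Omega> \<T> z N Om u) \<le> 4 * norm_a \<alpha> \<T> u"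
    "a_FE \<alpha> \<T> (T_A k \<alpha> \<Omega> \<T> z N Om u) u
      \<ge> 1 / (4 * (3 * layer_const \<sigma> + 2)) * inverse \<beta> * a_FE \<alpha> \<T> u u"
proof -
  define X where "X = (if k = (2::nat) then FE else FV)"
  define x where "x = (if k = (2::nat) then energy_form else tri_flux \<alpha> \<T> z)"
  define T where "T i = (if k = 2 then T2 else T3) \<alpha> \<Omega> \<T> z N Om i u" for i
  have Xx: "X v w = (\<Sum>K\<in>\<T>. x v w K)" for v w by (simp add: X_def x_def FE_def FV_def)
  have lx: "local_form x" using local_energy_form local_flux_form by (simp add: x_def)
  have T: "T i \<in> VS i" "v \<in> VS i \<Longrightarrow> X (T i) v = FV u v" for i v
    using T_solves[OF _ u k] \<theta> unfolding T_def X_def by auto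
  define TW where "TW = (\<lambda>y. \<Sum>i\<in>{1..N}. T i y)"
  have TW: "TW \<in> W" unfolding TW_def by (rule sum_V_space_in_W[OF T(1)])
  have \<phi>: "linear_form_on (CR \<Omega> \<T>) (FV u)" using FV_bilinear u unfolding bilinear_form_on_def by blast
  have TWs: "X TW v = FV u v" if "v \<in> W" for v
    unfolding Xx TW_def by (rule solves_on_W[OF lx \<phi> T(1) _ that]) (simp add: T(2) flip: Xx)
  have TA: "T_A k \<alpha> \<Omega> \<T> z N Om u = lincomb 1 (T 0) 1 TW"
  proof
    fix y
    have "{0..N} = insert 0 {1..N}" by auto
    then show "T_A k \<alpha> \<Omega> \<T> z N Om u y = lincomb 1 (T 0) 1 TW y"
      by (simp add: T_A_def lincomb_def TW_def T_def)
  qed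
  define w where "w = lincomb 1 u (-1) (IA u)"
  have IAu: "IA u \<in> CR \<Omega> \<T>" by (rule I_A_CR[OF u])
  have V0: "IA u \<in> VS 0" using u by (simp add: V_space_def)
  have "w \<in> CR \<Omega> \<T>" unfolding w_def by (rule function_subspaceD[OF CR_subspace u IAu])
  moreover have "w x = 0" if "i \<in> {1..N}" "x \<in> cr_boundary \<T> (Om i)" for i x
    using I_A_boundary[OF u that] by (simp add: w_def lincomb_def)
  ultimately have wW: "w \<in> W" unfolding W_def by blast
  have ueq: "u = lincomb 1 (IA u) 1 w" by (simp add: w_def lincomb_def)
  have \<theta>0: "\<theta> \<ge> 0" using \<Lambda>_nonneg mesh_size_pos by (simp add: \<theta>_def add_nonneg_nonneg)
  have Xa: "\<bar>X v v' - FE v v'\<bar> \<le> \<theta> * nrm v * nrm v'" if "v \<in> CR \<Omega> \<T>" "v' \<in> CR \<Omega> \<T>" for v v'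
    using FV_FE_error[OF that] \<theta>0 nrm_nonneg[OF that(1)] nrm_nonneg[OF that(2)] by (auto simp: X_def)
  have CL: "layer_const \<sigma> > 0" using \<sigma> by (rule layer_const_pos)
  have Q0: "layer_const \<sigma> * \<beta> \<ge> 0" using CL \<beta>_ge_1 by simp
  \<comment> \<open>\<open>Q\<close> is the layer bound, which determines the final constant, and
    \<open>Q'\<close> the ring bound, which only has to satisfy the smallness hypothesis.\<close>
  note S = schwarz_two_subspaces[OF u V0 wW V_space_subset W_subset ueq T(1) TW T(2) TWs FV_bilinear
      FV_FE_error Xa \<theta>0 \<theta> Q0 layer_stability[OF u] ring_stability[OF u q A refl] small]
  have C: "lincomb 1 (T 0) 1 TW \<in> CR \<Omega> \<T>"
    using function_subspaceD[OF CR_subspace] T(1)[of 0] V_space_subset TW W_subset by blast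
  show "norm_a \<alpha> \<T> (T_A k \<alpha> \<Omega> \<T> z N Om u) \<le> 4 * norm_a \<alpha> \<T> u"
    using S(1) unfolding TA norm_a_nrm[OF C] norm_a_nrm[OF u] .
  have "1 / (4 * (3 * layer_const \<sigma> + 2)) * inverse \<beta> * (nrm u)\<^sup>2
      \<le> (nrm u)\<^sup>2 / (4 * (3 * (layer_const \<sigma> * \<beta>) + 2))"
  proof -
    have "4 * (3 * (layer_const \<sigma> * \<beta>) + 2) \<le> 4 * (3 * layer_const \<sigma> + 2) * \<beta>"
      using \<beta>_ge_1 by (simp add: algebra_simps)
    moreover have "0 < 4 * (3 * (layer_const \<sigma> * \<beta>) + 2)" using Q0 by simp
    ultimately have "(nrm u)\<^sup>2 / (4 * (3 * layer_const \<sigma> + 2) * \<beta>) \<le> (nrm u)\<^sup>2 / (4 * (3 * (layer_const \<sigma> * \<beta>) + 2))"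
      by (intro divide_left_mono) (auto intro: mult_pos_pos)
    then show ?thesis by (simp add: divide_inverse mult_ac)
  qed
  then show "a_FE \<alpha> \<T> (T_A k \<alpha> \<Omega> \<T> z N Om u) u
      \<ge> 1 / (4 * (3 * layer_const \<sigma> + 2)) * inverse \<beta> * a_FE \<alpha> \<T> u u"
    using S(2) unfolding TA a_FE_FE[OF C u] a_FE_FE[OF u u] nrm_sq[OF u] by linarith
qed

end

section \<open>From the given data to the estimates, and the threshold\<close>

lemma coefficient_lipschitz:
  assumes "coefficient n D M \<alpha>0 \<alpha>" "nonoverlapping_partition \<Omega> n D" "j \<in> {1..n}" "convex U" "U \<subseteq> D j"
  shows "(24 * exp 8 * \<bar>M\<bar>)-lipschitz_on U \<alpha>"
  using assms
  by (intro W1inf_lipschitz_on_convex[of "D j"])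
    (auto simp: coefficient_def nonoverlapping_partition_def lipschitz_polytope_def)

text \<open>The bound depends on \<alpha>, as essential boundedness on each of finitely many pieces
  comes without a uniform constant; so it may influence the threshold but not the two
  constants.\<close>

lemma coefficient_bounded:
  assumes c: "coefficient n D M \<alpha>0 \<alpha>" and D: "nonoverlapping_partition \<Omega> n D"
  obtains A where "A \<ge> 1" "\<And>j x. j \<in> {1..n} \<Longrightarrow> x \<in> D j \<Longrightarrow> 1 \<le> \<alpha> x \<and> \<alpha> x \<le> A"
proof -
  have "\<exists>B. \<forall>x\<in>D j. \<bar>\<alpha> x\<bar> \<le> B" if j: "j \<in> {1..n}" for j
  proof -
    obtain B where "AE x in lebesgue_on (D j). \<bar>\<alpha> x\<bar> \<le> B"
      using c j unfolding coefficient_def W1inf_seminorm_le_def Linf_norm_le_def by blast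
    moreover have "open (D j)" "continuous_on (D j) \<alpha>"
      using c D j by (auto simp: coefficient_def nonoverlapping_partition_def lipschitz_polytope_def)
    ultimately show ?thesis using AE_bound_imp_bound_on_open by blast
  qed
  then obtain B where B: "\<And>j x. j \<in> {1..n} \<Longrightarrow> x \<in> D j \<Longrightarrow> \<bar>\<alpha> x\<bar> \<le> B j" by metis
  define A where "A = 1 + (\<Sum>j\<in>{1..n}. \<bar>B j\<bar>)"
  have "1 \<le> \<alpha> x \<and> \<alpha> x \<le> A" if j: "j \<in> {1..n}" "x \<in> D j" for j x
  proof -
    have "\<bar>B j\<bar> \<le> (\<Sum>j\<in>{1..n}. \<bar>B j\<bar>)" using j by (intro member_le_sum) auto
    moreover have "1 \<le> \<alpha> x" using c j unfolding coefficient_def by force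
    ultimately show ?thesis using B[OF j] by (simp add: A_def)
  qed
  moreover have "A \<ge> 1" by (simp add: A_def sum_nonneg)
  ultimately show ?thesis using that by blast
qed

lemma (in subdomain_mesh) layer_nonempty: "\<exists>K\<in>F. K \<inter> frontier S \<noteq> {}"
proof -
  have "(axis 1 1 :: point) \<in> sphere 0 1" by simp
  then have "\<Phi> (axis 1 1) \<in> frontier S" unfolding frontier_eq by (rule imageI)
  then show ?thesis using Union_F frontier_subset_closure by blast
qed

lemma subdomain_meshI:
  assumes "triangle_mesh \<T>" and sub: "subdomains \<sigma> \<Omega> \<T> N Om" and i: "i \<in> {1..N}"
    and \<Omega>: "bounded \<Omega>" "closure \<Omega> = \<Union>\<T>" and \<sigma>: "\<sigma> > 0"
  shows "\<exists>\<Phi>. subdomain_mesh \<T> (Om i) \<sigma> \<Phi>"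
proof -
  have p: "lipschitz_polytope (Om i)" "Om i \<subseteq> \<Omega>" "aligned \<T> (Om i)" "quasiuniform \<sigma> (mesh_on \<T> (Om i))"
    using sub i by (auto simp: subdomains_def nonoverlapping_partition_def)
  obtain \<Phi> where \<Phi>: "\<Phi> ` cball (0::point) 1 = closure (Om i)"
    "\<forall>x\<in>cball 0 1. \<forall>y\<in>cball 0 1. diameter (Om i) / \<sigma> * dist x y \<le> dist (\<Phi> x) (\<Phi> y) \<and>
           dist (\<Phi> x) (\<Phi> y) \<le> \<sigma> * diameter (Om i) * dist x y"
    using sub i unfolding subdomains_def coarse_shape_regular_def by blast
  have "subdomain_mesh_axioms \<T> (Om i) \<sigma> \<Phi>"
  proof
    show "Om i \<subseteq> \<Union>\<T>" using p(2) \<Omega>(2) closure_subset by blast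
    show "bounded (Om i)" using p(2) \<Omega>(1) bounded_subset by blast
    show "\<exists>x. ball x (mesh_size (mesh_on \<T> (Om i)) / \<sigma>) \<subseteq> K" if "K \<in> mesh_on \<T> (Om i)" for K
      using p(4) that by (simp add: quasiuniform_def)
  qed (use p \<Phi> \<sigma> in auto)
  then show ?thesis using assms(1) by (auto simp: subdomain_mesh_def)
qed

text \<open>By alignment every open triangle lies in a single piece of the coefficient partition.
  There \<alpha> is Lipschitz, and its values in layer triangles take part in the supremum and
  infimum over the layer.\<close>

lemma weighted_decompositionI:
  assumes \<Omega>: "polygonal_domain \<Omega>" and D: "nonoverlapping_partition \<Omega> n D" and \<sigma>: "\<sigma> > 0"
    and c: "coefficient n D M \<alpha>0 \<alpha>"
    and A: "\<And>j x. j \<in> {1..n} \<Longrightarrow> x \<in> D j \<Longrightarrow> 1 \<le> \<alpha> x \<and> \<alpha> x \<le> A"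
    and mesh: "fine_mesh \<sigma> \<Omega> n D \<T>" and z: "\<forall>K\<in>\<T>. z K \<in> interior K"
    and sub: "subdomains \<sigma> \<Omega> \<T> N Om"
  shows "weighted_decomposition \<T> \<Omega> N Om \<alpha> z \<sigma> (24 * exp 8 * \<bar>M\<bar>) A
    (\<lambda>i. alpha_inf n D \<alpha> \<T> (Om i)) (\<lambda>i. alpha_sup n D \<alpha> \<T> (Om i))"
proof -
  interpret triangle_mesh \<T>
    using mesh by unfold_locales (auto simp: fine_mesh_def)
  have b\<Omega>: "bounded \<Omega>"
    using \<Omega> bounded_subset[OF polytope_imp_bounded[of "closure \<Omega>"] closure_subset] by (simp add: polygonal_domain_def)
  have U: "\<Union>\<T> = closure \<Omega>" using mesh by (simp add: fine_mesh_def)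
  interpret domain_mesh \<T> \<Omega>
    using \<Omega> b\<Omega> U by unfold_locales (auto simp: polygonal_domain_def)
  interpret domain_decomposition \<T> \<Omega> N Om
    using sub by unfold_locales (auto simp: subdomains_def nonoverlapping_partition_def)
  have piece: "\<exists>j\<in>{1..n}. interior K \<subseteq> D j" if K: "K \<in> \<T>" for K
  proof -
    obtain x where x: "x \<in> interior K" using interior_tri[OF K] by blast
    then have "x \<in> closure \<Omega>" using K U interior_subset by blast
    then obtain j where j: "j \<in> {1..n}" "x \<in> closure (D j)" using D by (auto simp: nonoverlapping_partition_def)
    then have "interior K \<inter> D j \<noteq> {}" using x open_Int_closure_eq_empty[OF open_interior, of K "D j"] by blast
    moreover have "open (D j)" "aligned \<T> (D j)"
      using D mesh j by (auto simp: nonoverlapping_partition_def lipschitz_polytope_def fine_mesh_def)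
    ultimately show ?thesis using interior_subset_or_disjoint[OF _ _ K] j(1) by blast
  qed
  let ?L = "\<lambda>i. boundary_layer \<T> (Om i) \<inter> (\<Union>j\<in>{1..n}. D j)"
  have bdd: "bdd_above (\<alpha> ` ?L i)" "bdd_below (\<alpha> ` ?L i)" for i
    using A by (auto intro!: bdd_aboveI[of _ A] bdd_belowI[of _ 1])
  have in_layer: "x \<in> ?L i"
    if "K \<in> mesh_on \<T> (Om i)" "K \<inter> frontier (Om i) \<noteq> {}" "x \<in> interior K" for i K x
  proof -
    have "K \<in> \<T>" using that(1) mesh_on_subset by blast
    then show ?thesis using piece[of K] that interior_subset unfolding boundary_layer_def by blast
  qed
  have tm: "triangle_mesh \<T>" by (rule triangle_mesh_axioms)
  have sd: "\<exists>\<Phi>. subdomain_mesh \<T> (Om i) \<sigma> \<Phi>" if "i \<in> {1..N}" for i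
    by (rule subdomain_meshI[OF tm sub that b\<Omega> U[symmetric] \<sigma>])
  show ?thesis
  proof
    show "(24 * exp 8 * \<bar>M\<bar>)-lipschitz_on (interior K) \<alpha>" if "K \<in> \<T>" for K
      using piece[OF that] coefficient_lipschitz[OF c D _ convex_interior[OF convex_tri[OF that]]] by blast
    show "1 \<le> \<alpha> x \<and> \<alpha> x \<le> A" if "K \<in> \<T>" "x \<in> interior K" for K x
      using piece[OF that(1)] that(2) A by blast
    show "z K \<in> interior K" if "K \<in> \<T>" for K using z that by blast
    show "\<exists>x. ball x (mesh_size \<T> / \<sigma>) \<subseteq> K" if "K \<in> \<T>" for K
      using mesh that by (simp add: fine_mesh_def quasiuniform_def)
    show "alpha_inf n D \<alpha> \<T> (Om i) \<le> \<alpha> x \<and> \<alpha> x \<le> alpha_sup n D \<alpha> \<T> (Om i)"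
      if "i \<in> {1..N}" "K \<in> mesh_on \<T> (Om i)" "K \<inter> frontier (Om i) \<noteq> {}" "x \<in> interior K" for i K x
      unfolding alpha_inf_def alpha_sup_def
      using cINF_lower[OF bdd(2)] cSUP_upper[OF _ bdd(1)] in_layer[OF that(2-4)] by blast
    show "1 \<le> alpha_inf n D \<alpha> \<T> (Om i) \<and> alpha_inf n D \<alpha> \<T> (Om i) \<le> alpha_sup n D \<alpha> \<T> (Om i)"
      if i: "i \<in> {1..N}" for i
    proof -
      obtain \<Phi> where "subdomain_mesh \<T> (Om i) \<sigma> \<Phi>" using sd[OF i] by blast
      then interpret S: subdomain_mesh \<T> "Om i" \<sigma> \<Phi> .
      obtain K where K: "K \<in> mesh_on \<T> (Om i)" "K \<inter> frontier (Om i) \<noteq> {}" using S.layer_nonempty by blast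
      obtain x where "x \<in> interior K" using interior_tri K(1) mesh_on_subset by blast
      then have x: "x \<in> ?L i" by (rule in_layer[OF K])
      have "1 \<le> alpha_inf n D \<alpha> \<T> (Om i)"
        unfolding alpha_inf_def by (rule cINF_greatest) (use x A in blast)+
      moreover have "alpha_inf n D \<alpha> \<T> (Om i) \<le> \<alpha> x" "\<alpha> x \<le> alpha_sup n D \<alpha> \<T> (Om i)"
        unfolding alpha_inf_def alpha_sup_def using cINF_lower[OF bdd(2) x] cSUP_upper[OF x bdd(1)] by auto
      ultimately show ?thesis by linarith
    qed
  qed (use \<sigma> sd in auto)
qed

theorem theorem4p7:
  fixes \<Omega> :: "point set" and D :: "nat \<Rightarrow> point set" and n :: nat and M \<sigma> :: real
  assumes "polygonal_domain \<Omega>"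
    and "nonoverlapping_partition \<Omega> n D"
    and "\<sigma> > 0"
  shows "\<exists>C>0. \<exists>c>0. \<forall>\<alpha>0 \<alpha>. coefficient n D M \<alpha>0 \<alpha> \<longrightarrow>
    (\<exists>h0>0. \<forall>\<T> z N Om.
       fine_mesh \<sigma> \<Omega> n D \<T> \<longrightarrow> (\<forall>K\<in>\<T>. z K \<in> interior K) \<longrightarrow>
       subdomains \<sigma> \<Omega> \<T> N Om \<longrightarrow> mesh_size \<T> < h0 \<longrightarrow>
       (\<forall>k\<in>{2,3}. \<forall>u\<in>CR \<Omega> \<T>.
          norm_a \<alpha> \<T> (T_A k \<alpha> \<Omega> \<T> z N Om u) \<le> C * norm_a \<alpha> \<T> u \<and>
          a_FE \<alpha> \<T> (T_A k \<alpha> \<Omega> \<T> z N Om u) u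
            \<ge> c * inverse (condition_factor n D \<alpha> \<T> N Om) * a_FE \<alpha> \<T> u u))"
proof -
  define C where "C = (4::real)"
  define c where "c = 1 / (4 * (3 * layer_const \<sigma> + 2))"
  have c0: "c > 0" using layer_const_pos[OF assms(3)] by (simp add: c_def)
  have C0: "C > 0" by (simp add: C_def)
  \<comment> \<open>The factor of h in \<open>\<theta>\<close>.\<close>
  define c1 where "c1 = 24 * exp 8 * \<bar>M\<bar> * (1 + \<sigma>\<^sup>2 / 2)"
  have c1: "c1 \<ge> 0" by (simp add: c1_def add_nonneg_nonneg)
  define d where "d = diameter \<Omega> * \<sigma>"
  have "bounded \<Omega>"
    using assms(1) bounded_subset[OF polytope_imp_bounded[of "closure \<Omega>"] closure_subset] by (simp add: polygonal_domain_def)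
  then have d: "d \<ge> 0" using assms(3) diameter_ge_0[of \<Omega>] by (simp add: d_def)
  have rp: "ring_const \<sigma> > 0" by (rule ring_const_pos[OF assms(3)])
  have lp: "layer_const \<sigma> > 0" by (rule layer_const_pos[OF assms(3)])
  have "\<exists>h0>0. \<forall>\<T> z N Om.
       fine_mesh \<sigma> \<Omega> n D \<T> \<longrightarrow> (\<forall>K\<in>\<T>. z K \<in> interior K) \<longrightarrow>
       subdomains \<sigma> \<Omega> \<T> N Om \<longrightarrow> mesh_size \<T> < h0 \<longrightarrow>
       (\<forall>k\<in>{2,3}. \<forall>u\<in>CR \<Omega> \<T>.
          norm_a \<alpha> \<T> (T_A k \<alpha> \<Omega> \<T> z N Om u) \<le> C * norm_a \<alpha> \<T> u \<and>
          a_FE \<alpha> \<T> (T_A k \<alpha> \<Omega> \<T> z N Om u) u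
            \<ge> c * inverse (condition_factor n D \<alpha> \<T> N Om) * a_FE \<alpha> \<T> u u)"
    if coef: "coefficient n D M \<alpha>0 \<alpha>" for \<alpha>0 \<alpha>
  proof -
    obtain A where A: "A \<ge> 1" "\<And>j x. j \<in> {1..n} \<Longrightarrow> x \<in> D j \<Longrightarrow> 1 \<le> \<alpha> x \<and> \<alpha> x \<le> A"
      using coefficient_bounded[OF coef assms(2)] by blast
    \<comment> \<open>The part of the smallness condition that does not decay with h, before
      division by \<open>q\<close>: the squared perturbation cancels the squared ratio
      diam(\<Omega>)/h.\<close>
    define a2 where "a2 = 32 * c1\<^sup>2 * (3 * (A * (4 * (ring_const \<sigma>)\<^sup>2 * \<sigma> ^ 6 * d\<^sup>2)))"
    \<comment> \<open>Large enough to push that part to at most 1/2; the summand 1 keeps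
      \<open>q\<close> positive if \<open>a2\<close> is 0.\<close>
    define q where "q = nat \<lceil>2 * a2\<rceil> + 1"
    have q: "q \<ge> 1" "2 * a2 \<le> real q" by (simp_all add: q_def) linarith
    define a1 where "a1 = 32 * c1\<^sup>2 * (3 * (A * (8 * ring_const \<sigma> * \<sigma> ^ 6 * radial_const \<sigma> q * d)))"
    define a3 where "a3 = 32 * c1\<^sup>2 * (3 * (A * (layer_const \<sigma> * (3 * \<sigma> * real q)\<^sup>2)) + 2)"
    have a1: "a1 \<ge> 0" using rp assms(3) radial_const_nonneg A d by (simp add: a1_def)
    have a3: "a3 \<ge> 0" using lp A by (simp add: a3_def)
    \<comment> \<open>Three demands: h at most 1, so that h^2 is at most h; (a1 + a3) h at most 1/2;
      and c1 h at most 1/8. The summands 1 in the denominators exclude division by 0.\<close>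
    define h0 where "h0 = min 1 (min (1 / (2 * (a1 + a3) + 1)) (1 / (8 * c1 + 1)))"
    have h0: "h0 > 0" using a1 a3 c1 by (simp add: h0_def)
    show ?thesis
    proof (intro exI[of _ h0] conjI h0 allI impI ballI)
      fix \<T> z N Om k u
      assume mesh: "fine_mesh \<sigma> \<Omega> n D \<T>" and z: "\<forall>K\<in>\<T>. z K \<in> interior K"
        and sub: "subdomains \<sigma> \<Omega> \<T> N Om" and small: "mesh_size \<T> < h0" and k: "k \<in> {2, 3::nat}" and u: "u \<in> CR \<Omega> \<T>"
      interpret weighted_decomposition \<T> \<Omega> N Om \<alpha> z \<sigma> "24 * exp 8 * \<bar>M\<bar>" A
        "\<lambda>i. alpha_inf n D \<alpha> \<T> (Om i)" "\<lambda>i. alpha_sup n D \<alpha> \<T> (Om i)"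
        by (rule weighted_decompositionI[OF assms coef A(2) mesh z sub])
      define h where "h = mesh_size \<T>"
      have h: "0 < h" "h \<le> 1" "h * (2 * (a1 + a3) + 1) \<le> 1" "h * (8 * c1 + 1) \<le> 1"
        using mesh_size_pos small a1 a3 c1 by (auto simp: h_def h0_def pos_less_divide_eq less_imp_le)
      have \<theta>: "\<theta> = c1 * h" by (simp add: \<theta>_def c1_def h_def)
      have \<theta>8: "\<theta> \<le> 1/8" unfolding \<theta> using h(1,4) by (simp add: algebra_simps)
      have "32 * \<theta>\<^sup>2 * (3 * (A * (8 * ring_const \<sigma> * \<sigma> ^ 6 * radial_const \<sigma> q * (d / h)
          + 4 * (ring_const \<sigma>)\<^sup>2 * \<sigma> ^ 6 * (d / h)\<^sup>2 / real q + layer_const \<sigma> * (3 * \<sigma> * real q)\<^sup>2)) + 2)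
        = a1 * h + a2 / real q + a3 * h\<^sup>2"
        using h(1) unfolding a1_def a2_def a3_def \<theta> by (simp add: field_simps power2_eq_square)
      also have "\<dots> \<le> (a1 + a3) * h + 1/2"
      proof -
        have "a2 / real q \<le> 1/2" using q by (simp add: divide_le_eq)
        moreover have "a3 * h\<^sup>2 \<le> a3 * h" using h a3 by (intro mult_left_mono) (simp_all add: power2_eq_square mult_left_le)
        ultimately show ?thesis unfolding distrib_right by linarith
      qed
      also have "\<dots> \<le> 1" using h(1,3) by (simp add: algebra_simps)
      finally have sm: "32 * \<theta>\<^sup>2 * (3 * (A * (8 * ring_const \<sigma> * \<sigma> ^ 6 * radial_const \<sigma> q * (diameter \<Omega> * \<sigma> / mesh_size \<T>)
          + 4 * (ring_const \<sigma>)\<^sup>2 * \<sigma> ^ 6 * (diameter \<Omega> * \<sigma> / mesh_size \<T>)\<^sup>2 / real q + layer_const \<sigma> * (3 * \<sigma> * real q)\<^sup>2)) + 2) \<le> 1"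
        unfolding d_def h_def .
      have \<beta>: "condition_factor n D \<alpha> \<T> N Om = \<beta>" by (simp add: condition_factor_def \<beta>_def)
      show "norm_a \<alpha> \<T> (T_A k \<alpha> \<Omega> \<T> z N Om u) \<le> C * norm_a \<alpha> \<T> u"
        using additive_schwarz_bounds(1)[OF u k q(1) A(1) \<theta>8 sm] by (simp add: C_def)
      show "c * inverse (condition_factor n D \<alpha> \<T> N Om) * a_FE \<alpha> \<T> u u \<le> a_FE \<alpha> \<T> (T_A k \<alpha> \<Omega> \<T> z N Om u) u"
        using additive_schwarz_bounds(2)[OF u k q(1) A(1) \<theta>8 sm] by (simp only: c_def \<beta>)
    qed
  qed
  then show ?thesis using C0 c0 by blast
qed

end
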